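(* Assume that $(\mathcal E,\operatorname{Dom}\mathcal E)$ has Hino index $1$ and that $\mu=\nu_\omega$ for some harmonic form $\omega\in\mathcal H$. Then, for every $f,g\in\operatorname{Dom}\mathcal E$, $$\langle f,\star\partial g\rangle_2=-\langle\star\partial f,g\rangle_2 .$$ Therefore $(\mathcal E^\perp,\operatorname{Dom}\mathcal E^\perp)$ is an extension of $(\mathcal E,\operatorname{Dom}\mathcal E)$, i.e. $\operatorname{Dom}\mathcal E\subset\operatorname{Dom}\mathcal E^\perp$ and $\mathcal E^\perp=\mathcal E$ on $\operatorname{Dom}\mathcal E$.
   Context: Setting. $(X,d)$ is a locally compact separable metric space and $\mu$ is a locally finite Borel measure on $X$ with $\mu(U)>0$ for every nonempty open $U$. $(\mathcal E,\operatorname{Dom}\mathcal E)$ is a symmetric, strictly local (i.e. strongly local: $\mathcal E(f,g)=0$ whenever $f,g\in\operatorname{Dom}\mathcal E$ have compact support and $g$ is constant on a neighbourhood of $\operatorname{supp} f$), regular Dirichlet form on $L^2(X,\mu)$ admitting a carré du champ $\Gamma$: a symmetric bilinear positive map $\operatorname{Dom}\mathcal E\times\operatorname{Dom}\mathcal E\to L^1(X,\mu)$ with $\mathcal E(f,g)=\int\Gamma(f,g)\,d\mu$ and $2\int h\,\Gamma(f,g)\,d\mu=\mathcal E(fh,g)+\mathcal E(gh,f)-\mathcal E(fg,h)$ for bounded $f,g,h\in\operatorname{Dom}\mathcal E$. One-forms. With $\mathcal B_b(X)$ the bounded Borel functions and $\mathcal C=C_b(X)\cap\operatorname{Dom}\mathcal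 E$, $\mathcal H$ is the Hilbert space obtained from $\mathcal C\otimes\mathcal B_b(X)$ with the form $\langle f_1\otimes g_1,f_2\otimes g_2\rangle_{\mathcal H}=\int g_1g_2\Gamma(f_1,f_2)\,d\mu$ by quotienting out zero-seminorm elements and completing. Multiplication by $a\in\mathcal B_b(X)$ is $(f\otimes g)\cdot a=f\otimes(ga)$. $\partial f=f\otimes\mathbf 1$, extended to a closed densely defined operator $\partial:L^2(X,\mu)\to\mathcal H$ with domain $\operatorname{Dom}\mathcal E$; $\partial^*$ is its adjoint. $\mathcal H$ is isometric to a direct integral $\int^\oplus_X\mathcal H_x\,d\mu(x)$ with fibre inner products determined by $\langle f_1\otimes g_1,f_2\otimes g_2\rangle_{\mathcal H_x}=g_1(x)g_2(x)\Gamma(f_1,f_2)(x)$. Hino index. The pointwise Hino index $p(x)$ is the ($\mu$-a.e.) smallest function such that for all $N$ and $f_1,\dots,f_N\in\operatorname{Dom}\mathcal E$ the matrix $(\Gamma(f_i,f_j)(x))_{i,j}$ has rank at most $p(x)$ a.e.; equivalently $p(x)=\dim\mathcal H_x$ a.e. The Hino index is the $\mu$-essential supremum of $p$. Hodge star. For $\omega\in\mathcal H$, $\nu_\omega$ is the measure with $\int\phi\,d\nu_\omega=\langle\omega\cdot\phi,\omega\rangle_{\mathcal H}$ for $\phi\in C_b(X)$; $\mu=\nu_\omega$ means $\|\omega\|_{\mathcal H_x}=1$ a.e. When the Hino index is $1$ and $\mu=\nu_\omega$, the Hodge star $\star:L^2(X,\mu)\to\mathcal H$ is the isometric bijection $(\star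 f)_x=f(x)\omega_x$, and $\star$ also denotes its inverse, $\star(\omega\cdot f)=f$. A form $\omega\in\mathcal H$ is harmonic if $\omega\in\operatorname{Dom}\partial^*$ and $\partial^*\omega=0$. $\mathcal E^\perp(f,g)=\langle\partial^*\star f,\partial^*\star g\rangle_2$ with $\operatorname{Dom}\mathcal E^\perp=\{f\in L^2(X,\mu):\star f\in\operatorname{Dom}\partial^*\}$. *)

theory Defs
  imports
    "HOL-Probability.Probability"
    "Jordan_Normal_Form.DL_Rank"
begin

text \<open>
  Elements of $L^2(X,\mu)$ are represented by square integrable Borel functions on \<open>X\<close>, and
  equality in $L^2$ by equality almost everywhere. All spaces are real.
\<close>

definition L2 :: "'a measure \<Rightarrow> ('a \<Rightarrow> real) set" where
  "L2 M = {f \<in> borel_measurable M. integrable M (\<lambda>x. (f x)\<^sup>2)}"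

definition l2_inner :: "'a measure \<Rightarrow> ('a \<Rightarrow> real) \<Rightarrow> ('a \<Rightarrow> real) \<Rightarrow> real" where
  "l2_inner M f g = (\<integral>x. f x * g x \<partial>M)"

definition l2_norm :: "'a measure \<Rightarrow> ('a \<Rightarrow> real) \<Rightarrow> real" where
  "l2_norm M f = sqrt (l2_inner M f f)"

definition metric_measure_setting :: "'a::metric_space measure \<Rightarrow> bool" where
  "metric_measure_setting M \<longleftrightarrow>
     locally_compact_space (euclidean :: 'a topology) \<and>
     separable_space (euclidean :: 'a topology) \<and>
     sets M = sets borel \<and>
     (\<forall>x. \<exists>U. open U \<and> x \<in> U \<and> emeasure M U < \<infinity>) \<and>
     (\<forall>U. open U \<longrightarrow> U \<noteq> {} \<longrightarrow> emeasure M U > 0)"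


subsection \<open>Dirichlet forms\<close>

definition E1_norm ::
  "'a measure \<Rightarrow> (('a \<Rightarrow> real) \<Rightarrow> ('a \<Rightarrow> real) \<Rightarrow> real) \<Rightarrow> ('a \<Rightarrow> real) \<Rightarrow> real" where
  "E1_norm M E f = sqrt (E f f + l2_inner M f f)"

text \<open>
  \<open>D\<close> is the domain of the form \<open>E\<close>. Since its elements are functions and not classes, \<open>D\<close> and
  \<open>E\<close> are required to be compatible with almost everywhere equality; the values of \<open>E\<close> outside
  \<open>D\<close> are irrelevant.
\<close>

definition dirichlet_form ::
  "'a measure \<Rightarrow> ('a \<Rightarrow> real) set \<Rightarrow> (('a \<Rightarrow> real) \<Rightarrow> ('a \<Rightarrow> real) \<Rightarrow> real) \<Rightarrow> bool" where
  "dirichlet_form M D E \<longleftrightarrow>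
     \<comment> \<open>densely defined in $L^2$\<close>
     D \<subseteq> L2 M \<and>
     (\<forall>f\<in>D. \<forall>g\<in>borel_measurable M. (AE x in M. f x = g x) \<longrightarrow> g \<in> D) \<and>
     (\<lambda>x. 0) \<in> D \<and>
     (\<forall>f\<in>D. \<forall>g\<in>D. \<forall>a b. (\<lambda>x. a * f x + b * g x) \<in> D) \<and>
     (\<forall>f\<in>L2 M. \<forall>\<epsilon>>0. \<exists>g\<in>D. l2_norm M (\<lambda>x. g x - f x) < \<epsilon>) \<and>
     \<comment> \<open>symmetric, bilinear, nonnegative\<close>
     (\<forall>f\<in>D. \<forall>g\<in>D. \<forall>h\<in>D. (AE x in M. f x = g x) \<longrightarrow> E f h = E g h) \<and>
     (\<forall>f\<in>D. \<forall>g\<in>D. E f g = E g f) \<and>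
     (\<forall>f\<in>D. \<forall>g\<in>D. \<forall>h\<in>D. \<forall>a b. E (\<lambda>x. a * f x + b * g x) h = a * E f h + b * E g h) \<and>
     (\<forall>f\<in>D. E f f \<ge> 0) \<and>
     \<comment> \<open>closed\<close>
     (\<forall>u. (\<forall>n. u n \<in> D) \<and>
          (\<forall>\<epsilon>>0. \<exists>K::nat. \<forall>m\<ge>K. \<forall>n\<ge>K. E1_norm M E (\<lambda>x. u m x - u n x) < \<epsilon>) \<longrightarrow>
        (\<exists>f\<in>D. (\<lambda>n. E1_norm M E (\<lambda>x. u n x - f x)) \<longlonglongrightarrow> 0)) \<and>
     \<comment> \<open>Markovian\<close>
     (\<forall>f\<in>D. (\<lambda>x. min 1 (max 0 (f x))) \<in> D \<and>
        E (\<lambda>x. min 1 (max 0 (f x))) (\<lambda>x. min 1 (max 0 (f x))) \<le> E f f)"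

definition Cc :: "('a::metric_space \<Rightarrow> real) set" where
  "Cc = {f. continuous_on UNIV f \<and> compact (closure {x. f x \<noteq> 0})}"

definition regular_form ::
  "'a::metric_space measure \<Rightarrow> ('a \<Rightarrow> real) set \<Rightarrow> (('a \<Rightarrow> real) \<Rightarrow> ('a \<Rightarrow> real) \<Rightarrow> real) \<Rightarrow> bool" where
  "regular_form M D E \<longleftrightarrow>
     (\<forall>f\<in>D. \<forall>\<epsilon>>0. \<exists>g\<in>Cc \<inter> D. E1_norm M E (\<lambda>x. g x - f x) < \<epsilon>) \<and>
     (\<forall>f\<in>Cc. \<forall>\<epsilon>>0. \<exists>g\<in>Cc \<inter> D. \<forall>x. \<bar>g x - f x\<bar> < \<epsilon>)"

text \<open>
  The support of a class of functions: the smallest closed set off which the function vanishes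
  almost everywhere.
\<close>

definition ess_supp :: "'a::metric_space measure \<Rightarrow> ('a \<Rightarrow> real) \<Rightarrow> 'a set" where
  "ess_supp M f = \<Inter>{F. closed F \<and> (AE x in M. x \<notin> F \<longrightarrow> f x = 0)}"

definition strongly_local ::
  "'a::metric_space measure \<Rightarrow> ('a \<Rightarrow> real) set \<Rightarrow> (('a \<Rightarrow> real) \<Rightarrow> ('a \<Rightarrow> real) \<Rightarrow> real) \<Rightarrow> bool" where
  "strongly_local M D E \<longleftrightarrow>
     (\<forall>f\<in>D. \<forall>g\<in>D. compact (ess_supp M f) \<and> compact (ess_supp M g) \<and>
        (\<exists>U c. open U \<and> ess_supp M f \<subseteq> U \<and> (AE x in M. x \<in> U \<longrightarrow> g x = c)) \<longrightarrow>
        E f g = 0)"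

definition ess_bounded :: "'a measure \<Rightarrow> ('a \<Rightarrow> real) \<Rightarrow> bool" where
  "ess_bounded M f \<longleftrightarrow> (\<exists>B. AE x in M. \<bar>f x\<bar> \<le> B)"

definition carre_du_champ ::
  "'a measure \<Rightarrow> ('a \<Rightarrow> real) set \<Rightarrow> (('a \<Rightarrow> real) \<Rightarrow> ('a \<Rightarrow> real) \<Rightarrow> real)
     \<Rightarrow> (('a \<Rightarrow> real) \<Rightarrow> ('a \<Rightarrow> real) \<Rightarrow> 'a \<Rightarrow> real) \<Rightarrow> bool" where
  "carre_du_champ M D E \<Gamma> \<longleftrightarrow>
     (\<forall>f\<in>D. \<forall>g\<in>D. integrable M (\<Gamma> f g)) \<and>
     (\<forall>f\<in>D. \<forall>g\<in>D. \<forall>h\<in>D. (AE x in M. f x = g x) \<longrightarrow> (AE x in M. \<Gamma> f h x = \<Gamma> g h x)) \<and>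
     (\<forall>f\<in>D. \<forall>g\<in>D. AE x in M. \<Gamma> f g x = \<Gamma> g f x) \<and>
     (\<forall>f\<in>D. \<forall>g\<in>D. \<forall>h\<in>D. \<forall>a b.
        AE x in M. \<Gamma> (\<lambda>y. a * f y + b * g y) h x = a * \<Gamma> f h x + b * \<Gamma> g h x) \<and>
     (\<forall>f\<in>D. AE x in M. \<Gamma> f f x \<ge> 0) \<and>
     (\<forall>f\<in>D. \<forall>g\<in>D. E f g = (\<integral>x. \<Gamma> f g x \<partial>M)) \<and>
     (\<forall>f\<in>D. \<forall>g\<in>D. \<forall>h\<in>D. ess_bounded M f \<and> ess_bounded M g \<and> ess_bounded M h \<longrightarrow>
        2 * (\<integral>x. h x * \<Gamma> f g x \<partial>M) =
          E (\<lambda>x. f x * h x) g + E (\<lambda>x. g x * h x) f - E (\<lambda>x. f x * g x) h)"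


subsection \<open>Hino index\<close>

definition hino_bound ::
  "'a measure \<Rightarrow> ('a \<Rightarrow> real) set \<Rightarrow> (('a \<Rightarrow> real) \<Rightarrow> ('a \<Rightarrow> real) \<Rightarrow> 'a \<Rightarrow> real)
     \<Rightarrow> ('a \<Rightarrow> enat) \<Rightarrow> bool" where
  "hino_bound M D \<Gamma> p \<longleftrightarrow>
     p \<in> measurable M (count_space UNIV) \<and>
     (\<forall>N. \<forall>f :: nat \<Rightarrow> 'a \<Rightarrow> real. (\<forall>i<N. f i \<in> D) \<longrightarrow>
        (AE x in M. enat (vec_space.rank N (Matrix.mat N N (\<lambda>(i, j). \<Gamma> (f i) (f j) x))) \<le> p x))"

definition pointwise_hino_index ::
  "'a measure \<Rightarrow> ('a \<Rightarrow> real) set \<Rightarrow> (('a \<Rightarrow> real) \<Rightarrow> ('a \<Rightarrow> real) \<Rightarrow> 'a \<Rightarrow> real)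
     \<Rightarrow> ('a \<Rightarrow> enat) \<Rightarrow> bool" where
  "pointwise_hino_index M D \<Gamma> p \<longleftrightarrow>
     hino_bound M D \<Gamma> p \<and> (\<forall>q. hino_bound M D \<Gamma> q \<longrightarrow> (AE x in M. p x \<le> q x))"

definition has_hino_index ::
  "'a measure \<Rightarrow> ('a \<Rightarrow> real) set \<Rightarrow> (('a \<Rightarrow> real) \<Rightarrow> ('a \<Rightarrow> real) \<Rightarrow> 'a \<Rightarrow> real)
     \<Rightarrow> enat \<Rightarrow> bool" where
  "has_hino_index M D \<Gamma> n \<longleftrightarrow>
     (\<exists>p. pointwise_hino_index M D \<Gamma> p \<and> esssup M (\<lambda>x. ereal_of_enat (p x)) = ereal_of_enat n)"


subsection \<open>One-forms\<close>

definition Bb :: "('a::metric_space \<Rightarrow> real) set" where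
  "Bb = {g \<in> borel_measurable borel. bounded (range g)}"

definition Cb :: "('a::metric_space \<Rightarrow> real) set" where
  "Cb = {f. continuous_on UNIV f \<and> bounded (range f)}"

text \<open>
  A realisation of the Hilbert space of one-forms on a Hilbert space type \<open>'h\<close>: \<open>tens f g\<close> is
  the class of $f \otimes g$, with $f \in C_b(X) \cap \operatorname{Dom}\mathcal E$ and \<open>g\<close>
  bounded Borel. Bilinearity of \<open>tens\<close> and the identification of elements at distance zero
  follow from the inner product formula; together with density of the span it determines
  \<open>'h\<close> and \<open>tens\<close> up to a unique isometric isomorphism as the completion of the quotient
  of the algebraic tensor product.
\<close>

definition one_forms ::
  "'a::metric_space measure \<Rightarrow> ('a \<Rightarrow> real) set
     \<Rightarrow> (('a \<Rightarrow> real) \<Rightarrow> ('a \<Rightarrow> real) \<Rightarrow> 'a \<Rightarrow> real)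
     \<Rightarrow> (('a \<Rightarrow> real) \<Rightarrow> ('a \<Rightarrow> real) \<Rightarrow> 'h::{real_inner,complete_space}) \<Rightarrow> bool" where
  "one_forms M D \<Gamma> tens \<longleftrightarrow>
     (\<forall>f1\<in>Cb \<inter> D. \<forall>f2\<in>Cb \<inter> D. \<forall>g1\<in>Bb. \<forall>g2\<in>Bb.
        inner (tens f1 g1) (tens f2 g2) = (\<integral>x. g1 x * g2 x * \<Gamma> f1 f2 x \<partial>M)) \<and>
     closure (span {tens f g | f g. f \<in> Cb \<inter> D \<and> g \<in> Bb}) = UNIV"

text \<open>\<open>form_mult D tens a \<eta>\<close> is $\eta \cdot a$, for a bounded Borel function \<open>a\<close>.\<close>

definition form_mult ::
  "('a::metric_space \<Rightarrow> real) set
     \<Rightarrow> (('a \<Rightarrow> real) \<Rightarrow> ('a \<Rightarrow> real) \<Rightarrow> 'h::{real_inner,complete_space})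
     \<Rightarrow> ('a \<Rightarrow> real) \<Rightarrow> 'h \<Rightarrow> 'h" where
  "form_mult D tens a = (THE T. bounded_linear T \<and>
     (\<forall>f\<in>Cb \<inter> D. \<forall>g\<in>Bb. T (tens f g) = tens f (\<lambda>x. g x * a x)))"

text \<open>
  The derivation: the closure of the operator $f \mapsto f \otimes \mathbf 1$ from
  $L^2(X,\mu)$ to the one-forms, evaluated at $f \in \operatorname{Dom}\mathcal E$.
\<close>

definition deriv_form ::
  "'a::metric_space measure \<Rightarrow> ('a \<Rightarrow> real) set
     \<Rightarrow> (('a \<Rightarrow> real) \<Rightarrow> ('a \<Rightarrow> real) \<Rightarrow> 'h::{real_inner,complete_space})
     \<Rightarrow> ('a \<Rightarrow> real) \<Rightarrow> 'h" where
  "deriv_form M D tens f = (THE \<eta>. \<exists>u. (\<forall>n::nat. u n \<in> Cb \<inter> D) \<and>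
     (\<lambda>n. l2_norm M (\<lambda>x. u n x - f x)) \<longlonglongrightarrow> 0 \<and>
     (\<lambda>n. tens (u n) (\<lambda>x. 1)) \<longlonglongrightarrow> \<eta>)"

definition is_coderiv ::
  "'a::metric_space measure \<Rightarrow> ('a \<Rightarrow> real) set
     \<Rightarrow> (('a \<Rightarrow> real) \<Rightarrow> ('a \<Rightarrow> real) \<Rightarrow> 'h::{real_inner,complete_space})
     \<Rightarrow> 'h \<Rightarrow> ('a \<Rightarrow> real) \<Rightarrow> bool" where
  "is_coderiv M D tens \<eta> u \<longleftrightarrow>
     u \<in> L2 M \<and> (\<forall>f\<in>D. inner (deriv_form M D tens f) \<eta> = l2_inner M f u)"

definition dom_coderiv ::
  "'a::metric_space measure \<Rightarrow> ('a \<Rightarrow> real) set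
     \<Rightarrow> (('a \<Rightarrow> real) \<Rightarrow> ('a \<Rightarrow> real) \<Rightarrow> 'h::{real_inner,complete_space}) \<Rightarrow> 'h set" where
  "dom_coderiv M D tens = {\<eta>. \<exists>u. is_coderiv M D tens \<eta> u}"

text \<open>The adjoint of the derivation; its value is determined almost everywhere.\<close>

definition coderiv ::
  "'a::metric_space measure \<Rightarrow> ('a \<Rightarrow> real) set
     \<Rightarrow> (('a \<Rightarrow> real) \<Rightarrow> ('a \<Rightarrow> real) \<Rightarrow> 'h::{real_inner,complete_space})
     \<Rightarrow> 'h \<Rightarrow> 'a \<Rightarrow> real" where
  "coderiv M D tens \<eta> = (SOME u. is_coderiv M D tens \<eta> u)"

definition harmonic_form ::
  "'a::metric_space measure \<Rightarrow> ('a \<Rightarrow> real) set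
     \<Rightarrow> (('a \<Rightarrow> real) \<Rightarrow> ('a \<Rightarrow> real) \<Rightarrow> 'h::{real_inner,complete_space}) \<Rightarrow> 'h \<Rightarrow> bool" where
  "harmonic_form M D tens \<omega> \<longleftrightarrow>
     \<omega> \<in> dom_coderiv M D tens \<and> (AE x in M. coderiv M D tens \<omega> x = 0)"

text \<open>
  \<open>is_form_measure D tens \<omega> \<nu>\<close> states $\nu = \nu_\omega$. This measure has total mass
  $\|\omega\|^2$, so it is finite.
\<close>

definition is_form_measure ::
  "('a::metric_space \<Rightarrow> real) set
     \<Rightarrow> (('a \<Rightarrow> real) \<Rightarrow> ('a \<Rightarrow> real) \<Rightarrow> 'h::{real_inner,complete_space})
     \<Rightarrow> 'h \<Rightarrow> 'a measure \<Rightarrow> bool" where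
  "is_form_measure D tens \<omega> \<nu> \<longleftrightarrow>
     sets \<nu> = sets borel \<and> finite_measure \<nu> \<and>
     (\<forall>\<phi>\<in>Cb. (\<integral>x. \<phi> x \<partial>\<nu>) = inner (form_mult D tens \<phi> \<omega>) \<omega>)"


subsection \<open>Direct integral structure and Hodge star\<close>

text \<open>
  \<open>\<beta> \<xi> \<eta> x\<close> is the inner product of $\xi_x$ and $\eta_x$ in the fibre $\mathcal H_x$ of the
  direct integral. The last condition prescribes it on elementary tensors. Positivity and the
  isometry property give
  $\int |\beta(\xi,\eta)|\,d\mu \le \|\xi\| \|\eta\|$, so that
  \<open>\<beta>\<close> is determined almost everywhere by these values.
\<close>

definition is_fibre_inner ::
  "'a::metric_space measure \<Rightarrow> ('a \<Rightarrow> real) set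
     \<Rightarrow> (('a \<Rightarrow> real) \<Rightarrow> ('a \<Rightarrow> real) \<Rightarrow> 'a \<Rightarrow> real)
     \<Rightarrow> (('a \<Rightarrow> real) \<Rightarrow> ('a \<Rightarrow> real) \<Rightarrow> 'h::{real_inner,complete_space})
     \<Rightarrow> ('h \<Rightarrow> 'h \<Rightarrow> 'a \<Rightarrow> real) \<Rightarrow> bool" where
  "is_fibre_inner M D \<Gamma> tens \<beta> \<longleftrightarrow>
     (\<forall>\<xi> \<eta>. integrable M (\<beta> \<xi> \<eta>)) \<and>
     (\<forall>\<xi> \<eta>. AE x in M. \<beta> \<xi> \<eta> x = \<beta> \<eta> \<xi> x) \<and>
     (\<forall>\<xi> \<zeta> \<eta> a b. AE x in M. \<beta> (a *\<^sub>R \<xi> + b *\<^sub>R \<zeta>) \<eta> x = a * \<beta> \<xi> \<eta> x + b * \<beta> \<zeta> \<eta> x) \<and>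
     (\<forall>\<xi>. AE x in M. \<beta> \<xi> \<xi> x \<ge> 0) \<and>
     (\<forall>\<xi> \<eta>. inner \<xi> \<eta> = (\<integral>x. \<beta> \<xi> \<eta> x \<partial>M)) \<and>
     (\<forall>f1\<in>Cb \<inter> D. \<forall>f2\<in>Cb \<inter> D. \<forall>g1\<in>Bb. \<forall>g2\<in>Bb.
        AE x in M. \<beta> (tens f1 g1) (tens f2 g2) x = g1 x * g2 x * \<Gamma> f1 f2 x)"

definition fibre_inner ::
  "'a::metric_space measure \<Rightarrow> ('a \<Rightarrow> real) set
     \<Rightarrow> (('a \<Rightarrow> real) \<Rightarrow> ('a \<Rightarrow> real) \<Rightarrow> 'a \<Rightarrow> real)
     \<Rightarrow> (('a \<Rightarrow> real) \<Rightarrow> ('a \<Rightarrow> real) \<Rightarrow> 'h::{real_inner,complete_space})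
     \<Rightarrow> 'h \<Rightarrow> 'h \<Rightarrow> 'a \<Rightarrow> real" where
  "fibre_inner M D \<Gamma> tens = (SOME \<beta>. is_fibre_inner M D \<Gamma> tens \<beta>)"

text \<open>
  The Hodge star $(\star f)_x = f(x)\,\omega_x$ for \<open>f\<close> in $L^2(X,\mu)$, where equality in
  almost every fibre is tested against $\eta_x$ for all one-forms \<open>\<eta>\<close>.
\<close>

definition hodge_star ::
  "'a::metric_space measure \<Rightarrow> ('a \<Rightarrow> real) set
     \<Rightarrow> (('a \<Rightarrow> real) \<Rightarrow> ('a \<Rightarrow> real) \<Rightarrow> 'a \<Rightarrow> real)
     \<Rightarrow> (('a \<Rightarrow> real) \<Rightarrow> ('a \<Rightarrow> real) \<Rightarrow> 'h::{real_inner,complete_space})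
     \<Rightarrow> 'h \<Rightarrow> ('a \<Rightarrow> real) \<Rightarrow> 'h" where
  "hodge_star M D \<Gamma> tens \<omega> f = (THE \<zeta>. \<forall>\<eta>.
     AE x in M. fibre_inner M D \<Gamma> tens \<zeta> \<eta> x = f x * fibre_inner M D \<Gamma> tens \<omega> \<eta> x)"

text \<open>The inverse of the Hodge star, also written $\star$; its value is determined almost
  everywhere.\<close>

definition hodge_star_inv ::
  "'a::metric_space measure \<Rightarrow> ('a \<Rightarrow> real) set
     \<Rightarrow> (('a \<Rightarrow> real) \<Rightarrow> ('a \<Rightarrow> real) \<Rightarrow> 'a \<Rightarrow> real)
     \<Rightarrow> (('a \<Rightarrow> real) \<Rightarrow> ('a \<Rightarrow> real) \<Rightarrow> 'h::{real_inner,complete_space})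
     \<Rightarrow> 'h \<Rightarrow> 'h \<Rightarrow> 'a \<Rightarrow> real" where
  "hodge_star_inv M D \<Gamma> tens \<omega> \<eta> = (SOME f. f \<in> L2 M \<and> hodge_star M D \<Gamma> tens \<omega> f = \<eta>)"

definition dom_E_perp ::
  "'a::metric_space measure \<Rightarrow> ('a \<Rightarrow> real) set
     \<Rightarrow> (('a \<Rightarrow> real) \<Rightarrow> ('a \<Rightarrow> real) \<Rightarrow> 'a \<Rightarrow> real)
     \<Rightarrow> (('a \<Rightarrow> real) \<Rightarrow> ('a \<Rightarrow> real) \<Rightarrow> 'h::{real_inner,complete_space})
     \<Rightarrow> 'h \<Rightarrow> ('a \<Rightarrow> real) set" where
  "dom_E_perp M D \<Gamma> tens \<omega> =
     {f \<in> L2 M. hodge_star M D \<Gamma> tens \<omega> f \<in> dom_coderiv M D tens}"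

definition E_perp ::
  "'a::metric_space measure \<Rightarrow> ('a \<Rightarrow> real) set
     \<Rightarrow> (('a \<Rightarrow> real) \<Rightarrow> ('a \<Rightarrow> real) \<Rightarrow> 'a \<Rightarrow> real)
     \<Rightarrow> (('a \<Rightarrow> real) \<Rightarrow> ('a \<Rightarrow> real) \<Rightarrow> 'h::{real_inner,complete_space})
     \<Rightarrow> 'h \<Rightarrow> ('a \<Rightarrow> real) \<Rightarrow> ('a \<Rightarrow> real) \<Rightarrow> real" where
  "E_perp M D \<Gamma> tens \<omega> f g =
     l2_inner M (coderiv M D tens (hodge_star M D \<Gamma> tens \<omega> f))
                (coderiv M D tens (hodge_star M D \<Gamma> tens \<omega> g))"

end

theory Submission
  imports Defs "Jordan_Normal_Form.DL_Rank_Submatrix"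
begin

text \<open>
  Write \<open>\<partial>f\<close> for \<open>deriv_form M D tens f\<close>, \<open>\<star>\<close> for \<open>hodge_star M D \<Gamma> tens \<omega>\<close> and \<open>\<beta>\<close> for the fibre
  inner product. Since $\langle \star f, \eta\rangle = \int f \beta(\eta, \omega)\,d\mu$, the skew
  symmetry is the statement
  \<open>\<langle>\<star>f, \<partial>g\<rangle> + \<langle>\<star>g, \<partial>f\<rangle> = 0\<close>.
  For functions \<open>f\<close> and \<open>g\<close> in the domain that are continuous with compact support, the left-hand side
  is \<open>\<langle>f \<partial>g + g \<partial>f, \<omega>\<rangle>\<close>. By the Leibniz rule this is \<open>\<langle>\<partial>(f g), \<omega>\<rangle>\<close>, and \<open>\<omega>\<close> is orthogonal to
  all derivatives because it is harmonic. Regularity of the form and the isometry property of \<open>\<star>\<close>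
  carry the identity over to the whole domain (\<open>inner_star_deriv_skew\<close>). It then says that
  \<open>- \<beta>(\<partial>f, \<omega>)\<close> is the coderivative of \<open>\<star>f\<close> (\<open>is_coderiv_star\<close>), and \<open>\<eta> \<mapsto> \<beta>(\<eta>, \<omega>)\<close> is the inverse of
  \<open>\<star>\<close> and isometric, so both quadratic forms equal $\langle \partial f, \partial g\rangle$ on the
      domain.

  Two ingredients need work.

  The first is the algebra of the domain and the Leibniz rule, which have to be derived from the
      Markov
  property, strong locality and the identity for the carre du champ. By polarization it suffices to
  treat \<open>f^2\<close> with \<open>0 \<le> f \<le> 1\<close>. Cut \<open>f\<close> into the slices between the levels \<open>i/n\<close> and \<open>(i+1)/n\<close>. The
  Markov property makes all mixed energies of slices nonnegative (\<open>slice_energy_nonneg\<close>) and strong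
  locality makes those of non-adjacent slices vanish (\<open>slice_energy_eq_0\<close>). The former bounds the
  energy of any combination of slices with bounded coefficients, so piecewise linear approximations
      of
  \<open>\<phi>(f)\<close> converge in energy (\<open>chain_limit\<close>); in particular \<open>f^2\<close> and \<open>f^3\<close> lie in the domain. The
  latter then gives \<open>4 E(f^3, f) = 3 E(f^2, f^2)\<close> (\<open>square_cube_energy\<close>), and by the carre du
  champ identity \<open>4 E(f^3, f) - 3 E(f^2, f^2)\<close> is exactly the squared norm of \<open>\<partial>(f^2) - 2 f \<partial>f\<close>
  (\<open>grad_square\<close>).

  The second is that the objects defined by description operators exist: multiplication of a form by a bounded
  function (\<open>form_mult_exists\<close>), the fibre inner product, obtained from the Radon-Nikodym
  densities of the measures \<open>A \<mapsto> \<langle>\<xi> 1_A, \<xi>\<rangle>\<close> (\<open>fibre_inner_exists\<close>), and the Hodge star on all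
  square integrable functions, with its inverse. For the latter, Hino index one means that the
      2-by-2 minors
  of the fibre inner product vanish (\<open>\<beta>_minor\<close>). As \<open>\<beta>(\<omega>, \<omega>) = 1\<close>, every form \<open>\<eta>\<close> is
  \<open>\<beta>(\<eta>, \<omega>)\<close> times \<open>\<omega>\<close> fibrewise (\<open>\<beta>_factor\<close>).
\<close>

section \<open>Extension, densities and minors\<close>

text \<open>A bounded linear operator prescribed on a set with dense span. The prescription is given as a set
  of pairs; the closure of the span of the pairs is the graph of the extension.\<close>

lemma bounded_linear_extension_dense:
  fixes S :: "('a::{real_normed_vector,complete_space} \<times> 'b::{real_normed_vector,complete_space})
      set"
  assumes bound: "\<And>p. p \<in> span S \<Longrightarrow> norm (snd p) \<le> C * norm (fst p)"
    and dense: "closure (span (fst ` S)) = UNIV"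
  shows "\<exists>T. bounded_linear T \<and> (\<forall>x. norm (T x) \<le> C * norm x) \<and> (\<forall>p\<in>S. T (fst p) = snd p)"
proof -
  define G where "G = closure (span S)"
  have bG: "norm (snd p) \<le> C * norm (fst p)" if "p \<in> G" for p
  proof -
    have "closed {p :: 'a \<times> 'b. norm (snd p) \<le> C * norm (fst p)}"
      by (intro closed_Collect_le continuous_intros)
    then have "G \<subseteq> {p. norm (snd p) \<le> C * norm (fst p)}"
      unfolding G_def using bound by (intro closure_minimal) auto
    then show ?thesis using that by blast
  qed
  have G_add: "p + q \<in> G" if pq: "p \<in> G" "q \<in> G" for p q
  proof -
    obtain u v where "\<forall>n. u n \<in> span S" "u \<longlonglongrightarrow> p" "\<forall>n. v n \<in> span S" "v \<longlonglongrightarrow> q"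
      using pq unfolding G_def closure_sequential by blast
    then show ?thesis unfolding G_def closure_sequential
      by (intro exI[of _ "\<lambda>n. u n + v n"]) (auto intro: span_add tendsto_add)
  qed
  have G_scale: "r *\<^sub>R p \<in> G" if p: "p \<in> G" for p r
  proof -
    obtain u where "\<forall>n. u n \<in> span S" "u \<longlonglongrightarrow> p"
      using p unfolding G_def closure_sequential by blast
    then show ?thesis unfolding G_def closure_sequential
      by (intro exI[of _ "\<lambda>n. r *\<^sub>R u n"]) (auto intro: span_scale tendsto_scaleR)
  qed
  have G_inj: "y = z" if "(x, y) \<in> G" "(x, z) \<in> G" for x y z
  proof -
    have "(x, y) + (-1) *\<^sub>R (x, z) \<in> G" using that G_add G_scale by blast
    then show ?thesis using bG by fastforce
  qed
  have G_ex: "\<exists>y. (x, y) \<in> G" for x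
  proof -
    have "x \<in> closure (fst ` span S)"
      using dense linear_span_image[OF bounded_linear.linear[OF bounded_linear_fst], of S] by simp
    then obtain v where v: "\<And>n. v n \<in> fst ` span S" "v \<longlonglongrightarrow> x"
      unfolding closure_sequential by blast
    have "\<forall>n. \<exists>p. p \<in> span S \<and> v n = fst p" using v(1) by blast
    then obtain p where p: "\<And>n. p n \<in> span S" "\<And>n. v n = fst (p n)" by metis
    have "Cauchy (\<lambda>n. snd (p n))"
    proof (rule metric_CauchyI)
      fix e :: real assume e: "e > 0"
      have "Cauchy v" using v(2) LIMSEQ_imp_Cauchy by blast
      moreover have "e / (\<bar>C\<bar> + 1) > 0" using e by simp
      ultimately obtain K where K: "\<And>m n. m \<ge> K \<Longrightarrow> n \<ge> K \<Longrightarrow> dist (v m) (v n) < e / (\<bar>C\<bar> + 1)"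
        by (meson metric_CauchyD)
      have "dist (snd (p m)) (snd (p n)) < e" if mn: "m \<ge> K" "n \<ge> K" for m n
      proof -
        have "norm (snd (p m - p n)) \<le> C * norm (fst (p m - p n))"
          by (intro bound span_diff p)
        also have "\<dots> \<le> (\<bar>C\<bar> + 1) * dist (v m) (v n)"
          by (simp add: p(2) dist_norm mult_right_mono)
        also have "\<dots> < e" using K[OF mn] by (simp add: pos_less_divide_eq mult.commute)
        finally show ?thesis by (simp add: dist_norm)
      qed
      then show "\<exists>K. \<forall>m\<ge>K. \<forall>n\<ge>K. dist (snd (p m)) (snd (p n)) < e" by blast
    qed
    then obtain y where y: "(\<lambda>n. snd (p n)) \<longlonglongrightarrow> y"
      using Cauchy_convergent_iff convergent_def by blast
    have "(\<lambda>n. (v n, snd (p n))) \<longlonglongrightarrow> (x, y)" by (intro tendsto_Pair v y)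
    moreover have "(\<lambda>n. (v n, snd (p n))) = p" using p(2) by auto
    ultimately have "(x, y) \<in> G" unfolding G_def closure_sequential using p(1) by metis
    then show ?thesis by blast
  qed
  obtain T where T: "\<And>x. (x, T x) \<in> G" using G_ex by metis
  have "bounded_linear T"
  proof (rule bounded_linear_intro[of _ C])
    show "T (x + y) = T x + T y" for x y
      using G_inj[OF T] G_add[OF T T, of x y] by simp
    show "T (r *\<^sub>R x) = r *\<^sub>R T x" for r x
      using G_inj[OF T] G_scale[OF T, of r x] by simp
    show "norm (T x) \<le> norm x * C" for x
      using bG[OF T, of x] by (simp add: mult.commute)
  qed
  moreover have "T (fst p) = snd p" if "p \<in> S" for p
    using that G_inj[OF T, of "fst p" "snd p"] closure_subset[of "span S"] span_base[of p S]
    unfolding G_def by auto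
  moreover have "norm (T x) \<le> C * norm x" for x
    using bG[OF T, of x] by simp
  ultimately show ?thesis by blast
qed

text \<open>Radon-Nikodym theorem for a finitely additive set function that is continuous at the empty set.\<close>

lemma (in finite_measure) set_function_density:
  fixes \<nu> :: "'a set \<Rightarrow> real"
  assumes nonneg: "\<And>A. A \<in> sets M \<Longrightarrow> 0 \<le> \<nu> A"
    and add: "\<And>A B. A \<in> sets M \<Longrightarrow> B \<in> sets M \<Longrightarrow> A \<inter> B = {} \<Longrightarrow> \<nu> (A \<union> B) = \<nu> A + \<nu> B"
    and cont: "\<And>A. range A \<subseteq> sets M \<Longrightarrow> decseq A \<Longrightarrow> (\<Inter>i. A i) = {} \<Longrightarrow> (\<lambda>i. \<nu> (A i)) \<longlonglongrightarrow> 0"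
    and null: "\<And>A. A \<in> null_sets M \<Longrightarrow> \<nu> A = 0"
  shows "\<exists>d. integrable M d \<and> (\<forall>x. 0 \<le> d x) \<and> (\<forall>A\<in>sets M. \<nu> A = (\<integral>x\<in>A. d x \<partial>M))"
proof -
  define N where "N = measure_of (space M) (sets M) (\<lambda>A. ennreal (\<nu> A))"
  have sN[simp]: "sets N = sets M" "space N = space M" unfolding N_def by simp_all
  have e0: "\<nu> {} = 0" using null by simp
  have "countably_additive (sets M) (\<lambda>A. ennreal (\<nu> A))"
  proof (rule sets.empty_continuous_imp_countably_additive)
    show "positive (sets M) (\<lambda>A. ennreal (\<nu> A))" by (simp add: positive_def e0)
    show "additive (sets M) (\<lambda>A. ennreal (\<nu> A))"
      by (auto simp: additive_def add nonneg ennreal_plus)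
    fix A :: "nat \<Rightarrow> 'a set"
    assume "range A \<subseteq> sets M" "decseq A" "(\<Inter>i. A i) = {}"
    then show "(\<lambda>i. ennreal (\<nu> (A i))) \<longlonglongrightarrow> 0"
      using cont tendsto_ennrealI ennreal_0 by metis
  qed simp
  then have eN: "emeasure N A = ennreal (\<nu> A)" if "A \<in> sets M" for A
    unfolding N_def using that
    by (intro emeasure_measure_of_sigma sets.sigma_algebra_axioms) (auto simp: positive_def e0)
  have finN: "finite_measure N" by (rule finite_measureI) (simp add: eN)
  moreover have "absolutely_continuous M N"
    unfolding absolutely_continuous_def using null by (auto simp: null_sets_def eN)
  ultimately obtain f where f[measurable]: "f \<in> borel_measurable M" and fN: "density M f = N"
    using Radon_Nikodym_finite_measure[of N] by auto
  have int_f: "(\<integral>\<^sup>+x. f x * indicator A x \<partial>M) = ennreal (\<nu> A)" if "A \<in> sets M" for A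
    using that eN[OF that] emeasure_density[OF f that] fN by simp
  have "(\<integral>\<^sup>+x. f x \<partial>M) = (\<integral>\<^sup>+x. f x * indicator (space M) x \<partial>M)"
    by (intro nn_integral_cong) auto
  then have "(\<integral>\<^sup>+x. f x \<partial>M) \<noteq> \<infinity>" using int_f[of "space M"] by simp
  then have "AE x in M. f x \<noteq> \<infinity>" by (intro nn_integral_PInf_AE) auto
  then have fe: "AE x in M. f x = ennreal (enn2real (f x))"
    by eventually_elim (simp add: less_top)
  define d where "d x = enn2real (f x)" for x
  have [measurable]: "d \<in> borel_measurable M" unfolding d_def by measurable
  have ds: "(\<integral>\<^sup>+x. ennreal (d x * indicator A x) \<partial>M) = ennreal (\<nu> A)" if "A \<in> sets M" for A
  proof -
    have "(\<integral>\<^sup>+x. ennreal (d x * indicator A x) \<partial>M) = (\<integral>\<^sup>+x. f x * indicator A x \<partial>M)"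
      using fe unfolding d_def
      by (intro nn_integral_cong_AE, eventually_elim) (auto simp: indicator_def)
    then show ?thesis using int_f[OF that] by simp
  qed
  have "integrable M d"
  proof (rule integrableI_nonneg)
    show "AE x in M. 0 \<le> d x" by (simp add: d_def)
    have "(\<integral>\<^sup>+x. ennreal (d x) \<partial>M) = (\<integral>\<^sup>+x. ennreal (d x * indicator (space M) x) \<partial>M)"
      by (intro nn_integral_cong) auto
    then show "(\<integral>\<^sup>+x. ennreal (d x) \<partial>M) < \<infinity>" using ds[of "space M"] by simp
  qed simp
  moreover have "\<nu> A = (\<integral>x\<in>A. d x \<partial>M)" if A[measurable]: "A \<in> sets M" for A
  proof -
    have "(\<integral>x\<in>A. d x \<partial>M) = enn2real (\<integral>\<^sup>+x. ennreal (d x * indicator A x) \<partial>M)"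
      unfolding set_lebesgue_integral_def
      by (subst integral_eq_nn_integral) (auto simp: d_def mult.commute)
    then show ?thesis using ds[OF A] nonneg[OF A] by simp
  qed
  moreover have "\<forall>x. 0 \<le> d x" by (simp add: d_def)
  ultimately show ?thesis by blast
qed

lemma det_2_mat:
  fixes S :: "'a::comm_ring_1 mat"
  assumes S: "S \<in> carrier_mat 2 2"
  shows "det S = S $$ (0, 0) * S $$ (1, 1) - S $$ (0, 1) * S $$ (1, 0)"
proof -
  have d: "det (mat_delete S 0 j) = S $$ (1, 1 - j)" if "j < 2" for j
  proof -
    have c: "mat_delete S 0 j \<in> carrier_mat 1 1"
      using S unfolding mat_delete_def by auto
    have "mat_delete S 0 j $$ (0, 0) = S $$ (1, 1 - j)"
      using S that unfolding mat_delete_def by auto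
    then show ?thesis using det_single[OF c] by simp
  qed
  have "det S = (\<Sum>j<2. S $$ (0, j) * cofactor S 0 j)" by (rule laplace_expansion_row[OF S]) simp
  also have "\<dots> = S $$ (0, 0) * S $$ (1, 1) - S $$ (0, 1) * S $$ (1, 0)"
    using d[of 0] d[of 1] by (simp add: cofactor_def numeral_2_eq_2)
  finally show ?thesis .
qed

lemma rank_le_1_minor:
  fixes A :: "'a::field mat"
  assumes A: "A \<in> carrier_mat 4 4" and rank: "vec_space.rank 4 A \<le> 1"
  shows "A $$ (0, 2) * A $$ (1, 3) = A $$ (0, 3) * A $$ (1, 2)"
proof (rule ccontr)
  assume ne: "\<not> ?thesis"
  define S where "S = submatrix A {0, 1} {2, 3}"
  have c: "{i. i < 4 \<and> i \<in> {0, 1}} = {0, 1::nat}" "{j. j < 4 \<and> j \<in> {2, 3}} = {2, 3::nat}" by auto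
  have dA: "dim_row A = 4" "dim_col A = 4" using A by auto
  have p01: "pick {0, 1} 0 = 0" "pick {0, 1} 1 = 1" by (auto intro!: Least_equality)
  have p2: "pick {2, 3} 0 = 2" by (auto intro!: Least_equality)
  have "pick {2, 3} (Suc 0) = (LEAST a. a \<in> {2, 3} \<and> a > (2::nat))" using p2 by simp
  also have "\<dots> = 3" by (intro Least_equality) auto
  finally have p: "pick {0, 1} 0 = 0" "pick {0, 1} 1 = 1" "pick {2, 3} 0 = 2" "pick {2, 3} 1 = 3"
    using p01 p2 by simp_all
  have S: "S \<in> carrier_mat 2 2"
    unfolding S_def carrier_mat_def using c by (simp only: dim_submatrix dA mem_Collect_eq) simp
  have ix: "S $$ (i, j) = A $$ (pick {0, 1} i, pick {2, 3} j)" if "i < 2" "j < 2" for i j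
    unfolding S_def using that c
    by (intro submatrix_index) (simp_all only: dA, simp_all)
  have "det S = A $$ (0, 2) * A $$ (1, 3) - A $$ (0, 3) * A $$ (1, 2)"
    unfolding det_2_mat[OF S] using ix[of 0 0] ix[of 0 1] ix[of 1 0] ix[of 1 1] unfolding p
    by (simp add: mult.commute)
  then have "det (submatrix A {0, 1} {2, 3}) \<noteq> 0" using ne unfolding S_def by simp
  from vec_space.rank_gt_minor[OF A this] have "2 \<le> vec_space.rank 4 A"
    using c by simp
  then show False using rank by simp
qed

text \<open>A finite Borel measure on a metric space is determined by the integrals of bounded
  continuous functions.\<close>

lemma density_eq_1_if_Cb:
  fixes M :: "'a::metric_space measure"
  assumes "finite_measure M" and sets: "sets M = sets borel" and b: "integrable M b"
    and eq: "\<And>\<phi>. \<phi> \<in> Cb \<Longrightarrow> (\<integral>x. \<phi> x \<partial>M) = (\<integral>x. \<phi> x * b x \<partial>M)"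
  shows "AE x in M. b x = (1::real)"
proof -
  interpret finite_measure M by fact
  have sp: "space M = UNIV" using sets_eq_imp_space_eq[OF sets] by simp
  have [measurable_cong]: "sets M = sets borel" by fact
  note [measurable] = borel_measurable_integrable[OF b]
  have closed_eq: "(\<integral>x. indicator A x \<partial>M) = (\<integral>x. indicator A x * b x \<partial>M)" if A: "closed A" for A
  proof (cases "A = {}")
    case False
    define \<phi> where "\<phi> n x = max 0 (1 - real n * infdist x A)" for n x
    have cont: "continuous_on UNIV (\<phi> n)" for n unfolding \<phi>_def by (intro continuous_intros)
    have bd: "norm (\<phi> n x) \<le> 1" for n x
      unfolding \<phi>_def using infdist_nonneg[of x A] by simp
    have Cb: "\<phi> n \<in> Cb" for n
      unfolding Cb_def using cont bd by (auto simp: bounded_iff)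
    have m[measurable]: "\<phi> n \<in> borel_measurable M" for n
      using borel_measurable_continuous_onI[OF cont] by simp
    have Am[measurable]: "A \<in> sets M" using A sets by simp
    have lim: "(\<lambda>n. \<phi> n x) \<longlonglongrightarrow> indicator A x" for x
    proof (cases "x \<in> A")
      case True then show ?thesis by (simp add: \<phi>_def)
    next
      case nx: False
      then have "infdist x A > 0"
        using A False infdist_pos_not_in_closed by blast
      then obtain K :: nat where K: "real K * infdist x A > 1" using reals_Archimedean3 by blast
      have "\<phi> n x = 0" if "n \<ge> K" for n
      proof -
        have "real K * infdist x A \<le> real n * infdist x A" using that infdist_nonneg[of x A]
          by (intro mult_right_mono) auto
        then show ?thesis using K unfolding \<phi>_def by simp
      qed
      then have "eventually (\<lambda>n. \<phi> n x = 0) sequentially" unfolding eventually_sequentially by blast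
      then show ?thesis using nx by (simp add: tendsto_eventually)
    qed
    have "(\<lambda>n. \<integral>x. \<phi> n x \<partial>M) \<longlonglongrightarrow> (\<integral>x. indicator A x \<partial>M)"
      by (rule integral_dominated_convergence[where w="\<lambda>_. 1"]) (use lim bd in auto)
    moreover have "(\<lambda>n. \<integral>x. \<phi> n x * b x \<partial>M) \<longlonglongrightarrow> (\<integral>x. indicator A x * b x \<partial>M)"
    proof (rule integral_dominated_convergence[where w="\<lambda>x. norm (b x)"])
      show "AE x in M. (\<lambda>n. \<phi> n x * b x) \<longlonglongrightarrow> indicator A x * b x"
        using lim by (intro AE_I2 tendsto_mult tendsto_const)
      show "AE x in M. norm (\<phi> n x * b x) \<le> norm (b x)" for n
        using bd[of n] by (intro AE_I2) (simp add: abs_mult mult_left_le_one_le)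
      show "integrable M (\<lambda>x. norm (b x))" using b by (rule integrable_norm)
    qed measurable
    ultimately show ?thesis unfolding eq[OF Cb] by (rule LIMSEQ_unique)
  next
    case True
    then have "indicator A x = (0::real)" for x by (simp add: indicator_def)
    then show ?thesis by (simp only: mult_zero_left)
  qed
  have int1: "integrable M (\<lambda>x. indicator A x * b x)" if "A \<in> sets M" for A
    using integrable_real_mult_indicator[OF that b] by (simp add: mult.commute)
  have all: "(\<integral>x. indicator A x \<partial>M) = (\<integral>x. indicator A x * b x \<partial>M)" if "A \<in> sets M" for A
  proof -
    have "A \<in> sigma_sets UNIV (Collect closed)"
      using that unfolding sets by (simp add: borel_eq_closed)
    have Int: "Int_stable (Collect closed :: 'a set set)" by (auto simp: Int_stable_def)
    have "Collect closed \<subseteq> Pow (UNIV :: 'a set)" by simp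
    from Int this \<open>A \<in> sigma_sets UNIV (Collect closed)\<close> show ?thesis
    proof (induction rule: sigma_sets_induct_disjoint)
      case (basic A) then show ?case using closed_eq by simp
    next
      case empty show ?case by (simp only: indicator_simps empty_iff not_False_eq_True
          mult_zero_left)
    next
      case (compl A)
      then have A[measurable]: "A \<in> sets M"
        unfolding sets by (simp add: borel_eq_closed)
      have "(\<integral>x. indicator (UNIV - A) x \<partial>M) = (\<integral>x. (1 - indicator A x :: real) \<partial>M)"
        by (intro Bochner_Integration.integral_cong) (auto simp: indicator_def)
      also have "\<dots> = (\<integral>x. 1 \<partial>M) - (\<integral>x. indicator A x \<partial>M)"
        by (intro Bochner_Integration.integral_diff integrable_const integrable_real_indicator A)
          (simp add: less_top[symmetric])
      also have "\<dots> = (\<integral>x. b x \<partial>M) - (\<integral>x. indicator A x * b x \<partial>M)"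
        using closed_eq[of UNIV] compl by simp
      also have "\<dots> = (\<integral>x. b x - indicator A x * b x \<partial>M)"
        by (intro Bochner_Integration.integral_diff[symmetric] b int1 A)
      also have "\<dots> = (\<integral>x. indicator (UNIV - A) x * b x \<partial>M)"
        by (intro Bochner_Integration.integral_cong) (auto simp: indicator_def)
      finally show ?case .
    next
      case (union A)
      have A[measurable]: "A i \<in> sets M" for i
        using union(2) unfolding sets by (auto simp: borel_eq_closed)
      have si: "set_integrable M B c" if "B \<in> sets M" "integrable M c" for B and c :: "'a \<Rightarrow> real"
        unfolding set_integrable_def using that by (rule integrable_mult_indicator)
      have dj: "A i \<inter> A j = {}" if "i \<noteq> j" for i j
        using union(1) that unfolding disjoint_family_on_def by blast
      have UA: "(\<Union>i. A i) \<in> sets M" using A by blast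
      have "(\<integral>x\<in>(\<Union>i. A i). (1::real) \<partial>M) = (\<Sum>i. \<integral>x\<in>A i. 1 \<partial>M)"
        by (rule lebesgue_integral_countable_add[OF A dj si[OF UA]]) simp_all
      moreover have "(\<integral>x\<in>(\<Union>i. A i). b x \<partial>M) = (\<Sum>i. \<integral>x\<in>A i. b x \<partial>M)"
        by (rule lebesgue_integral_countable_add[OF A dj si[OF UA b]]) simp_all
      ultimately show ?case using union(3) by (simp only: set_lebesgue_integral_def real_scaleR_def
          mult_1_right)
    qed
  qed
  show ?thesis
  proof (rule density_unique_real[OF b])
    show "(\<integral>x\<in>A. b x \<partial>M) = (\<integral>x\<in>A. 1 \<partial>M)" if "A \<in> sets M" for A
      using all[OF that] by (simp add: set_lebesgue_integral_def)
  qed simp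
qed


section \<open>Square integrable functions\<close>

lemma L2_measurable: "f \<in> L2 M \<Longrightarrow> f \<in> borel_measurable M"
  and L2_integrable_square: "f \<in> L2 M \<Longrightarrow> integrable M (\<lambda>x. (f x)\<^sup>2)"
  by (auto simp: L2_def)

lemma integrable_L2_mult:
  assumes "f \<in> L2 M" "g \<in> L2 M"
  shows "integrable M (\<lambda>x. f x * g x)"
proof (rule Bochner_Integration.integrable_bound)
  show "integrable M (\<lambda>x. (f x)\<^sup>2 + (g x)\<^sup>2)" using assms by (simp add: L2_def)
  show "(\<lambda>x. f x * g x) \<in> borel_measurable M" using assms by (auto simp: L2_def)
  have "\<bar>a * b\<bar> \<le> a\<^sup>2 + b\<^sup>2" for a b :: real
    using sum_squares_bound[of "\<bar>a\<bar>" "\<bar>b\<bar>"] abs_ge_zero[of "a * b"] unfolding abs_mult power2_abs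
        by linarith
  then show "AE x in M. norm (f x * g x) \<le> norm ((f x)\<^sup>2 + (g x)\<^sup>2)" by simp
qed

lemma L2_lincomb:
  assumes "f \<in> L2 M" "g \<in> L2 M"
  shows "(\<lambda>x. a * f x + b * g x) \<in> L2 M"
proof -
  have "integrable M (\<lambda>x. a\<^sup>2 * (f x)\<^sup>2 + 2 * a * b * (f x * g x) + b\<^sup>2 * (g x)\<^sup>2)"
    using assms integrable_L2_mult[OF assms] by (auto simp: L2_def)
  moreover have "(\<lambda>x. (a * f x + b * g x)\<^sup>2) =
      (\<lambda>x. a\<^sup>2 * (f x)\<^sup>2 + 2 * a * b * (f x * g x) + b\<^sup>2 * (g x)\<^sup>2)"
    by (auto simp: power2_eq_square algebra_simps)
  ultimately show ?thesis using assms by (auto simp: L2_def)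
qed

lemma L2_diff: "f \<in> L2 M \<Longrightarrow> g \<in> L2 M \<Longrightarrow> (\<lambda>x. f x - g x) \<in> L2 M"
  using L2_lincomb[of f M g 1 "-1"] by simp

lemma l2_norm_eq: "l2_norm M f = sqrt (\<integral>x. (f x)\<^sup>2 \<partial>M)"
  by (simp add: l2_norm_def l2_inner_def power2_eq_square)

lemma l2_norm_tendsto_0_iff:
  "(\<lambda>n. l2_norm M (h n)) \<longlonglongrightarrow> 0 \<longleftrightarrow> (\<lambda>n. \<integral>x. (h n x)\<^sup>2 \<partial>M) \<longlonglongrightarrow> 0"
proof
  assume "(\<lambda>n. l2_norm M (h n)) \<longlonglongrightarrow> 0"
  from tendsto_power[OF this, of 2] show "(\<lambda>n. \<integral>x. (h n x)\<^sup>2 \<partial>M) \<longlonglongrightarrow> 0"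
    by (simp add: l2_norm_eq)
next
  assume "(\<lambda>n. \<integral>x. (h n x)\<^sup>2 \<partial>M) \<longlonglongrightarrow> 0"
  from tendsto_real_sqrt[OF this] show "(\<lambda>n. l2_norm M (h n)) \<longlonglongrightarrow> 0"
    by (simp add: l2_norm_eq)
qed

lemma integral_square_add_le:
  assumes u: "u \<in> L2 M" and v: "v \<in> L2 M"
  shows "(\<integral>x. (u x + v x)\<^sup>2 \<partial>M) \<le> 2 * (\<integral>x. (u x)\<^sup>2 \<partial>M) + 2 * (\<integral>x. (v x)\<^sup>2 \<partial>M)"
proof -
  have "(\<integral>x. (u x + v x)\<^sup>2 \<partial>M) \<le> (\<integral>x. 2 * (u x)\<^sup>2 + 2 * (v x)\<^sup>2 \<partial>M)"
  proof (rule integral_mono)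
    show "integrable M (\<lambda>x. (u x + v x)\<^sup>2)"
      using L2_lincomb[OF u v, of 1 1] by (simp add: L2_def)
    show "integrable M (\<lambda>x. 2 * (u x)\<^sup>2 + 2 * (v x)\<^sup>2)" using u v by (simp add: L2_def)
    fix x
    have "0 \<le> (u x - v x)\<^sup>2" by simp
    then show "(u x + v x)\<^sup>2 \<le> 2 * (u x)\<^sup>2 + 2 * (v x)\<^sup>2"
      by (simp add: power2_eq_square algebra_simps)
  qed
  then show ?thesis using u v by (simp add: L2_def)
qed

lemma L2_AE_eq_0:
  assumes "f \<in> L2 M" "(\<integral>x. (f x)\<^sup>2 \<partial>M) \<le> 0"
  shows "AE x in M. f x = 0"
proof -
  have "(\<integral>x. (f x)\<^sup>2 \<partial>M) = 0" using assms(2) by (simp add: order_antisym)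
  then show ?thesis
    using integral_nonneg_eq_0_iff_AE[OF L2_integrable_square[OF assms(1)]] by simp
qed

lemma Bb_iff: "g \<in> Bb \<longleftrightarrow> g \<in> borel_measurable borel \<and> (\<exists>B. \<forall>x. \<bar>g x\<bar> \<le> B)"
  unfolding Bb_def bounded_iff by auto

lemma Bb_lincomb: "g \<in> Bb \<Longrightarrow> h \<in> Bb \<Longrightarrow> (\<lambda>x. a * g x + b * h x) \<in> Bb"
proof -
  assume g: "g \<in> Bb" and h: "h \<in> Bb"
  then obtain B C where B: "\<And>x. \<bar>g x\<bar> \<le> B" and C: "\<And>x. \<bar>h x\<bar> \<le> C" by (auto simp: Bb_iff)
  have "\<bar>a * g x + b * h x\<bar> \<le> \<bar>a\<bar> * B + \<bar>b\<bar> * C" for x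
  proof -
    have "\<bar>a * g x + b * h x\<bar> \<le> \<bar>a\<bar> * \<bar>g x\<bar> + \<bar>b\<bar> * \<bar>h x\<bar>"
      by (metis abs_mult abs_triangle_ineq)
    also have "\<dots> \<le> \<bar>a\<bar> * B + \<bar>b\<bar> * C" using B C by (intro add_mono mult_left_mono) auto
    finally show ?thesis .
  qed
  then show ?thesis using g h by (auto simp: Bb_iff)
qed

lemma Bb_mult: "g \<in> Bb \<Longrightarrow> h \<in> Bb \<Longrightarrow> (\<lambda>x. g x * h x) \<in> Bb"
proof -
  assume g: "g \<in> Bb" and h: "h \<in> Bb"
  then obtain B C where B: "\<And>x. \<bar>g x\<bar> \<le> B" and C: "\<And>x. \<bar>h x\<bar> \<le> C" by (auto simp: Bb_iff)
  have "\<bar>g x * h x\<bar> \<le> B * C" for x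
    unfolding abs_mult using B[of x] C[of x] by (intro mult_mono) auto
  then show ?thesis using g h by (auto simp: Bb_iff)
qed

lemma Bb_const: "(\<lambda>x. c) \<in> Bb"
  by (auto simp: Bb_iff)

lemma Bb_indicator: "A \<in> sets borel \<Longrightarrow> indicator A \<in> Bb"
  by (auto simp: Bb_iff indicator_def intro!: exI[of _ 1])

lemma Cb_subset_Bb: "f \<in> Cb \<Longrightarrow> f \<in> Bb"
  by (auto simp: Cb_def Bb_def intro: borel_measurable_continuous_onI)

lemma Cb_iff: "g \<in> Cb \<longleftrightarrow> continuous_on UNIV g \<and> (\<exists>B. \<forall>x. \<bar>g x\<bar> \<le> B)"
  unfolding Cb_def bounded_iff by auto

lemma Cb_lincomb: "g \<in> Cb \<Longrightarrow> h \<in> Cb \<Longrightarrow> (\<lambda>x. a * g x + b * h x) \<in> Cb"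
  using Bb_lincomb[OF Cb_subset_Bb Cb_subset_Bb, of g h a b]
  by (auto simp: Cb_iff Bb_iff intro!: continuous_intros)

lemma Cb_mult: "g \<in> Cb \<Longrightarrow> h \<in> Cb \<Longrightarrow> (\<lambda>x. g x * h x) \<in> Cb"
  using Bb_mult[OF Cb_subset_Bb Cb_subset_Bb, of g h]
  by (auto simp: Cb_iff Bb_iff intro!: continuous_intros)

section \<open>One-forms and their multiplication by functions\<close>

text \<open>Finiteness of the measure is part of the setting, because a measure of the form $\nu_\omega$
  has finite total mass.\<close>

locale local_dirichlet_forms =
  fixes M :: "'a::metric_space measure"
    and D :: "('a \<Rightarrow> real) set"
    and E :: "('a \<Rightarrow> real) \<Rightarrow> ('a \<Rightarrow> real) \<Rightarrow> real"
    and \<Gamma> :: "('a \<Rightarrow> real) \<Rightarrow> ('a \<Rightarrow> real) \<Rightarrow> 'a \<Rightarrow> real"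
    and tens :: "('a \<Rightarrow> real) \<Rightarrow> ('a \<Rightarrow> real) \<Rightarrow> 'h::{real_inner,complete_space}"
  assumes finite_M: "finite_measure M"
    and setting: "metric_measure_setting M"
    and dirichlet: "dirichlet_form M D E"
    and regular: "regular_form M D E"
    and strongly_local: "strongly_local M D E"
    and carre: "carre_du_champ M D E \<Gamma>"
    and forms: "one_forms M D \<Gamma> tens"
begin

sublocale finite_measure M by (rule finite_M)

lemma sets_M[measurable_cong]: "sets M = sets borel"
  using setting by (simp add: metric_measure_setting_def)

lemma space_M: "space M = UNIV"
  using sets_eq_imp_space_eq[OF sets_M] by simp

lemma D_L2: "f \<in> D \<Longrightarrow> f \<in> L2 M"
  and D_AE: "f \<in> D \<Longrightarrow> g \<in> borel_measurable M \<Longrightarrow> (AE x in M. f x = g x) \<Longrightarrow> g \<in> D"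
  and D_zero: "(\<lambda>x. 0) \<in> D"
  and D_lincomb: "f \<in> D \<Longrightarrow> g \<in> D \<Longrightarrow> (\<lambda>x. a * f x + b * g x) \<in> D"
  and D_dense: "f \<in> L2 M \<Longrightarrow> \<epsilon> > 0 \<Longrightarrow> \<exists>g\<in>D. l2_norm M (\<lambda>x. g x - f x) < \<epsilon>"
  and E_AE: "f \<in> D \<Longrightarrow> g \<in> D \<Longrightarrow> h \<in> D \<Longrightarrow> (AE x in M. f x = g x) \<Longrightarrow> E f h = E g h"
  and E_sym: "f \<in> D \<Longrightarrow> g \<in> D \<Longrightarrow> E f g = E g f"
  and E_lincomb: "f \<in> D \<Longrightarrow> g \<in> D \<Longrightarrow> h \<in> D \<Longrightarrow>
      E (\<lambda>x. a * f x + b * g x) h = a * E f h + b * E g h"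
  and E_nonneg: "f \<in> D \<Longrightarrow> E f f \<ge> 0"
  and E_closed: "(\<And>n. u n \<in> D) \<Longrightarrow>
      (\<And>\<epsilon>. \<epsilon> > 0 \<Longrightarrow> \<exists>K::nat. \<forall>m\<ge>K. \<forall>n\<ge>K. E1_norm M E (\<lambda>x. u m x - u n x) < \<epsilon>) \<Longrightarrow>
      \<exists>f\<in>D. (\<lambda>n. E1_norm M E (\<lambda>x. u n x - f x)) \<longlonglongrightarrow> 0"
  and D_unit: "f \<in> D \<Longrightarrow> (\<lambda>x. min 1 (max 0 (f x))) \<in> D"
  and E_unit: "f \<in> D \<Longrightarrow> E (\<lambda>x. min 1 (max 0 (f x))) (\<lambda>x. min 1 (max 0 (f x))) \<le> E f f"
proof -
  note d = dirichlet[unfolded dirichlet_form_def]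
  have d1: "D \<subseteq> L2 M"
    and d2: "\<forall>f\<in>D. \<forall>g\<in>borel_measurable M. (AE x in M. f x = g x) \<longrightarrow> g \<in> D"
    and d3: "(\<lambda>x. 0) \<in> D"
    and d4: "\<forall>f\<in>D. \<forall>g\<in>D. \<forall>a b. (\<lambda>x. a * f x + b * g x) \<in> D"
    and d5: "\<forall>f\<in>L2 M. \<forall>\<epsilon>>0. \<exists>g\<in>D. l2_norm M (\<lambda>x. g x - f x) < \<epsilon>"
    and d6: "\<forall>f\<in>D. \<forall>g\<in>D. \<forall>h\<in>D. (AE x in M. f x = g x) \<longrightarrow> E f h = E g h"
    and d7: "\<forall>f\<in>D. \<forall>g\<in>D. E f g = E g f"
    and d8: "\<forall>f\<in>D. \<forall>g\<in>D. \<forall>h\<in>D. \<forall>a b. E (\<lambda>x. a * f x + b * g x) h = a * E f h + b * E g h"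
    and d9: "\<forall>f\<in>D. E f f \<ge> 0"
    and d10: "\<forall>u. (\<forall>n. u n \<in> D) \<and>
          (\<forall>\<epsilon>>0. \<exists>K::nat. \<forall>m\<ge>K. \<forall>n\<ge>K. E1_norm M E (\<lambda>x. u m x - u n x) < \<epsilon>) \<longrightarrow>
        (\<exists>f\<in>D. (\<lambda>n. E1_norm M E (\<lambda>x. u n x - f x)) \<longlonglongrightarrow> 0)"
    and d11: "\<forall>f\<in>D. (\<lambda>x. min 1 (max 0 (f x))) \<in> D \<and>
        E (\<lambda>x. min 1 (max 0 (f x))) (\<lambda>x. min 1 (max 0 (f x))) \<le> E f f"
    using d by - (elim conjE, assumption)+
  show "f \<in> D \<Longrightarrow> f \<in> L2 M" using d1 by blast
  show "f \<in> D \<Longrightarrow> g \<in> borel_measurable M \<Longrightarrow> (AE x in M. f x = g x) \<Longrightarrow> g \<in> D" using d2 by blast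
  show "(\<lambda>x. 0) \<in> D" by (rule d3)
  show "f \<in> D \<Longrightarrow> g \<in> D \<Longrightarrow> (\<lambda>x. a * f x + b * g x) \<in> D" using d4 by blast
  show "f \<in> L2 M \<Longrightarrow> \<epsilon> > 0 \<Longrightarrow> \<exists>g\<in>D. l2_norm M (\<lambda>x. g x - f x) < \<epsilon>" using d5 by blast
  show "f \<in> D \<Longrightarrow> g \<in> D \<Longrightarrow> h \<in> D \<Longrightarrow> (AE x in M. f x = g x) \<Longrightarrow> E f h = E g h" using d6 by blast
  show "f \<in> D \<Longrightarrow> g \<in> D \<Longrightarrow> E f g = E g f" using d7 by blast
  show "f \<in> D \<Longrightarrow> g \<in> D \<Longrightarrow> h \<in> D \<Longrightarrow>
      E (\<lambda>x. a * f x + b * g x) h = a * E f h + b * E g h" using d8 by blast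
  show "f \<in> D \<Longrightarrow> E f f \<ge> 0" using d9 by blast
  show "(\<And>n. u n \<in> D) \<Longrightarrow>
      (\<And>\<epsilon>. \<epsilon> > 0 \<Longrightarrow> \<exists>K::nat. \<forall>m\<ge>K. \<forall>n\<ge>K. E1_norm M E (\<lambda>x. u m x - u n x) < \<epsilon>) \<Longrightarrow>
      \<exists>f\<in>D. (\<lambda>n. E1_norm M E (\<lambda>x. u n x - f x)) \<longlonglongrightarrow> 0" using spec[OF d10, of u] by blast
  show "f \<in> D \<Longrightarrow> (\<lambda>x. min 1 (max 0 (f x))) \<in> D" using d11 by blast
  show "f \<in> D \<Longrightarrow> E (\<lambda>x. min 1 (max 0 (f x))) (\<lambda>x. min 1 (max 0 (f x))) \<le> E f f" using d11 by blast
qed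

lemma D_scale: "f \<in> D \<Longrightarrow> (\<lambda>x. a * f x) \<in> D"
  using D_lincomb[of f f a 0] by simp

lemma D_diff: "f \<in> D \<Longrightarrow> g \<in> D \<Longrightarrow> (\<lambda>x. f x - g x) \<in> D"
  using D_lincomb[of f g 1 "-1"] by simp

lemma \<Gamma>_integrable: "f \<in> D \<Longrightarrow> g \<in> D \<Longrightarrow> integrable M (\<Gamma> f g)"
  and \<Gamma>_lincomb: "f \<in> D \<Longrightarrow> g \<in> D \<Longrightarrow> h \<in> D \<Longrightarrow>
      AE x in M. \<Gamma> (\<lambda>y. a * f y + b * g y) h x = a * \<Gamma> f h x + b * \<Gamma> g h x"
  and E_\<Gamma>: "f \<in> D \<Longrightarrow> g \<in> D \<Longrightarrow> E f g = (\<integral>x. \<Gamma> f g x \<partial>M)"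
  and \<Gamma>_product: "f \<in> D \<Longrightarrow> g \<in> D \<Longrightarrow> h \<in> D \<Longrightarrow>
      ess_bounded M f \<Longrightarrow> ess_bounded M g \<Longrightarrow> ess_bounded M h \<Longrightarrow>
      2 * (\<integral>x. h x * \<Gamma> f g x \<partial>M) =
        E (\<lambda>x. f x * h x) g + E (\<lambda>x. g x * h x) f - E (\<lambda>x. f x * g x) h"
proof -
  have c1: "\<forall>f\<in>D. \<forall>g\<in>D. integrable M (\<Gamma> f g)"
    and c3: "\<forall>f\<in>D. \<forall>g\<in>D. \<forall>h\<in>D. \<forall>a b.
        AE x in M. \<Gamma> (\<lambda>y. a * f y + b * g y) h x = a * \<Gamma> f h x + b * \<Gamma> g h x"
    and c4: "\<forall>f\<in>D. \<forall>g\<in>D. E f g = (\<integral>x. \<Gamma> f g x \<partial>M)"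
    and c5: "\<forall>f\<in>D. \<forall>g\<in>D. \<forall>h\<in>D. ess_bounded M f \<and> ess_bounded M g \<and> ess_bounded M h \<longrightarrow>
        2 * (\<integral>x. h x * \<Gamma> f g x \<partial>M) =
          E (\<lambda>x. f x * h x) g + E (\<lambda>x. g x * h x) f - E (\<lambda>x. f x * g x) h"
    using carre[unfolded carre_du_champ_def] by - (elim conjE, assumption)+
  show "f \<in> D \<Longrightarrow> g \<in> D \<Longrightarrow> integrable M (\<Gamma> f g)" using c1 by blast
  show "f \<in> D \<Longrightarrow> g \<in> D \<Longrightarrow> h \<in> D \<Longrightarrow>
      AE x in M. \<Gamma> (\<lambda>y. a * f y + b * g y) h x = a * \<Gamma> f h x + b * \<Gamma> g h x" using c3 by blast
  show "f \<in> D \<Longrightarrow> g \<in> D \<Longrightarrow> E f g = (\<integral>x. \<Gamma> f g x \<partial>M)" using c4 by blast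
  show "f \<in> D \<Longrightarrow> g \<in> D \<Longrightarrow> h \<in> D \<Longrightarrow>
      ess_bounded M f \<Longrightarrow> ess_bounded M g \<Longrightarrow> ess_bounded M h \<Longrightarrow>
      2 * (\<integral>x. h x * \<Gamma> f g x \<partial>M) =
        E (\<lambda>x. f x * h x) g + E (\<lambda>x. g x * h x) f - E (\<lambda>x. f x * g x) h" using c5 by blast
qed

text \<open>The functions that can occur on the left of an elementary tensor.\<close>

abbreviation "CD \<equiv> Cb \<inter> D"

lemma CD_lincomb: "f \<in> CD \<Longrightarrow> g \<in> CD \<Longrightarrow> (\<lambda>x. a * f x + b * g x) \<in> CD"
  using Cb_lincomb D_lincomb by blast

lemma inner_tens: "f1 \<in> CD \<Longrightarrow> f2 \<in> CD \<Longrightarrow> g1 \<in> Bb \<Longrightarrow> g2 \<in> Bb \<Longrightarrow>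
    inner (tens f1 g1) (tens f2 g2) = (\<integral>x. g1 x * g2 x * \<Gamma> f1 f2 x \<partial>M)"
  using forms unfolding one_forms_def by blast

lemma integrable_Bb_mult:
  assumes g: "g \<in> Bb" and k: "integrable M k"
  shows "integrable M (\<lambda>x. g x * k x :: real)"
proof -
  obtain B where B: "\<And>x. \<bar>g x\<bar> \<le> B" using g by (auto simp: Bb_iff)
  have [measurable]: "g \<in> borel_measurable M" using g
      by (simp add: Bb_iff measurable_cong_sets[OF sets_M refl])
  note [measurable] = borel_measurable_integrable[OF k]
  show ?thesis
  proof (rule Bochner_Integration.integrable_bound)
    show "integrable M (\<lambda>x. B * k x)" using k by simp
    show "AE x in M. norm (g x * k x) \<le> norm (B * k x)"
      using B by (intro AE_I2) (simp add: abs_mult, metis abs_ge_self abs_ge_zero mult_right_mono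
          order_trans)
  qed measurable
qed

lemma integrable_BB_\<Gamma>:
  "f1 \<in> CD \<Longrightarrow> f2 \<in> CD \<Longrightarrow> g1 \<in> Bb \<Longrightarrow> g2 \<in> Bb \<Longrightarrow> integrable M (\<lambda>x. g1 x * g2 x * \<Gamma> f1 f2 x)"
  using integrable_Bb_mult[OF Bb_mult \<Gamma>_integrable, of g1 g2 f1 f2] by simp

text \<open>Elementary tensors span a dense subspace, so closed linear properties need to be checked only on
  them.\<close>

lemma forms_induct:
  assumes "closed S" "Real_Vector_Spaces.subspace S" and "\<And>f g. f \<in> CD \<Longrightarrow> g \<in> Bb \<Longrightarrow> tens f g \<in> S"
  shows "\<xi> \<in> S"
proof -
  have "span {tens f g |f g. f \<in> CD \<and> g \<in> Bb} \<subseteq> S"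
    using assms by (intro span_minimal) auto
  then have "closure (span {tens f g |f g. f \<in> CD \<and> g \<in> Bb}) \<subseteq> S"
    using assms(1) by (rule closure_minimal)
  then show ?thesis using forms unfolding one_forms_def by blast
qed

lemma forms_eqI:
  assumes "\<And>f g. f \<in> CD \<Longrightarrow> g \<in> Bb \<Longrightarrow> inner \<xi> (tens f g) = inner \<eta> (tens f g)"
  shows "\<xi> = \<eta>"
proof -
  have "\<xi> - \<eta> \<in> {\<zeta>. inner (\<xi> - \<eta>) \<zeta> = 0}"
  proof (rule forms_induct)
    show "closed {\<zeta>. inner (\<xi> - \<eta>) \<zeta> = 0}" by (intro closed_Collect_eq continuous_intros)
    show "Real_Vector_Spaces.subspace {\<zeta>. inner (\<xi> - \<eta>) \<zeta> = 0}"
        by (auto simp: real_vector.subspace_def inner_add_right)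
  qed (use assms in \<open>auto simp: inner_diff_left\<close>)
  then show ?thesis by simp
qed

lemma tens_lincomb_left:
  assumes f: "f1 \<in> CD" "f2 \<in> CD" and g: "g \<in> Bb"
  shows "tens (\<lambda>x. a * f1 x + b * f2 x) g = a *\<^sub>R tens f1 g + b *\<^sub>R tens f2 g"
proof (rule forms_eqI)
  fix h k :: "'a \<Rightarrow> real" assume h: "h \<in> CD" and k: "k \<in> Bb"
  note [simp] = integrable_BB_\<Gamma>[OF f(1) h g k] integrable_BB_\<Gamma>[OF f(2) h g k]
  have "(\<integral>x. g x * k x * \<Gamma> (\<lambda>x. a * f1 x + b * f2 x) h x \<partial>M) =
      (\<integral>x. a * (g x * k x * \<Gamma> f1 h x) + b * (g x * k x * \<Gamma> f2 h x) \<partial>M)"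
  proof (rule integral_cong_AE)
    show "AE x in M. g x * k x * \<Gamma> (\<lambda>x. a * f1 x + b * f2 x) h x =
        a * (g x * k x * \<Gamma> f1 h x) + b * (g x * k x * \<Gamma> f2 h x)"
      using \<Gamma>_lincomb[of f1 f2 h a b] f h by (auto simp: algebra_simps)
  qed (intro borel_measurable_integrable integrable_BB_\<Gamma> CD_lincomb f h g k
        Bochner_Integration.integrable_add integrable_mult_right)+
  then show "inner (tens (\<lambda>x. a * f1 x + b * f2 x) g) (tens h k) =
      inner (a *\<^sub>R tens f1 g + b *\<^sub>R tens f2 g) (tens h k)"
    using f h g k by (simp add: inner_tens CD_lincomb inner_add_left del: Int_iff)
qed

lemma tens_lincomb_right:
  assumes f: "f \<in> CD" and g: "g1 \<in> Bb" "g2 \<in> Bb"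
  shows "tens f (\<lambda>x. a * g1 x + b * g2 x) = a *\<^sub>R tens f g1 + b *\<^sub>R tens f g2"
proof (rule forms_eqI)
  fix h k :: "'a \<Rightarrow> real" assume h: "h \<in> CD" and k: "k \<in> Bb"
  note [simp] = integrable_BB_\<Gamma>[OF f h g(1) k] integrable_BB_\<Gamma>[OF f h g(2) k]
  have "(\<integral>x. (a * g1 x + b * g2 x) * k x * \<Gamma> f h x \<partial>M) =
      (\<integral>x. a * (g1 x * k x * \<Gamma> f h x) + b * (g2 x * k x * \<Gamma> f h x) \<partial>M)"
    by (simp add: algebra_simps)
  then show "inner (tens f (\<lambda>x. a * g1 x + b * g2 x)) (tens h k) =
      inner (a *\<^sub>R tens f g1 + b *\<^sub>R tens f g2) (tens h k)"
    using f h g k by (simp add: inner_tens Bb_lincomb inner_add_left del: Int_iff)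
qed

text \<open>If \<open>s^2 = C^2 - a^2\<close>, then $|\xi a|^2 + |\xi s|^2 = C^2 |\xi|^2$ on the span of the
  elementary tensors. This gives the norm bound for multiplication by \<open>a\<close> directly from the inner product
  formula. The operator \<open>\<xi> \<mapsto> (\<xi> a, \<xi> s)\<close> is extended as a whole.\<close>

lemma form_mult_exists:
  assumes a: "a \<in> Bb" and C: "\<And>x. \<bar>a x\<bar> \<le> C"
  shows "\<exists>T. bounded_linear T \<and> (\<forall>\<xi>. norm (T \<xi>) \<le> C * norm \<xi>) \<and>
     (\<forall>f\<in>CD. \<forall>g\<in>Bb. T (tens f g) = tens f (\<lambda>x. g x * a x))"
proof -
  have C0: "C \<ge> 0" using C[of undefined] by linarith
  have sq: "(a x)\<^sup>2 \<le> C\<^sup>2" for x using C[of x] by (metis abs_ge_zero power2_abs power_mono)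
  define s where "s x = sqrt (C\<^sup>2 - (a x)\<^sup>2)" for x
  have s2: "s x * s x = C\<^sup>2 - a x * a x" for x
    unfolding s_def using sq[of x] by (simp add: power2_eq_square)
  have sB: "s \<in> Bb"
  proof -
    have "\<bar>s x\<bar> \<le> C" for x
      unfolding s_def using sq[of x] C0 by (simp add: real_le_lsqrt)
    moreover have "s \<in> borel_measurable borel"
    proof -
      have [measurable]: "a \<in> borel_measurable borel" using a by (simp add: Bb_iff)
      show ?thesis unfolding s_def by measurable
    qed
    ultimately show ?thesis by (auto simp: Bb_iff)
  qed
  define S where "S = {(tens f g, tens f (\<lambda>x. g x * a x), tens f (\<lambda>x. g x * s x)) |f g. f \<in> CD
      \<and> g \<in> Bb}"
  define Q where "Q p q \<longleftrightarrow> C\<^sup>2 * inner (fst p) (fst q) = inner (snd p) (snd q)"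
      for p q :: "'h \<times> 'h \<times> 'h"
  have Q1: "Q p q" if "p \<in> S" "q \<in> S" for p q
  proof -
    obtain f1 g1 f2 g2 where fg: "f1 \<in> CD" "f2 \<in> CD" "g1 \<in> Bb" "g2 \<in> Bb"
      and p: "p = (tens f1 g1, tens f1 (\<lambda>x. g1 x * a x), tens f1 (\<lambda>x. g1 x * s x))"
      and q: "q = (tens f2 g2, tens f2 (\<lambda>x. g2 x * a x), tens f2 (\<lambda>x. g2 x * s x))"
      using \<open>p \<in> S\<close> \<open>q \<in> S\<close> unfolding S_def by blast
    have "inner (snd p) (snd q) =
        (\<integral>x. (g1 x * a x) * (g2 x * a x) * \<Gamma> f1 f2 x \<partial>M)
            + (\<integral>x. (g1 x * s x) * (g2 x * s x) * \<Gamma> f1 f2 x \<partial>M)"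
      using fg a sB by (simp add: p q inner_tens Bb_mult del: Int_iff)
    also have "\<dots> = (\<integral>x. (g1 x * a x) * (g2 x * a x) * \<Gamma> f1 f2 x
        + (g1 x * s x) * (g2 x * s x) * \<Gamma> f1 f2 x \<partial>M)"
      by (intro Bochner_Integration.integral_add[symmetric] integrable_BB_\<Gamma> fg Bb_mult a sB)
    also have "\<dots> = (\<integral>x. C\<^sup>2 * (g1 x * g2 x * \<Gamma> f1 f2 x) \<partial>M)"
    proof (rule Bochner_Integration.integral_cong[OF refl])
      fix x
      have "(g1 x * a x) * (g2 x * a x) * \<Gamma> f1 f2 x + (g1 x * s x) * (g2 x * s x) * \<Gamma> f1 f2 x
          = (a x * a x + s x * s x) * (g1 x * g2 x * \<Gamma> f1 f2 x)" by (simp add: algebra_simps)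
      then show "(g1 x * a x) * (g2 x * a x) * \<Gamma> f1 f2 x + (g1 x * s x) * (g2 x * s x) * \<Gamma> f1 f2 x
          = C\<^sup>2 * (g1 x * g2 x * \<Gamma> f1 f2 x)" by (simp add: s2)
    qed
    also have "\<dots> = C\<^sup>2 * inner (fst p) (fst q)" using fg by (simp add: p q inner_tens del: Int_iff)
    finally show ?thesis by (simp add: Q_def)
  qed
  have sub: "Real_Vector_Spaces.subspace {p. Q p q}" "Real_Vector_Spaces.subspace {p. Q q p}" for q
    by (auto simp: real_vector.subspace_def Q_def inner_add_left inner_add_right algebra_simps)
  have Q2: "Q p q" if "p \<in> span S" "q \<in> S" for p q
    using span_minimal[of S "{p. Q p q}"] sub(1) Q1 that by blast
  have Q3: "Q p q" if "p \<in> span S" "q \<in> span S" for p q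
    using span_minimal[of S "{q. Q p q}"] sub(2) Q2 that by blast
  have "\<exists>T. bounded_linear T \<and> (\<forall>x. norm (T x) \<le> C * norm x) \<and> (\<forall>p\<in>S. T (fst p) = snd p)"
  proof (rule bounded_linear_extension_dense)
    fix p assume "p \<in> span S"
    then have "(norm (snd p))\<^sup>2 = (C * norm (fst p))\<^sup>2"
      using Q3[of p p] by (simp add: Q_def power_mult_distrib power2_norm_eq_inner)
    then show "norm (snd p) \<le> C * norm (fst p)" using C0 by (simp add: power2_eq_iff_nonneg)
  next
    have "fst ` S = {tens f g |f g. f \<in> CD \<and> g \<in> Bb}" unfolding S_def by force
    then show "closure (span (fst ` S)) = UNIV" using forms unfolding one_forms_def by simp
  qed
  then obtain T where T: "bounded_linear T" "\<And>x. norm (T x) \<le> C * norm x" "\<And>p. p \<in> S \<Longrightarrow> T (fst p)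
      = snd p"
    by blast
  show ?thesis
  proof (intro exI[of _ "\<lambda>\<xi>. fst (T \<xi>)"] conjI allI ballI)
    show "bounded_linear (\<lambda>\<xi>. fst (T \<xi>))" by (rule bounded_linear_fst_comp[OF T(1)])
    show "norm (fst (T \<xi>)) \<le> C * norm \<xi>" for \<xi>
      using norm_fst_le[of "fst (T \<xi>)" "snd (T \<xi>)"] T(2)[of \<xi>] by simp
    fix f g :: "'a \<Rightarrow> real" assume "f \<in> CD" "g \<in> Bb"
    then have "(tens f g, tens f (\<lambda>x. g x * a x), tens f (\<lambda>x. g x * s x)) \<in> S" unfolding S_def
        by blast
    from T(3)[OF this] show "fst (T (tens f g)) = tens f (\<lambda>x. g x * a x)" by simp
  qed
qed

lemma bounded_linear_eq_on_tens:
  assumes T: "bounded_linear T" and U: "bounded_linear U"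
    and eq: "\<And>f g. f \<in> CD \<Longrightarrow> g \<in> Bb \<Longrightarrow> T (tens f g) = U (tens f g)"
  shows "T \<xi> = (U \<xi> :: 'b::real_normed_vector)"
proof -
  have "\<xi> \<in> {\<xi>. T \<xi> = U \<xi>}"
  proof (rule forms_induct)
    show "closed {\<xi>. T \<xi> = U \<xi>}"
      by (intro closed_Collect_eq linear_continuous_on T U)
    show "Real_Vector_Spaces.subspace {\<xi>. T \<xi> = U \<xi>}"
      using linear_0[OF bounded_linear.linear[OF T]] linear_0[OF bounded_linear.linear[OF U]]
      by (auto simp: real_vector.subspace_def bounded_linear.linear[OF T] bounded_linear.linear[OF
          U]
          linear_add linear_cmul)
  qed (use eq in auto)
  then show ?thesis by simp
qed

text \<open>Multiplication of forms by the function \<open>a\<close>.\<close>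

abbreviation "fmul a \<equiv> form_mult D tens a"

lemma form_mult:
  assumes a: "a \<in> Bb"
  shows bounded_linear_form_mult: "bounded_linear (fmul a)"
    and form_mult_tens: "\<And>f g. f \<in> CD \<Longrightarrow> g \<in> Bb \<Longrightarrow> fmul a (tens f g) = tens f (\<lambda>x. g x * a x)"
    and norm_form_mult_le: "\<And>C \<xi>. (\<And>x. \<bar>a x\<bar> \<le> C) \<Longrightarrow> norm (fmul a \<xi>) \<le> C * norm \<xi>"
proof -
  define P where "P T \<longleftrightarrow> bounded_linear T \<and>
     (\<forall>f\<in>CD. \<forall>g\<in>Bb. T (tens f g) = tens f (\<lambda>x. g x * a x))" for T
  have un: "T = U" if "P T" "P U" for T U
    using bounded_linear_eq_on_tens[of T U] that unfolding P_def by (auto simp: fun_eq_iff)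
  have ex: "\<exists>T. P T \<and> (\<forall>\<xi>. norm (T \<xi>) \<le> C * norm \<xi>)" if "\<And>x. \<bar>a x\<bar> \<le> C" for C
    using form_mult_exists[OF a that] unfolding P_def by blast
  obtain C where "\<And>x. \<bar>a x\<bar> \<le> C" using a by (auto simp: Bb_iff)
  then have "\<exists>!T. P T" using ex un by blast
  then have P: "P (fmul a)" unfolding form_mult_def P_def by (rule theI')
  then show "bounded_linear (fmul a)"
    and "\<And>f g. f \<in> CD \<Longrightarrow> g \<in> Bb \<Longrightarrow> fmul a (tens f g) = tens f (\<lambda>x. g x * a x)"
    unfolding P_def by blast+
  show "norm (fmul a \<xi>) \<le> C * norm \<xi>" if "\<And>x. \<bar>a x\<bar> \<le> C" for C \<xi>
    using ex[OF that] un[OF P] by blast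
qed

lemma inner_form_mult:
  assumes a: "a \<in> Bb"
  shows "inner (fmul a \<xi>) \<eta> = inner \<xi> (fmul a \<eta>)"
proof -
  note bl = bounded_linear_form_mult[OF a]
  have 1: "inner (fmul a (tens f g)) (tens h k) = inner (tens f g) (fmul a (tens h k))"
    if "f \<in> CD" "h \<in> CD" "g \<in> Bb" "k \<in> Bb" for f g h k :: "'a \<Rightarrow> real"
    using that a by (simp add: form_mult_tens inner_tens Bb_mult ac_simps del: Int_iff)
  have 2: "inner (fmul a \<xi>) (tens h k) = inner \<xi> (fmul a (tens h k))"
    if "h \<in> CD" "k \<in> Bb" for \<xi> and h k :: "'a \<Rightarrow> real"
    by (rule bounded_linear_eq_on_tens[OF bounded_linear_inner_left_comp[OF bl]
        bounded_linear_inner_left])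
      (use 1 that in blast)
  show ?thesis
    by (rule bounded_linear_eq_on_tens[OF bounded_linear_inner_right
        bounded_linear_inner_right_comp[OF bl]])
      (use 2 in blast)
qed

lemma form_mult_mult:
  assumes a: "a \<in> Bb" and b: "b \<in> Bb"
  shows "fmul a (fmul b \<xi>) = fmul (\<lambda>x. b x * a x) \<xi>"
  by (rule bounded_linear_eq_on_tens[OF bounded_linear_compose[OF bounded_linear_form_mult[OF a]
      bounded_linear_form_mult[OF b]] bounded_linear_form_mult[OF Bb_mult[OF b a]]])
    (simp add: form_mult_tens a b Bb_mult mult.assoc del: Int_iff)

lemma form_mult_lincomb:
  assumes a: "a \<in> Bb" and b: "b \<in> Bb"
  shows "fmul (\<lambda>x. c * a x + d * b x) \<xi> = c *\<^sub>R fmul a \<xi> + d *\<^sub>R fmul b \<xi>"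
proof (rule bounded_linear_eq_on_tens[OF bounded_linear_form_mult[OF Bb_lincomb[OF a b]]])
  show "bounded_linear (\<lambda>\<xi>. c *\<^sub>R fmul a \<xi> + d *\<^sub>R fmul b \<xi>)"
    by (intro bounded_linear_add bounded_linear_const_scaleR bounded_linear_form_mult a b)
  fix f g :: "'a \<Rightarrow> real" assume fg: "f \<in> CD" "g \<in> Bb"
  have "tens f (\<lambda>x. g x * (c * a x + d * b x)) = tens f (\<lambda>x. c * (g x * a x) + d * (g x * b x))"
    by (simp add: algebra_simps)
  then show "fmul (\<lambda>x. c * a x + d * b x) (tens f g) = c *\<^sub>R fmul a (tens f g)
      + d *\<^sub>R fmul b (tens f g)"
    using fg a b by (simp add: form_mult_tens Bb_lincomb Bb_mult tens_lincomb_right del: Int_iff)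
qed

lemma form_mult_one: "fmul (\<lambda>x. 1) \<xi> = \<xi>"
  by (rule bounded_linear_eq_on_tens[OF bounded_linear_form_mult[OF Bb_const] bounded_linear_ident])
    (simp add: form_mult_tens Bb_const del: Int_iff)

end

section \<open>The direct integral\<close>

context local_dirichlet_forms
begin

lemma Bb_measurable: "g \<in> Bb \<Longrightarrow> g \<in> borel_measurable M"
  by (simp add: Bb_iff measurable_cong_sets[OF sets_M refl])

lemma indicator_Bb: "A \<in> sets M \<Longrightarrow> indicator A \<in> Bb"
  by (simp add: Bb_indicator sets_M)

lemma form_mult_null:
  assumes A: "A \<in> null_sets M"
  shows "fmul (indicator A) \<xi> = 0"
proof -
  have AB: "indicator A \<in> Bb" using A by (intro indicator_Bb) auto
  show ?thesis
  proof (rule bounded_linear_eq_on_tens[OF bounded_linear_form_mult[OF AB] bounded_linear_zero])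
    fix f g :: "'a \<Rightarrow> real" assume fg: "f \<in> CD" "g \<in> Bb"
    let ?g = "\<lambda>x. g x * indicator A x"
    have gA: "?g \<in> Bb" by (rule Bb_mult[OF fg(2) AB])
    have "inner (tens f ?g) (tens f ?g) = (\<integral>x. ?g x * ?g x * \<Gamma> f f x \<partial>M)"
      by (rule inner_tens[OF fg(1) fg(1) gA gA])
    also have "\<dots> = 0"
      using AE_not_in[OF A] by (intro integral_eq_zero_AE) (auto elim!: AE_mp)
    finally show "fmul (indicator A) (tens f g) = 0"
      using form_mult_tens[OF AB fg] by simp
  qed
qed

lemma form_mult_decseq:
  assumes A: "range A \<subseteq> sets M" "decseq A" "(\<Inter>i. A i) = {}"
  shows "(\<lambda>i. fmul (indicator (A i)) \<xi>) \<longlonglongrightarrow> 0"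
proof -
  have AB: "indicator (A i) \<in> Bb" for i using A(1) by (intro indicator_Bb) auto
  have le: "norm (fmul (indicator (A i)) \<zeta>) \<le> norm \<zeta>" for i \<zeta>
    using norm_form_mult_le[OF AB, of i 1 \<zeta>] by (simp add: indicator_def)
  have lin: "bounded_linear (fmul (indicator (A i)))" for i
      by (rule bounded_linear_form_mult[OF AB])
  define S where "S = {\<xi>. (\<lambda>i. fmul (indicator (A i)) \<xi>) \<longlonglongrightarrow> 0}"
  have "\<xi> \<in> S"
  proof (rule forms_induct)
    show "Real_Vector_Spaces.subspace S"
    proof (unfold real_vector.subspace_def, intro conjI ballI allI)
      show "0 \<in> S" using linear_0[OF bounded_linear.linear[OF lin]] by (simp add: S_def)
    next
      fix x y assume "x \<in> S" "y \<in> S"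
      then have "(\<lambda>i. fmul (indicator (A i)) x + fmul (indicator (A i)) y) \<longlonglongrightarrow> 0 + 0"
        unfolding S_def by (intro tendsto_add) auto
      then show "x + y \<in> S" by (simp add: S_def linear_add[OF bounded_linear.linear[OF lin]])
    next
      fix c and x assume "x \<in> S"
      then have "(\<lambda>i. c *\<^sub>R fmul (indicator (A i)) x) \<longlonglongrightarrow> c *\<^sub>R 0"
        unfolding S_def by (intro tendsto_intros) auto
      then show "c *\<^sub>R x \<in> S" by (simp add: S_def linear_cmul[OF bounded_linear.linear[OF lin]])
    qed
  next
    show "closed S"
      unfolding closed_sequential_limits
    proof (intro allI impI, elim conjE)
      fix u l assume u: "\<forall>n. u n \<in> S" "u \<longlonglongrightarrow> l"
      show "l \<in> S" unfolding S_def mem_Collect_eq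
      proof (rule LIMSEQ_I)
        fix r :: real assume r: "r > 0"
        then obtain n where n: "norm (u n - l) < r / 2"
          using LIMSEQ_D[OF u(2), of "r / 2"] by auto
        have "(\<lambda>i. fmul (indicator (A i)) (u n)) \<longlonglongrightarrow> 0" using u(1) by (simp add: S_def)
        then obtain K where K: "\<And>i. i \<ge> K \<Longrightarrow> norm (fmul (indicator (A i)) (u n)) < r / 2"
          using LIMSEQ_D[of _ 0 "r / 2"] r by auto
        have "norm (fmul (indicator (A i)) l) < r" if i: "i \<ge> K" for i
        proof -
          have "fmul (indicator (A i)) l = fmul (indicator (A i)) (u n)
              - fmul (indicator (A i)) (u n - l)"
            by (simp add: linear_diff[OF bounded_linear.linear[OF lin]])
          then have "norm (fmul (indicator (A i)) l) \<le>
              norm (fmul (indicator (A i)) (u n)) + norm (fmul (indicator (A i)) (u n - l))"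
            by (metis norm_triangle_ineq4)
          then show ?thesis using K[OF i] le[of i "u n - l"] n by linarith
        qed
        then show "\<exists>K. \<forall>i\<ge>K. norm (fmul (indicator (A i)) l - 0) < r" by auto
      qed
    qed
  next
    fix f g :: "'a \<Rightarrow> real" assume fg: "f \<in> CD" "g \<in> Bb"
    have gA: "(\<lambda>x. g x * indicator (A i) x) \<in> Bb" for i by (rule Bb_mult[OF fg(2) AB])
    have lim: "(\<lambda>i. indicator (A i) x :: real) \<longlonglongrightarrow> 0" for x
    proof -
      obtain K where K: "x \<notin> A K" using A(3) by blast
      have "indicator (A i) x = (0::real)" if "i \<ge> K" for i
        using decseqD[OF A(2) that] K by (auto simp: indicator_def)
      then show ?thesis by (intro tendsto_eventually) (auto simp: eventually_sequentially)
    qed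
    have "(\<lambda>i. \<integral>x. (g x * indicator (A i) x) * (g x * indicator (A i) x) * \<Gamma> f f x \<partial>M) \<longlonglongrightarrow> (\<integral>x. 0 \<partial>M)"
    proof (rule integral_dominated_convergence[where w="\<lambda>x. norm (g x * g x * \<Gamma> f f x)"])
      show "integrable M (\<lambda>x. norm (g x * g x * \<Gamma> f f x))"
        by (intro integrable_norm integrable_BB_\<Gamma> fg)
      show "(\<lambda>x. (g x * indicator (A i) x) * (g x * indicator (A i) x) * \<Gamma> f f x) \<in> borel_measurable
          M" for i
        by (intro borel_measurable_integrable integrable_BB_\<Gamma> fg gA)
      show "AE x in M. (\<lambda>i. (g x * indicator (A i) x) * (g x * indicator (A i) x) * \<Gamma> f f x) \<longlonglongrightarrow> 0"
      proof (rule AE_I2)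
        fix x
        have "(\<lambda>i. (g x * indicator (A i) x) * (g x * indicator (A i) x) * \<Gamma> f f x) \<longlonglongrightarrow>
            (g x * 0) * (g x * 0) * \<Gamma> f f x"
          by (intro tendsto_mult tendsto_const lim)
        then show "(\<lambda>i. (g x * indicator (A i) x) * (g x * indicator (A i) x) * \<Gamma> f f x) \<longlonglongrightarrow> 0"
            by simp
      qed
    qed (auto simp: indicator_def)
    then have "(\<lambda>i. sqrt (inner (fmul (indicator (A i)) (tens f g)) (fmul (indicator (A i)) (tens f
        g)))) \<longlonglongrightarrow> sqrt 0"
      using inner_tens[OF fg(1) fg(1) gA gA] by (intro tendsto_real_sqrt) (simp add:
          form_mult_tens[OF AB fg])
    then show "tens f g \<in> S"
      unfolding S_def mem_Collect_eq norm_eq_sqrt_inner[symmetric]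
          by (simp add: tendsto_norm_zero_iff)
  qed
  then show ?thesis by (simp add: S_def)
qed

text \<open>The measure \<open>A \<mapsto> \<langle>\<xi> 1_A, \<xi>\<rangle>\<close> has a density, the squared fibre norm of \<open>\<xi>\<close>.\<close>

lemma fibre_density_diag:
  "\<exists>d. integrable M d \<and> (\<forall>x. 0 \<le> d x) \<and> (\<forall>A\<in>sets M. inner (fmul (indicator A) \<xi>) \<xi>
      = (\<integral>x\<in>A. d x \<partial>M))"
proof (rule set_function_density)
  fix A assume A: "A \<in> sets M"
  have "fmul (indicator A) \<xi> = fmul (indicator A) (fmul (indicator A) \<xi>)"
    using form_mult_mult[OF indicator_Bb[OF A] indicator_Bb[OF A]]
    by (simp flip: indicator_inter_arith)
  then have "inner (fmul (indicator A) \<xi>) \<xi> = inner (fmul (indicator A) \<xi>) (fmul (indicator A) \<xi>)"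
    using inner_form_mult[OF indicator_Bb[OF A]] by metis
  then show "0 \<le> inner (fmul (indicator A) \<xi>) \<xi>" by simp
next
  fix A B assume A: "A \<in> sets M" and B: "B \<in> sets M" and AB: "A \<inter> B = {}"
  have "indicator (A \<union> B) = (\<lambda>x. 1 * indicator A x + 1 * indicator B x :: real)"
    using AB by (auto simp: fun_eq_iff indicator_def)
  then have "fmul (indicator (A \<union> B)) \<xi> = fmul (indicator A) \<xi> + fmul (indicator B) \<xi>"
    using form_mult_lincomb[OF indicator_Bb[OF A] indicator_Bb[OF B], of 1 1] by simp
  then show "inner (fmul (indicator (A \<union> B)) \<xi>) \<xi> =
      inner (fmul (indicator A) \<xi>) \<xi> + inner (fmul (indicator B) \<xi>) \<xi>"
    by (simp add: inner_add_left)
next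
  fix A :: "nat \<Rightarrow> 'a set" assume "range A \<subseteq> sets M" "decseq A" "(\<Inter>i. A i) = {}"
  from tendsto_inner[OF form_mult_decseq[OF this] tendsto_const]
  show "(\<lambda>i. inner (fmul (indicator (A i)) \<xi>) \<xi>) \<longlonglongrightarrow> 0" by simp
next
  fix A assume "A \<in> null_sets M"
  then show "inner (fmul (indicator A) \<xi>) \<xi> = 0" by (simp add: form_mult_null)
qed

lemma fibre_density:
  "\<exists>b. integrable M b \<and> (\<forall>A\<in>sets M. inner (fmul (indicator A) \<xi>) \<eta> = (\<integral>x\<in>A. b x \<partial>M))"
proof -
  obtain p where p: "integrable M p"
    "\<And>A. A \<in> sets M \<Longrightarrow> inner (fmul (indicator A) (\<xi> + \<eta>)) (\<xi> + \<eta>) = (\<integral>x\<in>A. p x \<partial>M)"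
    using fibre_density_diag[of "\<xi> + \<eta>"] by blast
  obtain q where q: "integrable M q"
    "\<And>A. A \<in> sets M \<Longrightarrow> inner (fmul (indicator A) (\<xi> - \<eta>)) (\<xi> - \<eta>) = (\<integral>x\<in>A. q x \<partial>M)"
    using fibre_density_diag[of "\<xi> - \<eta>"] by blast
  have "inner (fmul (indicator A) \<xi>) \<eta> = (\<integral>x\<in>A. (p x - q x) / 4 \<partial>M)" if A: "A \<in> sets M" for A
  proof -
    have si: "set_integrable M A p" "set_integrable M A q"
      unfolding set_integrable_def by (intro integrable_mult_indicator A p q)+
    have "(\<integral>x\<in>A. (p x - q x) / 4 \<partial>M) = ((\<integral>x\<in>A. p x \<partial>M) - (\<integral>x\<in>A. q x \<partial>M)) / 4"
      using si by (simp add: set_integral_diff)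
    also have "\<dots> = (inner (fmul (indicator A) (\<xi> + \<eta>)) (\<xi> + \<eta>) - inner (fmul (indicator A) (\<xi>
        - \<eta>)) (\<xi> - \<eta>)) / 4"
      by (simp add: p(2) q(2) A)
    also have "\<dots> = inner (fmul (indicator A) \<xi>) \<eta>"
      using inner_form_mult[OF indicator_Bb[OF A], of \<eta> \<xi>]
      by (simp add: linear_add linear_diff bounded_linear.linear[OF bounded_linear_form_mult[OF
          indicator_Bb[OF A]]]
          inner_add_left inner_add_right inner_diff_left inner_diff_right inner_commute)
    finally show ?thesis by simp
  qed
  moreover have "integrable M (\<lambda>x. (p x - q x) / 4)" using p(1) q(1) by simp
  ultimately show ?thesis by (intro exI[of _ "\<lambda>x. (p x - q x) / 4"]) auto
qed

lemma fibre_inner_exists: "\<exists>\<beta>. is_fibre_inner M D \<Gamma> tens \<beta>"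
proof -
  obtain \<beta> where b: "\<And>\<xi> \<eta>. integrable M (\<beta> \<xi> \<eta>)"
    and s: "\<And>\<xi> \<eta> A. A \<in> sets M \<Longrightarrow> (\<integral>x\<in>A. \<beta> \<xi> \<eta> x \<partial>M) = inner (fmul (indicator A) \<xi>) \<eta>"
    using fibre_density by metis
  have si: "set_integrable M A (\<beta> \<xi> \<eta>)" if "A \<in> sets M" for A \<xi> \<eta>
    unfolding set_integrable_def by (intro integrable_mult_indicator that b)
  note lin = bounded_linear.linear[OF bounded_linear_form_mult[OF indicator_Bb]]
  have "AE x in M. \<beta> \<xi> \<eta> x = \<beta> \<eta> \<xi> x" for \<xi> \<eta>
    by (rule density_unique_real[OF b b]) (metis s inner_form_mult indicator_Bb inner_commute)
  moreover have "AE x in M. \<beta> (a *\<^sub>R \<xi> + c *\<^sub>R \<zeta>) \<eta> x = a * \<beta> \<xi> \<eta> x + c * \<beta> \<zeta> \<eta> x" for \<xi> \<zeta> \<eta> a c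
  proof (rule density_unique_real[OF b])
    show "integrable M (\<lambda>x. a * \<beta> \<xi> \<eta> x + c * \<beta> \<zeta> \<eta> x)" using b by simp
    fix A assume A: "A \<in> sets M"
    show "(\<integral>x\<in>A. \<beta> (a *\<^sub>R \<xi> + c *\<^sub>R \<zeta>) \<eta> x \<partial>M) = (\<integral>x\<in>A. a * \<beta> \<xi> \<eta> x + c * \<beta> \<zeta> \<eta> x \<partial>M)"
      using si[OF A] by (simp add: s[OF A] linear_add[OF lin[OF A]] linear_cmul[OF lin[OF A]]
          inner_add_left)
  qed
  moreover have "AE x in M. \<beta> \<xi> \<xi> x \<ge> 0" for \<xi>
  proof -
    obtain d where d: "integrable M d" "\<And>x. 0 \<le> d x"
      "\<And>A. A \<in> sets M \<Longrightarrow> inner (fmul (indicator A) \<xi>) \<xi> = (\<integral>x\<in>A. d x \<partial>M)"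
      using fibre_density_diag[of \<xi>] by blast
    have "AE x in M. \<beta> \<xi> \<xi> x = d x"
      by (rule density_unique_real[OF b d(1)]) (simp add: s d(3))
    then show ?thesis by eventually_elim (simp add: d(2))
  qed
  moreover have "inner \<xi> \<eta> = (\<integral>x. \<beta> \<xi> \<eta> x \<partial>M)" for \<xi> \<eta>
  proof -
    have "indicator (space M) = (\<lambda>x::'a. 1::real)" by (simp add: space_M)
    then show ?thesis
      using s[OF sets.top, of \<xi> \<eta>] by (simp add: form_mult_one set_lebesgue_integral_def)
  qed
  moreover have "AE x in M. \<beta> (tens f1 g1) (tens f2 g2) x = g1 x * g2 x * \<Gamma> f1 f2 x"
    if fg: "f1 \<in> CD" "f2 \<in> CD" "g1 \<in> Bb" "g2 \<in> Bb" for f1 f2 g1 g2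
  proof (rule density_unique_real[OF b integrable_BB_\<Gamma>[OF fg]])
    fix A assume A: "A \<in> sets M"
    have "(\<integral>x\<in>A. \<beta> (tens f1 g1) (tens f2 g2) x \<partial>M)
        = (\<integral>x. g1 x * indicator A x * g2 x * \<Gamma> f1 f2 x \<partial>M)"
      unfolding s[OF A] form_mult_tens[OF indicator_Bb[OF A] fg(1,3)]
      by (rule inner_tens[OF fg(1,2) Bb_mult[OF fg(3) indicator_Bb[OF A]] fg(4)])
    then show "(\<integral>x\<in>A. \<beta> (tens f1 g1) (tens f2 g2) x \<partial>M) = (\<integral>x\<in>A. g1 x * g2 x * \<Gamma> f1 f2 x \<partial>M)"
      by (simp add: set_lebesgue_integral_def ac_simps)
  qed
  ultimately have "is_fibre_inner M D \<Gamma> tens \<beta>" unfolding is_fibre_inner_def using b by blast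
  then show ?thesis by blast
qed

text \<open>From here on only the defining properties of the fibre inner product are used, so the choice of
  representatives in \<^const>\<open>fibre_inner\<close> does not matter.\<close>

abbreviation "\<beta> \<equiv> fibre_inner M D \<Gamma> tens"

lemma \<beta>_integrable: "integrable M (\<beta> \<xi> \<eta>)"
  and \<beta>_sym: "AE x in M. \<beta> \<xi> \<eta> x = \<beta> \<eta> \<xi> x"
  and \<beta>_lincomb: "AE x in M. \<beta> (a *\<^sub>R \<xi> + b *\<^sub>R \<zeta>) \<eta> x = a * \<beta> \<xi> \<eta> x + b * \<beta> \<zeta> \<eta> x"
  and \<beta>_nonneg: "AE x in M. \<beta> \<xi> \<xi> x \<ge> 0"
  and inner_\<beta>: "inner \<xi> \<eta> = (\<integral>x. \<beta> \<xi> \<eta> x \<partial>M)"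
  and \<beta>_tens: "f1 \<in> CD \<Longrightarrow> f2 \<in> CD \<Longrightarrow> g1 \<in> Bb \<Longrightarrow> g2 \<in> Bb \<Longrightarrow>
      AE x in M. \<beta> (tens f1 g1) (tens f2 g2) x = g1 x * g2 x * \<Gamma> f1 f2 x"
proof -
  have *: "is_fibre_inner M D \<Gamma> tens \<beta>"
    unfolding fibre_inner_def using fibre_inner_exists by (rule someI_ex)
  show "integrable M (\<beta> \<xi> \<eta>)" "AE x in M. \<beta> \<xi> \<eta> x = \<beta> \<eta> \<xi> x"
    "AE x in M. \<beta> (a *\<^sub>R \<xi> + b *\<^sub>R \<zeta>) \<eta> x = a * \<beta> \<xi> \<eta> x + b * \<beta> \<zeta> \<eta> x"
    "AE x in M. \<beta> \<xi> \<xi> x \<ge> 0" "inner \<xi> \<eta> = (\<integral>x. \<beta> \<xi> \<eta> x \<partial>M)"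
    using * unfolding is_fibre_inner_def by metis+
  show "f1 \<in> CD \<Longrightarrow> f2 \<in> CD \<Longrightarrow> g1 \<in> Bb \<Longrightarrow> g2 \<in> Bb \<Longrightarrow>
      AE x in M. \<beta> (tens f1 g1) (tens f2 g2) x = g1 x * g2 x * \<Gamma> f1 f2 x"
    using * unfolding is_fibre_inner_def by blast
qed

lemma \<beta>_quadratic:
  "AE x in M. \<beta> (a *\<^sub>R \<xi> + b *\<^sub>R \<eta>) (a *\<^sub>R \<xi> + b *\<^sub>R \<eta>) x =
     a\<^sup>2 * \<beta> \<xi> \<xi> x + 2 * a * b * \<beta> \<xi> \<eta> x + b\<^sup>2 * \<beta> \<eta> \<eta> x"
proof -
  let ?z = "a *\<^sub>R \<xi> + b *\<^sub>R \<eta>"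
  show ?thesis
    using \<beta>_lincomb[of a \<xi> b \<eta> ?z] \<beta>_sym[of \<xi> ?z] \<beta>_sym[of \<eta> ?z]
      \<beta>_lincomb[of a \<xi> b \<eta> \<xi>] \<beta>_lincomb[of a \<xi> b \<eta> \<eta>] \<beta>_sym[of \<eta> \<xi>]
    by eventually_elim (simp add: power2_eq_square algebra_simps)
qed

lemma \<beta>_diff: "AE x in M. \<beta> (\<xi> - \<zeta>) \<eta> x = \<beta> \<xi> \<eta> x - \<beta> \<zeta> \<eta> x"
  using \<beta>_lincomb[of 1 \<xi> "-1" \<zeta> \<eta>] by simp

lemma \<beta>_abs_le: "AE x in M. 2 * \<bar>\<beta> \<xi> \<eta> x\<bar> \<le> \<beta> \<xi> \<xi> x + \<beta> \<eta> \<eta> x"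
  using \<beta>_quadratic[of 1 \<xi> 1 \<eta>] \<beta>_quadratic[of 1 \<xi> "-1" \<eta>]
    \<beta>_nonneg[of "1 *\<^sub>R \<xi> + 1 *\<^sub>R \<eta>"] \<beta>_nonneg[of "1 *\<^sub>R \<xi> + (-1) *\<^sub>R \<eta>"]
  by eventually_elim auto

lemma integral_abs_\<beta>_le: "(\<integral>x. \<bar>\<beta> \<xi> \<eta> x\<bar> \<partial>M) \<le> norm \<xi> * norm \<eta>"
proof -
  have amgm: "2 * (\<integral>x. \<bar>\<beta> \<xi> \<eta> x\<bar> \<partial>M) \<le> (norm \<xi>)\<^sup>2 + (norm \<eta>)\<^sup>2" for \<xi> \<eta>
  proof -
    have "(\<integral>x. 2 * \<bar>\<beta> \<xi> \<eta> x\<bar> \<partial>M) \<le> (\<integral>x. \<beta> \<xi> \<xi> x + \<beta> \<eta> \<eta> x \<partial>M)"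
      by (rule integral_mono_AE) (use \<beta>_integrable \<beta>_abs_le in auto)
    then show ?thesis
      by (simp add: \<beta>_integrable power2_norm_eq_inner inner_\<beta>)
  qed
  have scale: "(\<integral>x. \<bar>\<beta> (a *\<^sub>R \<xi>) (b *\<^sub>R \<eta>) x\<bar> \<partial>M) = \<bar>a * b\<bar> * (\<integral>x. \<bar>\<beta> \<xi> \<eta> x\<bar> \<partial>M)" for a b \<xi> \<eta>
  proof -
    have "AE x in M. \<bar>\<beta> (a *\<^sub>R \<xi>) (b *\<^sub>R \<eta>) x\<bar> = \<bar>a * b\<bar> * \<bar>\<beta> \<xi> \<eta> x\<bar>"
      using \<beta>_lincomb[of a \<xi> 0 \<xi> "b *\<^sub>R \<eta>"] \<beta>_sym[of \<xi> "b *\<^sub>R \<eta>"] \<beta>_lincomb[of b \<eta> 0 \<eta> \<xi>] \<beta>_sym[of \<eta>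
          \<xi>]
      by eventually_elim (simp add: abs_mult)
    then have "(\<integral>x. \<bar>\<beta> (a *\<^sub>R \<xi>) (b *\<^sub>R \<eta>) x\<bar> \<partial>M) = (\<integral>x. \<bar>a * b\<bar> * \<bar>\<beta> \<xi> \<eta> x\<bar> \<partial>M)"
      by (intro integral_cong_AE) (use \<beta>_integrable in \<open>auto intro: borel_measurable_integrable\<close>)
    then show ?thesis by simp
  qed
  show ?thesis
  proof (cases "\<xi> = 0 \<or> \<eta> = 0")
    case True
    then show ?thesis using scale[of 0 0 0 \<eta>] scale[of 1 \<xi> 0 0] scale[of 0 0 1 \<eta>] by auto
  next
    case False
    define I where "I = (\<integral>x. \<bar>\<beta> \<xi> \<eta> x\<bar> \<partial>M)"
    have "2 * (\<bar>inverse (norm \<xi>) * inverse (norm \<eta>)\<bar> * I) \<le> 1 + 1"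
      using amgm[of "inverse (norm \<xi>) *\<^sub>R \<xi>" "inverse (norm \<eta>) *\<^sub>R \<eta>"] False
      unfolding scale I_def by simp
    then have "I \<le> norm \<xi> * norm \<eta>" using False by (simp add: abs_mult field_simps)
    then show ?thesis by (simp add: I_def)
  qed
qed

text \<open>The map \<open>\<xi> \<mapsto> \<beta> \<xi> \<eta>\<close> is continuous into $L^1$, hence almost everywhere along a subsequence. Two
  second arguments are allowed so that one subsequence serves both factors of a minor.\<close>

lemma \<beta>_tendsto_subseq:
  assumes "u \<longlonglongrightarrow> \<xi>"
  shows "\<exists>r. strict_mono r \<and> (AE x in M. (\<lambda>n. \<beta> (u (r n)) \<eta> x) \<longlonglongrightarrow> \<beta> \<xi> \<eta> x \<and> (\<lambda>n. \<beta> (u (r n)) \<zeta> x)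
      \<longlonglongrightarrow> \<beta> \<xi> \<zeta> x)"
proof -
  have l: "(\<lambda>n. norm (u n - \<xi>) * (norm \<eta> + norm \<zeta>)) \<longlonglongrightarrow> 0"
    using tendsto_mult[OF tendsto_norm[OF tendsto_diff[OF assms tendsto_const[of \<xi>]]]
        tendsto_const[of "norm \<eta> + norm \<zeta>"]]
    by simp
  have "(\<lambda>n. \<integral>x. norm (\<bar>\<beta> (u n - \<xi>) \<eta> x\<bar> + \<bar>\<beta> (u n - \<xi>) \<zeta> x\<bar>) \<partial>M) \<longlonglongrightarrow> 0"
  proof (rule tendsto_sandwich[OF _ _ tendsto_const l])
    show "\<forall>\<^sub>F n in sequentially. 0 \<le> (\<integral>x. norm (\<bar>\<beta> (u n - \<xi>) \<eta> x\<bar> + \<bar>\<beta> (u n - \<xi>) \<zeta> x\<bar>) \<partial>M)" by simp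
    have "(\<integral>x. norm (\<bar>\<beta> (u n - \<xi>) \<eta> x\<bar> + \<bar>\<beta> (u n - \<xi>) \<zeta> x\<bar>) \<partial>M) \<le> norm (u n - \<xi>) * (norm \<eta>
        + norm \<zeta>)" for n
      using integral_abs_\<beta>_le[of "u n - \<xi>" \<eta>] integral_abs_\<beta>_le[of "u n - \<xi>" \<zeta>] \<beta>_integrable
      by (simp add: algebra_simps)
    then show "\<forall>\<^sub>F n in sequentially. (\<integral>x. norm (\<bar>\<beta> (u n - \<xi>) \<eta> x\<bar> + \<bar>\<beta> (u n - \<xi>) \<zeta> x\<bar>) \<partial>M)
        \<le> norm (u n - \<xi>) * (norm \<eta> + norm \<zeta>)" by simp
  qed
  from tendsto_L1_AE_subseq[OF _ this] obtain r where r: "strict_mono r"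
    "AE x in M. (\<lambda>n. \<bar>\<beta> (u (r n) - \<xi>) \<eta> x\<bar> + \<bar>\<beta> (u (r n) - \<xi>) \<zeta> x\<bar>) \<longlonglongrightarrow> 0"
    using \<beta>_integrable by auto
  have "AE x in M. \<forall>n. \<beta> (u n - \<xi>) \<eta> x = \<beta> (u n) \<eta> x - \<beta> \<xi> \<eta> x"
    "AE x in M. \<forall>n. \<beta> (u n - \<xi>) \<zeta> x = \<beta> (u n) \<zeta> x - \<beta> \<xi> \<zeta> x"
    unfolding AE_all_countable using \<beta>_diff by blast+
  then have "AE x in M. (\<lambda>n. \<beta> (u (r n)) \<eta> x) \<longlonglongrightarrow> \<beta> \<xi> \<eta> x \<and> (\<lambda>n. \<beta> (u (r n)) \<zeta> x) \<longlonglongrightarrow> \<beta> \<xi> \<zeta> x"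
    using r(2)
  proof eventually_elim
    case (elim x)
    have "(\<lambda>n. \<beta> (u (r n)) \<eta> x - \<beta> \<xi> \<eta> x) \<longlonglongrightarrow> 0"
      by (rule tendsto_rabs_zero_cancel, rule tendsto_sandwich[OF _ _ tendsto_const elim(3)]) (use
          elim in auto)
    moreover have "(\<lambda>n. \<beta> (u (r n)) \<zeta> x - \<beta> \<xi> \<zeta> x) \<longlonglongrightarrow> 0"
      by (rule tendsto_rabs_zero_cancel, rule tendsto_sandwich[OF _ _ tendsto_const elim(3)]) (use
          elim in auto)
    ultimately show ?case by (simp add: LIM_zero_iff)
  qed
  then show ?thesis using r(1) by blast
qed

lemma inner_form_mult_\<beta>:
  assumes a: "a \<in> Bb"
  shows "inner (fmul a \<xi>) \<eta> = (\<integral>x. a x * \<beta> \<xi> \<eta> x \<partial>M)"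
proof -
  obtain C where C: "\<And>x. \<bar>a x\<bar> \<le> C" using a by (auto simp: Bb_iff)
  have ai: "integrable M (\<lambda>x. a x * \<beta> \<xi> \<eta> x)" for \<xi> \<eta>
    by (rule integrable_Bb_mult[OF a \<beta>_integrable])
  have bl: "bounded_linear (\<lambda>\<xi>. \<integral>x. a x * \<beta> \<xi> \<eta> x \<partial>M)" for \<eta>
  proof (rule bounded_linear_intro[where K="C * norm \<eta>"])
    have lc: "(\<integral>x. a x * \<beta> (c *\<^sub>R \<xi> + d *\<^sub>R \<zeta>) \<eta> x \<partial>M) =
        c * (\<integral>x. a x * \<beta> \<xi> \<eta> x \<partial>M) + d * (\<integral>x. a x * \<beta> \<zeta> \<eta> x \<partial>M)" for c d \<xi> \<zeta>
    proof -
      have "AE x in M. a x * \<beta> (c *\<^sub>R \<xi> + d *\<^sub>R \<zeta>) \<eta> x = c * (a x * \<beta> \<xi> \<eta> x) + d * (a x * \<beta> \<zeta> \<eta> x)"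
        using \<beta>_lincomb[of c \<xi> d \<zeta> \<eta>] by eventually_elim (simp add: algebra_simps)
      then have "(\<integral>x. a x * \<beta> (c *\<^sub>R \<xi> + d *\<^sub>R \<zeta>) \<eta> x \<partial>M) =
          (\<integral>x. c * (a x * \<beta> \<xi> \<eta> x) + d * (a x * \<beta> \<zeta> \<eta> x) \<partial>M)"
        using ai by (intro integral_cong_AE) (auto intro: borel_measurable_integrable)
      then show ?thesis using ai by simp
    qed
    show "(\<integral>x. a x * \<beta> (\<xi> + \<zeta>) \<eta> x \<partial>M) = (\<integral>x. a x * \<beta> \<xi> \<eta> x \<partial>M) + (\<integral>x. a x * \<beta> \<zeta> \<eta> x \<partial>M)" for \<xi> \<zeta>
      using lc[of 1 \<xi> 1 \<zeta>] by simp
    show "(\<integral>x. a x * \<beta> (r *\<^sub>R \<xi>) \<eta> x \<partial>M) = r *\<^sub>R (\<integral>x. a x * \<beta> \<xi> \<eta> x \<partial>M)" for r \<xi>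
      using lc[of r \<xi> 0 \<xi>] by simp
    show "norm (\<integral>x. a x * \<beta> \<xi> \<eta> x \<partial>M) \<le> norm \<xi> * (C * norm \<eta>)" for \<xi>
    proof -
      have "norm (\<integral>x. a x * \<beta> \<xi> \<eta> x \<partial>M) \<le> (\<integral>x. norm (a x * \<beta> \<xi> \<eta> x) \<partial>M)"
        by (rule integral_norm_bound)
      also have "\<dots> \<le> (\<integral>x. C * \<bar>\<beta> \<xi> \<eta> x\<bar> \<partial>M)"
        by (rule integral_mono[OF integrable_norm[OF ai]])
          (use \<beta>_integrable C in \<open>auto simp: abs_mult intro: mult_right_mono\<close>)
      also have "\<dots> \<le> C * (norm \<xi> * norm \<eta>)"
        using integral_abs_\<beta>_le[of \<xi> \<eta>] C[of undefined] by (simp add: mult_left_mono)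
      finally show ?thesis by (simp add: ac_simps)
    qed
  qed
  have sym: "(\<integral>x. a x * \<beta> \<xi> \<eta> x \<partial>M) = (\<integral>x. a x * \<beta> \<eta> \<xi> x \<partial>M)" for \<xi> \<eta>
    by (intro integral_cong_AE) (use ai \<beta>_sym[of \<xi> \<eta>] in \<open>auto intro: borel_measurable_integrable\<close>)
  note ba = bounded_linear_form_mult[OF a]
  have 1: "inner (fmul a (tens f g)) (tens h k) = (\<integral>x. a x * \<beta> (tens f g) (tens h k) x \<partial>M)"
    if t: "f \<in> CD" "h \<in> CD" "g \<in> Bb" "k \<in> Bb" for f h g k
  proof -
    have "inner (fmul a (tens f g)) (tens h k) = (\<integral>x. g x * a x * k x * \<Gamma> f h x \<partial>M)"
      using form_mult_tens[OF a t(1,3)] inner_tens[OF t(1,2) Bb_mult[OF t(3) a] t(4)] by simp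
    also have "\<dots> = (\<integral>x. a x * \<beta> (tens f g) (tens h k) x \<partial>M)"
      by (rule integral_cong_AE, intro borel_measurable_integrable integrable_BB_\<Gamma> Bb_mult a t,
          rule borel_measurable_integrable[OF ai]) (use \<beta>_tens[OF t] in \<open>auto simp: ac_simps\<close>)
    finally show ?thesis .
  qed
  have 2: "inner (fmul a \<xi>) (tens h k) = (\<integral>x. a x * \<beta> \<xi> (tens h k) x \<partial>M)"
    if "h \<in> CD" "k \<in> Bb" for \<xi> h k
    by (rule bounded_linear_eq_on_tens[OF bounded_linear_inner_left_comp[OF ba] bl]) (use 1 that in
        blast)
  show ?thesis
    unfolding sym[of \<xi>]
    by (rule bounded_linear_eq_on_tens[OF bounded_linear_inner_right bl]) (use 2 sym in metis)
qed

lemma \<beta>_form_mult: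
  assumes a: "a \<in> Bb"
  shows "AE x in M. \<beta> (fmul a \<xi>) \<eta> x = a x * \<beta> \<xi> \<eta> x"
proof (rule density_unique_real[OF \<beta>_integrable integrable_Bb_mult[OF a \<beta>_integrable]])
  fix A assume A: "A \<in> sets M"
  note iA = indicator_Bb[OF A]
  have "(\<integral>x\<in>A. \<beta> (fmul a \<xi>) \<eta> x \<partial>M) = inner (fmul (indicator A) (fmul a \<xi>)) \<eta>"
    by (simp add: inner_form_mult_\<beta>[OF iA] set_lebesgue_integral_def)
  also have "\<dots> = (\<integral>x\<in>A. a x * \<beta> \<xi> \<eta> x \<partial>M)"
    by (simp add: form_mult_mult[OF iA a] inner_form_mult_\<beta>[OF Bb_mult[OF a iA]]
        set_lebesgue_integral_def ac_simps)
  finally show "(\<integral>x\<in>A. \<beta> (fmul a \<xi>) \<eta> x \<partial>M) = (\<integral>x\<in>A. a x * \<beta> \<xi> \<eta> x \<partial>M)" .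
qed

end

section \<open>The Hodge star\<close>

text \<open>Hino index one together with a harmonic form of fibre norm one.\<close>

locale harmonic_frame = local_dirichlet_forms M D E \<Gamma> tens
  for M :: "'a::metric_space measure"
    and D :: "('a \<Rightarrow> real) set"
    and E :: "('a \<Rightarrow> real) \<Rightarrow> ('a \<Rightarrow> real) \<Rightarrow> real"
    and \<Gamma> :: "('a \<Rightarrow> real) \<Rightarrow> ('a \<Rightarrow> real) \<Rightarrow> 'a \<Rightarrow> real"
    and tens :: "('a \<Rightarrow> real) \<Rightarrow> ('a \<Rightarrow> real) \<Rightarrow> 'h::{real_inner,complete_space}" +
  fixes \<omega> :: 'h
  assumes hino: "has_hino_index M D \<Gamma> 1"
    and harmonic: "harmonic_form M D tens \<omega>"
    and form_measure: "is_form_measure D tens \<omega> M"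
begin

text \<open>A Gram matrix of four functions has rank at most one; the minor with rows \<open>f1\<close>, \<open>f2\<close> and columns
  \<open>f3\<close>, \<open>f4\<close> vanishes. Four independent entries make the identity linear in each of them.\<close>

lemma \<Gamma>_minor:
  assumes f: "f1 \<in> D" "f2 \<in> D" "f3 \<in> D" "f4 \<in> D"
  shows "AE x in M. \<Gamma> f1 f3 x * \<Gamma> f2 f4 x = \<Gamma> f1 f4 x * \<Gamma> f2 f3 x"
proof -
  obtain p where p: "pointwise_hino_index M D \<Gamma> p"
    and ess: "esssup M (\<lambda>x. ereal_of_enat (p x)) = ereal_of_enat 1"
    using hino unfolding has_hino_index_def by blast
  have hb: "hino_bound M D \<Gamma> p" using p by (simp add: pointwise_hino_index_def)
  from esssup_AE[of "\<lambda>x. ereal_of_enat (p x)" M] have p1: "AE x in M. p x \<le> 1"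
    unfolding ess by eventually_elim simp
  define F where "F i = [f1, f2, f3, f4] ! i" for i
  have F: "F i \<in> D" if "i < 4" for i
    using f that unfolding F_def by (auto simp: less_Suc_eq numeral_eq_Suc)
  have "AE x in M. enat (vec_space.rank 4 (Matrix.mat 4 4 (\<lambda>(i, j). \<Gamma> (F i) (F j) x))) \<le> p x"
    using hb F unfolding hino_bound_def by blast
  then show ?thesis using p1
  proof eventually_elim
    case (elim x)
    let ?A = "Matrix.mat 4 4 (\<lambda>(i, j). \<Gamma> (F i) (F j) x)"
    have "enat (vec_space.rank 4 ?A) \<le> enat 1"
      using order_trans[OF elim(1,2)] by (simp only: one_enat_def)
    then have "vec_space.rank 4 ?A \<le> 1" by simp
    from rank_le_1_minor[OF _ this] show ?case by (simp add: F_def)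
  qed
qed

lemma \<beta>_minor:
  "AE x in M. \<beta> \<xi>1 \<xi>3 x * \<beta> \<xi>2 \<xi>4 x = \<beta> \<xi>1 \<xi>4 x * \<beta> \<xi>2 \<xi>3 x"
proof -
  define P where "P \<xi>1 \<xi>2 \<xi>3 \<xi>4 \<longleftrightarrow>
    (AE x in M. \<beta> \<xi>1 \<xi>3 x * \<beta> \<xi>2 \<xi>4 x = \<beta> \<xi>1 \<xi>4 x * \<beta> \<xi>2 \<xi>3 x)" for \<xi>1 \<xi>2 \<xi>3 \<xi>4
  have swap: "P \<xi>2 \<xi>1 \<xi>4 \<xi>3" if "P \<xi>1 \<xi>2 \<xi>3 \<xi>4" for \<xi>1 \<xi>2 \<xi>3 \<xi>4
    using that unfolding P_def by eventually_elim (simp add: mult.commute)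
  have transp: "P \<xi>3 \<xi>4 \<xi>1 \<xi>2" if "P \<xi>1 \<xi>2 \<xi>3 \<xi>4" for \<xi>1 \<xi>2 \<xi>3 \<xi>4
    using that \<beta>_sym[of \<xi>1 \<xi>3] \<beta>_sym[of \<xi>2 \<xi>4] \<beta>_sym[of \<xi>1 \<xi>4] \<beta>_sym[of \<xi>2 \<xi>3]
    unfolding P_def by eventually_elim (simp add: mult.commute)
  \<comment> \<open>The identity is linear in each argument and stable under limits almost everywhere along
    subsequences, so each argument in turn may be freed from being an elementary tensor.\<close>
  have ext: "P \<xi>1 \<xi>2 \<xi>3 \<xi>4"
    if t: "\<And>f g. f \<in> CD \<Longrightarrow> g \<in> Bb \<Longrightarrow> P (tens f g) \<xi>2 \<xi>3 \<xi>4" for \<xi>1 \<xi>2 \<xi>3 \<xi>4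
  proof -
    have lin: "P (a *\<^sub>R \<xi> + b *\<^sub>R \<zeta>) \<xi>2 \<xi>3 \<xi>4" if "P \<xi> \<xi>2 \<xi>3 \<xi>4" "P \<zeta> \<xi>2 \<xi>3 \<xi>4" for a b \<xi> \<zeta>
      using that \<beta>_lincomb[of a \<xi> b \<zeta> \<xi>3] \<beta>_lincomb[of a \<xi> b \<zeta> \<xi>4] unfolding P_def
      by eventually_elim (simp add: algebra_simps)
    have "\<xi>1 \<in> {\<xi>1. P \<xi>1 \<xi>2 \<xi>3 \<xi>4}"
    proof (rule forms_induct)
      show "closed {\<xi>1. P \<xi>1 \<xi>2 \<xi>3 \<xi>4}"
        unfolding closed_sequential_limits
      proof (intro allI impI, elim conjE)
        fix u l assume u: "\<forall>n. u n \<in> {\<xi>1. P \<xi>1 \<xi>2 \<xi>3 \<xi>4}" "u \<longlonglongrightarrow> l"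
        obtain r where r: "AE x in M. (\<lambda>n. \<beta> (u (r n)) \<xi>3 x) \<longlonglongrightarrow> \<beta> l \<xi>3 x \<and> (\<lambda>n. \<beta> (u (r n)) \<xi>4 x)
            \<longlonglongrightarrow> \<beta> l \<xi>4 x"
          using \<beta>_tendsto_subseq[OF u(2), of \<xi>3 \<xi>4] by blast
        have "AE x in M. \<forall>n. \<beta> (u (r n)) \<xi>3 x * \<beta> \<xi>2 \<xi>4 x = \<beta> (u (r n)) \<xi>4 x * \<beta> \<xi>2 \<xi>3 x"
          unfolding AE_all_countable using u(1) by (simp add: P_def)
        then have "P l \<xi>2 \<xi>3 \<xi>4" using r unfolding P_def
        proof eventually_elim
          case (elim x)
          then have "(\<lambda>n. \<beta> (u (r n)) \<xi>4 x * \<beta> \<xi>2 \<xi>3 x) \<longlonglongrightarrow> \<beta> l \<xi>3 x * \<beta> \<xi>2 \<xi>4 x"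
            using tendsto_mult_right[of "\<lambda>n. \<beta> (u (r n)) \<xi>3 x" "\<beta> l \<xi>3 x" sequentially "\<beta> \<xi>2 \<xi>4 x"]
                by simp
          moreover have "(\<lambda>n. \<beta> (u (r n)) \<xi>4 x * \<beta> \<xi>2 \<xi>3 x) \<longlonglongrightarrow> \<beta> l \<xi>4 x * \<beta> \<xi>2 \<xi>3 x"
            using elim by (intro tendsto_intros) auto
          ultimately show ?case by (rule LIMSEQ_unique)
        qed
        then show "l \<in> {\<xi>1. P \<xi>1 \<xi>2 \<xi>3 \<xi>4}" by simp
      qed
      have 0: "\<exists>f::'a \<Rightarrow> real. f \<in> CD" "(\<lambda>x. 1) \<in> Bb"
        using D_zero by (auto simp: Cb_iff Bb_const intro!: exI[of _ "\<lambda>x. 0"])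
      then obtain f0 :: "'a \<Rightarrow> real" where f0: "f0 \<in> CD" by blast
      show "Real_Vector_Spaces.subspace {\<xi>1. P \<xi>1 \<xi>2 \<xi>3 \<xi>4}"
      proof (unfold real_vector.subspace_def, intro conjI ballI allI)
        show "0 \<in> {\<xi>1. P \<xi>1 \<xi>2 \<xi>3 \<xi>4}"
          using lin[OF t[OF f0 0(2)] t[OF f0 0(2)], of 0 0] by simp
        show "x + y \<in> {\<xi>1. P \<xi>1 \<xi>2 \<xi>3 \<xi>4}" if "x \<in> {\<xi>1. P \<xi>1 \<xi>2 \<xi>3 \<xi>4}" "y \<in> {\<xi>1. P \<xi>1 \<xi>2 \<xi>3 \<xi>4}"
            for x y
          using lin[of x y 1 1] that by simp
        show "c *\<^sub>R x \<in> {\<xi>1. P \<xi>1 \<xi>2 \<xi>3 \<xi>4}" if "x \<in> {\<xi>1. P \<xi>1 \<xi>2 \<xi>3 \<xi>4}" for c x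
          using lin[of x x c 0] that by simp
      qed
    qed (use t in auto)
    then show ?thesis by simp
  qed
  have 0: "P (tens f1 g1) (tens f2 g2) (tens f3 g3) (tens f4 g4)"
    if "f1 \<in> CD" "f2 \<in> CD" "f3 \<in> CD" "f4 \<in> CD" "g1 \<in> Bb" "g2 \<in> Bb" "g3 \<in> Bb" "g4 \<in> Bb"
    for f1 f2 f3 f4 g1 g2 g3 g4
  proof -
    have "f1 \<in> D" "f2 \<in> D" "f3 \<in> D" "f4 \<in> D" using that by auto
    note \<Gamma>_minor[OF this]
    then show ?thesis
      unfolding P_def
      using \<beta>_tens[OF that(1,3,5,7)] \<beta>_tens[OF that(2,4,6,8)] \<beta>_tens[OF that(1,4,5,8)] \<beta>_tens[OF
          that(2,3,6,7)]
    proof eventually_elim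
      case (elim x)
      have alg: "(a * c * p) * (b * d * q) = (a * b * c * d) * (p * q)" for a b c d p q :: real
        by simp
      have alg': "(a * d * p) * (b * c * q) = (a * b * c * d) * (p * q)" for a b c d p q :: real
        by simp
      show ?case
        unfolding elim(2-5) by (rule trans[OF alg], subst elim(1), rule alg'[symmetric])
    qed
  qed
  have 1: "P \<xi>1 (tens f2 g2) (tens f3 g3) (tens f4 g4)"
    if "f2 \<in> CD" "f3 \<in> CD" "f4 \<in> CD" "g2 \<in> Bb" "g3 \<in> Bb" "g4 \<in> Bb" for \<xi>1 f2 f3 f4 g2 g3 g4
    by (rule ext, rule 0) (use that in auto)
  have 2: "P \<xi>1 \<xi>2 (tens f3 g3) (tens f4 g4)"
    if "f3 \<in> CD" "f4 \<in> CD" "g3 \<in> Bb" "g4 \<in> Bb" for \<xi>1 \<xi>2 f3 f4 g3 g4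
    by (rule swap, rule ext, rule swap, rule 1) (use that in auto)
  have 3: "P \<xi>1 \<xi>2 \<xi>3 (tens f4 g4)" if "f4 \<in> CD" "g4 \<in> Bb" for \<xi>1 \<xi>2 \<xi>3 f4 g4
    by (rule transp, rule ext, rule transp, rule 2) (use that in auto)
  have "P \<xi>1 \<xi>2 \<xi>3 \<xi>4"
    by (rule transp, rule swap, rule ext, rule swap, rule transp, rule 3)
  then show ?thesis by (simp add: P_def)
qed

lemma \<beta>_\<omega>_\<omega>: "AE x in M. \<beta> \<omega> \<omega> x = 1"
proof (rule density_eq_1_if_Cb[OF finite_M sets_M \<beta>_integrable])
  fix \<phi> :: "'a \<Rightarrow> real" assume \<phi>: "\<phi> \<in> Cb"
  have "(\<integral>x. \<phi> x \<partial>M) = inner (fmul \<phi> \<omega>) \<omega>"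
    using form_measure \<phi> unfolding is_form_measure_def by blast
  then show "(\<integral>x. \<phi> x \<partial>M) = (\<integral>x. \<phi> x * \<beta> \<omega> \<omega> x \<partial>M)"
    using inner_form_mult_\<beta>[OF Cb_subset_Bb[OF \<phi>]] by simp
qed

lemma \<beta>_factor: "AE x in M. \<beta> \<eta> \<zeta> x = \<beta> \<eta> \<omega> x * \<beta> \<omega> \<zeta> x"
  using \<beta>_minor[of \<eta> \<zeta> \<omega> \<omega>] \<beta>_\<omega>_\<omega> by eventually_elim simp

lemma coefficient_L2: "\<beta> \<eta> \<omega> \<in> L2 M"
proof -
  have "AE x in M. (\<beta> \<eta> \<omega> x)\<^sup>2 = \<beta> \<eta> \<eta> x"
    using \<beta>_factor[of \<eta> \<eta>] \<beta>_sym[of \<eta> \<omega>] by eventually_elim (simp add: power2_eq_square)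
  moreover have m: "\<beta> \<eta> \<omega> \<in> borel_measurable M" using \<beta>_integrable
      by (rule borel_measurable_integrable)
  ultimately have "integrable M (\<lambda>x. (\<beta> \<eta> \<omega> x)\<^sup>2)"
    using \<beta>_integrable[of \<eta> \<eta>] by (subst integrable_cong_AE) auto
  then show ?thesis using m by (simp add: L2_def)
qed

lemma norm_form_mult_\<omega>: "a \<in> Bb \<Longrightarrow> (norm (fmul a \<omega>))\<^sup>2 = (\<integral>x. (a x)\<^sup>2 \<partial>M)"
proof -
  assume a: "a \<in> Bb"
  have "(norm (fmul a \<omega>))\<^sup>2 = inner (fmul (\<lambda>x. a x * a x) \<omega>) \<omega>"
    using inner_form_mult[OF a, of "fmul a \<omega>" \<omega>] form_mult_mult[OF a a, of \<omega>]
    by (simp add: power2_norm_eq_inner)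
  also have "\<dots> = (\<integral>x. (a x * a x) * \<beta> \<omega> \<omega> x \<partial>M)" by (rule inner_form_mult_\<beta>[OF Bb_mult[OF a a]])
  also have "\<dots> = (\<integral>x. (a x)\<^sup>2 \<partial>M)"
    using \<beta>_\<omega>_\<omega> Bb_measurable[OF a] \<beta>_integrable[THEN borel_measurable_integrable]
    by (intro integral_cong_AE) (auto simp: power2_eq_square)
  finally show ?thesis .
qed

abbreviation "star \<equiv> hodge_star M D \<Gamma> tens \<omega>"

text \<open>A form \<open>\<zeta>\<close> with the defining property of \<open>\<star>f\<close> is unique, since its inner products with all forms
  are determined.\<close>

lemma star_eqI:
  assumes "\<And>\<eta>. AE x in M. \<beta> \<zeta> \<eta> x = f x * \<beta> \<omega> \<eta> x"
  shows "star f = \<zeta>"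
  unfolding hodge_star_def
proof (rule the_equality)
  show "\<forall>\<eta>. AE x in M. \<beta> \<zeta> \<eta> x = f x * \<beta> \<omega> \<eta> x" using assms by blast
  fix \<zeta>' assume z: "\<forall>\<eta>. AE x in M. \<beta> \<zeta>' \<eta> x = f x * \<beta> \<omega> \<eta> x"
  have "inner \<zeta>' \<eta> = inner \<zeta> \<eta>" for \<eta>
  proof -
    have "AE x in M. \<beta> \<zeta>' \<eta> x = \<beta> \<zeta> \<eta> x" using spec[OF z, of \<eta>] assms[of \<eta>] by eventually_elim simp
    then show ?thesis
      unfolding inner_\<beta> by (intro integral_cong_AE) (auto intro: borel_measurable_integrable
          \<beta>_integrable)
  qed
  then show "\<zeta>' = \<zeta>" by (metis inner_eq_zero_iff inner_diff_left right_minus_eq)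
qed

lemma tendsto_form_mult_\<omega>:
  assumes f: "f \<in> L2 M" and a: "\<And>n. a n \<in> Bb" "(\<lambda>n. \<integral>x. (a n x - f x)\<^sup>2 \<partial>M) \<longlonglongrightarrow> 0"
  shows "\<exists>\<zeta>. (\<lambda>n. fmul (a n) \<omega>) \<longlonglongrightarrow> \<zeta>"
proof -
  have aL: "a n \<in> L2 M" for n
    using integrable_Bb_mult[OF Bb_mult[OF a(1) a(1)], of "\<lambda>x. 1"] Bb_measurable[OF a(1)]
    by (simp add: L2_def power2_eq_square)
  have "Cauchy (\<lambda>n. fmul (a n) \<omega>)"
  proof (rule metric_CauchyI)
    fix e :: real assume e: "e > 0"
    then obtain K where K: "\<And>n. n \<ge> K \<Longrightarrow> (\<integral>x. (a n x - f x)\<^sup>2 \<partial>M) < e\<^sup>2 / 4"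
      using order_tendstoD(2)[OF a(2), of "e\<^sup>2 / 4"] by (auto simp: eventually_sequentially)
    have "dist (fmul (a m) \<omega>) (fmul (a n) \<omega>) < e" if mn: "m \<ge> K" "n \<ge> K" for m n
    proof -
      have "fmul (a m) \<omega> - fmul (a n) \<omega> = fmul (\<lambda>x. 1 * a m x + (-1) * a n x) \<omega>"
        by (subst form_mult_lincomb[OF a(1) a(1)]) simp
      then have "(dist (fmul (a m) \<omega>) (fmul (a n) \<omega>))\<^sup>2 = (\<integral>x. (1 * a m x + (-1) * a n x)\<^sup>2 \<partial>M)"
        unfolding dist_norm using norm_form_mult_\<omega>[OF Bb_lincomb[OF a(1) a(1)]] by metis
      also have "\<dots> = (\<integral>x. ((a m x - f x) + (-1) * (a n x - f x))\<^sup>2 \<partial>M)" by (simp add: algebra_simps)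
      also have "\<dots> \<le> 2 * (\<integral>x. (a m x - f x)\<^sup>2 \<partial>M) + 2 * (\<integral>x. ((-1) * (a n x - f x))\<^sup>2 \<partial>M)"
        using L2_diff[OF aL f] L2_lincomb[OF L2_diff[OF aL f] L2_diff[OF aL f], of "-1" n 0 n]
        by (intro integral_square_add_le) auto
      also have "\<dots> < e\<^sup>2" using K[OF mn(1)] K[OF mn(2)] by (simp add: power2_commute)
      finally show ?thesis using e by (simp add: power_less_imp_less_base)
    qed
    then show "\<exists>K. \<forall>m\<ge>K. \<forall>n\<ge>K. dist (fmul (a m) \<omega>) (fmul (a n) \<omega>) < e" by blast
  qed
  then show ?thesis using Cauchy_convergent_iff convergent_def by blast
qed

text \<open>Existence of \<open>\<star>f\<close> for every square integrable \<open>f\<close>, as the limit of \<open>\<omega>\<close> multiplied by the truncations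
  of \<open>f\<close>.\<close>

lemma star_\<beta>:
  assumes f: "f \<in> L2 M"
  shows "AE x in M. \<beta> (star f) \<eta> x = f x * \<beta> \<omega> \<eta> x"
proof -
  define a where "a n x = max (- real n) (min (real n) (f x))" for n x
  have fm[measurable]: "f \<in> borel_measurable borel"
    using f by (simp add: L2_def measurable_cong_sets[OF sets_M refl])
  have aB: "a n \<in> Bb" for n
  proof -
    have "a n \<in> borel_measurable borel" unfolding a_def by measurable
    moreover have "\<bar>a n x\<bar> \<le> real n" for x unfolding a_def by auto
    ultimately show ?thesis by (auto simp: Bb_iff)
  qed
  have a_lim: "eventually (\<lambda>n. a n x = f x) sequentially" for x
  proof -
    obtain K :: nat where K: "\<bar>f x\<bar> \<le> real K" using real_arch_simple by blast
    have "a n x = f x" if "n \<ge> K" for n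
    proof -
      have "real K \<le> real n" using that by simp
      then show ?thesis using K unfolding a_def by auto
    qed
    then show ?thesis by (auto simp: eventually_sequentially)
  qed
  have "(\<lambda>n. \<integral>x. (a n x - f x)\<^sup>2 \<partial>M) \<longlonglongrightarrow> (\<integral>x. 0 \<partial>M)"
  proof (rule integral_dominated_convergence[where w="\<lambda>x. (f x)\<^sup>2"])
    show "integrable M (\<lambda>x. (f x)\<^sup>2)" using f by (rule L2_integrable_square)
    show "(\<lambda>x. (a n x - f x)\<^sup>2) \<in> borel_measurable M" for n
      using Bb_measurable[OF aB, of n] L2_measurable[OF f] by simp
    have "\<bar>a n x - f x\<bar> \<le> \<bar>f x\<bar>" for n x unfolding a_def by auto
    then show "AE x in M. norm ((a n x - f x)\<^sup>2) \<le> (f x)\<^sup>2" for n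
      by (intro AE_I2) (simp add: abs_le_square_iff)
    show "AE x in M. (\<lambda>n. (a n x - f x)\<^sup>2) \<longlonglongrightarrow> 0"
    proof (rule AE_I2)
      fix x
      show "(\<lambda>n. (a n x - f x)\<^sup>2) \<longlonglongrightarrow> 0"
        using a_lim[of x] by (intro tendsto_eventually) (auto elim: eventually_mono)
    qed
  qed simp
  then obtain \<zeta> where z: "(\<lambda>n. fmul (a n) \<omega>) \<longlonglongrightarrow> \<zeta>"
    using tendsto_form_mult_\<omega>[of f a] f aB by auto
  have *: "AE x in M. \<beta> \<zeta> \<eta> x = f x * \<beta> \<omega> \<eta> x" for \<eta>
  proof -
    obtain r where r: "strict_mono r" "AE x in M. (\<lambda>n. \<beta> (fmul (a (r n)) \<omega>) \<eta> x) \<longlonglongrightarrow> \<beta> \<zeta> \<eta> x"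
      using \<beta>_tendsto_subseq[OF z, of \<eta> \<eta>] by auto
    have "AE x in M. \<forall>n. \<beta> (fmul (a n) \<omega>) \<eta> x = a n x * \<beta> \<omega> \<eta> x"
      unfolding AE_all_countable using \<beta>_form_mult[OF aB] by blast
    then show ?thesis using r(2)
    proof eventually_elim
      case (elim x)
      have "(\<lambda>n. a n x) \<longlonglongrightarrow> f x" using a_lim by (rule tendsto_eventually)
      from LIMSEQ_subseq_LIMSEQ[OF this r(1)] have "(\<lambda>n. a (r n) x * \<beta> \<omega> \<eta> x) \<longlonglongrightarrow> f x * \<beta> \<omega> \<eta> x"
        by (intro tendsto_mult tendsto_const) (simp add: o_def)
      then show ?case using elim by (simp add: LIMSEQ_unique)
    qed
  qed
  show ?thesis using star_eqI[OF *] * by simp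
qed

lemma star_coefficient: "star (\<beta> \<eta> \<omega>) = \<eta>"
  by (rule star_eqI) (rule \<beta>_factor)

lemma inner_star: "f \<in> L2 M \<Longrightarrow> inner (star f) \<eta> = l2_inner M f (\<beta> \<eta> \<omega>)"
  unfolding inner_\<beta> l2_inner_def
proof (rule integral_cong_AE)
  assume f: "f \<in> L2 M"
  show "\<beta> (star f) \<eta> \<in> borel_measurable M" "(\<lambda>x. f x * \<beta> \<eta> \<omega> x) \<in> borel_measurable M"
    using \<beta>_integrable[THEN borel_measurable_integrable] L2_measurable[OF f] by auto
  show "AE x in M. \<beta> (star f) \<eta> x = f x * \<beta> \<eta> \<omega> x"
    using star_\<beta>[OF f, of \<eta>] \<beta>_sym[of \<eta> \<omega>] by eventually_elim simp
qed

lemma l2_inner_coefficient: "l2_inner M (\<beta> \<eta> \<omega>) (\<beta> \<zeta> \<omega>) = inner \<eta> \<zeta>"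
  using inner_star[OF coefficient_L2, of \<eta> \<zeta>] by (simp add: star_coefficient)

lemma star_inv_AE: "AE x in M. hodge_star_inv M D \<Gamma> tens \<omega> \<eta> x = \<beta> \<eta> \<omega> x"
  and star_inv_L2: "hodge_star_inv M D \<Gamma> tens \<omega> \<eta> \<in> L2 M"
proof -
  let ?f = "hodge_star_inv M D \<Gamma> tens \<omega> \<eta>"
  have "\<beta> \<eta> \<omega> \<in> L2 M \<and> star (\<beta> \<eta> \<omega>) = \<eta>" using coefficient_L2 star_coefficient by blast
  then have f: "?f \<in> L2 M \<and> star ?f = \<eta>" unfolding hodge_star_inv_def
      by (rule someI[where P="\<lambda>f. f \<in> L2 M \<and> star f = \<eta>"])
  then show "?f \<in> L2 M" by blast
  show "AE x in M. ?f x = \<beta> \<eta> \<omega> x"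
    using star_\<beta>[of ?f \<omega>] f \<beta>_\<omega>_\<omega> by (auto elim!: eventually_elim2)
qed

lemma star_Bb:
  assumes "f \<in> Bb"
  shows "star f = fmul f \<omega>"
  by (rule star_eqI) (rule \<beta>_form_mult[OF assms])

end

section \<open>Slices of a function and the Leibniz rule\<close>

text \<open>The part of \<open>f\<close> between the levels \<open>i/n\<close> and \<open>(i+1)/n\<close>.\<close>

definition slice :: "nat \<Rightarrow> ('a \<Rightarrow> real) \<Rightarrow> nat \<Rightarrow> 'a \<Rightarrow> real" where
  "slice n f i x = min (f x) (real (Suc i) / real n) - min (f x) (real i / real n)"

text \<open>For \<open>f\<close> with values in the unit interval, the composition of \<open>f\<close> with the piecewise
  linear function that vanishes at \<open>0\<close> and has slope \<open>a (i/n)\<close> on the interval from \<open>i/n\<close> to \<open>(i+1)/n\<close>.\<close>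

definition staircase :: "nat \<Rightarrow> (real \<Rightarrow> real) \<Rightarrow> ('a \<Rightarrow> real) \<Rightarrow> 'a \<Rightarrow> real" where
  "staircase n a f x = (\<Sum>i<n. a (real i / real n) * slice n f i x)"

lemma slice_bounds:
  assumes "n > 0"
  shows "0 \<le> slice n f i x" "slice n f i x \<le> 1 / real n"
proof -
  have *: "0 \<le> min y q - min y p \<and> min y q - min y p \<le> q - p" if "p \<le> q" for y p q :: real
    using that by auto
  have "real i / real n \<le> real (Suc i) / real n" by (simp add: divide_right_mono)
  moreover have "real (Suc i) / real n - real i / real n = 1 / real n"
    by (simp add: add_divide_distrib)
  ultimately show "0 \<le> slice n f i x" "slice n f i x \<le> 1 / real n"
    unfolding slice_def using *[of "real i / real n" "real (Suc i) / real n" "f x"] by simp_all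
qed

lemma slice_eq_0: "f x \<le> real i / real n \<Longrightarrow> slice n f i x = 0"
proof -
  assume "f x \<le> real i / real n"
  moreover have "real i / real n \<le> real (Suc i) / real n" by (simp add: divide_right_mono)
  ultimately show ?thesis unfolding slice_def by simp
qed

lemma slice_eq_max: "real (Suc i) / real n \<le> f x \<Longrightarrow> slice n f i x = 1 / real n"
proof -
  assume "real (Suc i) / real n \<le> f x"
  moreover have "real i / real n \<le> real (Suc i) / real n" by (simp add: divide_right_mono)
  moreover have "real (Suc i) / real n - real i / real n = 1 / real n"
    by (simp add: add_divide_distrib)
  ultimately show ?thesis unfolding slice_def by (simp add: min_absorb2 del: of_nat_Suc)
qed

lemma sum_slice:
  assumes "n > 0" "0 \<le> f x" "f x \<le> 1"
  shows "(\<Sum>i<n. slice n f i x) = f x"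
  unfolding slice_def using assms by (subst sum_lessThan_telescope) simp

lemma slice_refine:
  assumes "n > 0" "m > 0"
  shows "slice n f i x = (\<Sum>r<m. slice (n * m) f (i * m + r) x)"
proof -
  define p where "p r = min (f x) (real (i * m + r) / real (n * m))" for r
  have "(\<Sum>r<m. slice (n * m) f (i * m + r) x) = (\<Sum>r<m. p (Suc r) - p r)"
    unfolding slice_def p_def by simp
  also have "\<dots> = p m - p 0" by (rule sum_lessThan_telescope)
  also have "\<dots> = slice n f i x"
  proof -
    have "real (i * m + m) / real (n * m) = real (Suc i) / real n"
      "real (i * m + 0) / real (n * m) = real i / real n"
      using assms by (auto simp: field_simps)
    then show ?thesis unfolding slice_def p_def by simp
  qed
  finally show ?thesis by simp
qed

lemma staircase_refine:
  assumes nm: "n > 0" "m > 0"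
  shows "staircase n a f x = (\<Sum>j<n * m. a (real (j div m) / real n) * slice (n * m) f j x)"
proof -
  have "staircase n a f x = (\<Sum>i<n. \<Sum>r<m. a (real i / real n) * slice (n * m) f (i * m + r) x)"
    unfolding staircase_def slice_refine[OF nm] by (simp add: sum_distrib_left)
  also have "\<dots> = (\<Sum>i<n. \<Sum>r<m. a (real ((i * m + r) div m) / real n) * slice (n * m) f (i * m
      + r) x)"
    by (intro sum.cong refl) simp
  also have "\<dots> = (\<Sum>i<n. \<Sum>j\<in>{i * m..<i * m + m}. a (real (j div m) / real n) * slice (n * m) f j x)"
  proof (rule sum.cong[OF refl])
    fix i
    let ?F = "\<lambda>j. a (real (j div m) / real n) * slice (n * m) f j x"
    show "(\<Sum>r<m. ?F (i * m + r)) = (\<Sum>j\<in>{i * m..<i * m + m}. ?F j)"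
      using sum.shift_bounds_nat_ivl[of ?F 0 "i * m" m] by (simp add: lessThan_atLeast0 add.commute)
  qed
  also have "\<dots> = (\<Sum>j<n * m. a (real (j div m) / real n) * slice (n * m) f j x)"
    by (rule sum.nat_group)
  finally show ?thesis .
qed

lemma staircase_approx:
  assumes n: "n > 0" and f: "0 \<le> f x" "f x \<le> 1" and 0: "\<phi> 0 = 0"
    and \<phi>: "\<And>s t. 0 \<le> s \<Longrightarrow> s \<le> t \<Longrightarrow> t \<le> 1 \<Longrightarrow> \<bar>\<phi> t - \<phi> s - a s * (t - s)\<bar> \<le> L * (t - s)\<^sup>2"
  shows "\<bar>\<phi> (f x) - staircase n a f x\<bar> \<le> L / real n * f x"
proof -
  define p where "p i = min (f x) (real i / real n)" for i
  have L: "L \<ge> 0" using \<phi>[of 0 1] by simp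
  have "\<phi> (f x) = \<phi> (p n) - \<phi> (p 0)" using n f 0 by (simp add: p_def)
  also have "\<dots> = (\<Sum>i<n. \<phi> (p (Suc i)) - \<phi> (p i))" by (rule sum_lessThan_telescope[symmetric])
  finally have "\<phi> (f x) - staircase n a f x =
      (\<Sum>i<n. \<phi> (p (Suc i)) - \<phi> (p i) - a (real i / real n) * slice n f i x)"
    unfolding staircase_def by (simp add: sum_subtractf)
  also have "\<bar>\<dots>\<bar> \<le> (\<Sum>i<n. L / real n * slice n f i x)"
  proof (rule order_trans[OF sum_abs], rule sum_mono)
    fix i
    have sl: "slice n f i x = p (Suc i) - p i" by (simp add: slice_def p_def)
    show "\<bar>\<phi> (p (Suc i)) - \<phi> (p i) - a (real i / real n) * slice n f i x\<bar>
        \<le> L / real n * slice n f i x"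
    proof (cases "f x \<le> real i / real n")
      case True
      then have "slice n f i x = 0" by (rule slice_eq_0)
      then show ?thesis using sl by simp
    next
      case False
      then have pi: "p i = real i / real n" by (simp add: p_def)
      have "p (Suc i) - p i \<ge> 0" using slice_bounds(1)[OF n, of f i x] sl by simp
      then have "\<bar>\<phi> (p (Suc i)) - \<phi> (p i) - a (p i) * (p (Suc i) - p i)\<bar> \<le> L * (p (Suc i) - p i)\<^sup>2"
        using f pi by (intro \<phi>) (auto simp: p_def)
      also have "\<dots> \<le> L * (1 / real n * (p (Suc i) - p i))"
        using slice_bounds[OF n, of f i x] L unfolding power2_eq_square sl
        by (intro mult_left_mono mult_right_mono) auto
      finally show ?thesis using pi sl by simp
    qed
  qed
  also have "\<dots> = L / real n * f x"
    unfolding sum_distrib_left[symmetric] sum_slice[of n f x, OF n f] by (rule refl)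
  finally show ?thesis .
qed

text \<open>Both quotients are \<open>j/(n m)\<close> rounded down, to a multiple of \<open>1/n\<close> and of \<open>1/m\<close>.\<close>

lemma floor_grid_diff:
  fixes n m j :: nat
  assumes "n > 0" "m > 0"
  shows "\<bar>real (j div m) / real n - real (j div n) / real m\<bar> \<le> 1 / real n + 1 / real m"
proof -
  have *: "real j / real (p * q) - 1 / real q \<le> real (j div p) / real q"
    "real (j div p) / real q \<le> real j / real (p * q)" if "p > 0" "q > 0" for p q
  proof -
    have "real (j div p) * real p \<le> real j" by (metis div_times_less_eq_dividend of_nat_le_iff
        of_nat_mult)
    then show "real (j div p) / real q \<le> real j / real (p * q)"
      using that by (simp add: field_simps)
    have "j < (j div p) * p + p" using that(1) by (metis add.commute dividend_less_div_times)
    then have "real j < real (j div p) * real p + real p"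
        by (metis of_nat_less_iff of_nat_add of_nat_mult)
    then have "real j / real p - 1 \<le> real (j div p)" using that by (simp add: field_simps)
    then have "(real j / real p - 1) / real q \<le> real (j div p) / real q"
        by (simp add: divide_right_mono)
    then show "real j / real (p * q) - 1 / real q \<le> real (j div p) / real q"
      by (simp add: diff_divide_distrib)
  qed
  show ?thesis
    using *[of m n] *[of n m] assms by (simp add: mult.commute abs_le_iff)
qed

lemma Cc_iff: "f \<in> Cc \<longleftrightarrow> continuous_on UNIV f \<and> (\<exists>K. compact K \<and> (\<forall>x. x \<notin> K \<longrightarrow> f x = 0))"
proof
  assume "f \<in> Cc"
  then show "continuous_on UNIV f \<and> (\<exists>K. compact K \<and> (\<forall>x. x \<notin> K \<longrightarrow> f x = 0))"
    unfolding Cc_def using closure_subset[of "{x. f x \<noteq> 0}"] by blast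
next
  assume r: "continuous_on UNIV f \<and> (\<exists>K. compact K \<and> (\<forall>x. x \<notin> K \<longrightarrow> f x = 0))"
  then obtain K where K: "compact K" "\<And>x. x \<notin> K \<Longrightarrow> f x = 0" by blast
  have "closure {x. f x \<noteq> 0} \<subseteq> K"
    using K by (intro closure_minimal compact_imp_closed) auto
  then have "compact (closure {x. f x \<noteq> 0})"
    using K(1) by (metis closed_closure compact_Int_closed inf.absorb_iff2)
  then show "f \<in> Cc" using r by (simp add: Cc_def)
qed

lemma CcE:
  assumes "f \<in> Cc"
  obtains K where "continuous_on UNIV f" "compact K" "\<forall>x. x \<notin> K \<longrightarrow> f x = 0"
proof -
  from assms[unfolded Cc_iff] obtain K where "continuous_on UNIV f"
    and K: "compact K" "\<forall>x. x \<notin> K \<longrightarrow> f x = 0" by (elim conjE exE)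
  then show thesis by (intro that[of K]) simp_all
qed

lemma Cc_subset_Cb: "Cc \<subseteq> Cb"
proof
  fix f :: "'a \<Rightarrow> real" assume "f \<in> Cc"
  then obtain K where f: "continuous_on UNIV f" and K: "compact K" "\<forall>x. x \<notin> K \<longrightarrow> f x = 0"
    by (rule CcE)
  have "compact (f ` K)" using K(1) continuous_on_subset[OF f]
      by (intro compact_continuous_image) auto
  then obtain B where B: "\<And>x. x \<in> K \<Longrightarrow> \<bar>f x\<bar> \<le> B"
    using compact_imp_bounded bounded_iff by (metis imageI real_norm_def)
  have "\<bar>f x\<bar> \<le> \<bar>B\<bar>" for x
    using B[of x] K(2) by (cases "x \<in> K") auto
  then show "f \<in> Cb" using f by (auto simp: Cb_iff)
qed

lemma Cc_lincomb: "f \<in> Cc \<Longrightarrow> g \<in> Cc \<Longrightarrow> (\<lambda>x. a * f x + b * g x) \<in> Cc"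
proof -
  assume fC: "f \<in> Cc" and gC: "g \<in> Cc"
  obtain K where f: "continuous_on UNIV f" and K: "compact K" "\<forall>x. x \<notin> K \<longrightarrow> f x = 0"
    using fC by (rule CcE)
  obtain L where g: "continuous_on UNIV g" and L: "compact L" "\<forall>x. x \<notin> L \<longrightarrow> g x = 0"
    using gC by (rule CcE)
  have "continuous_on UNIV (\<lambda>x. a * f x + b * g x)" by (intro continuous_intros f g)
  moreover have "compact (K \<union> L)" using K(1) L(1) by (rule compact_Un)
  ultimately show ?thesis unfolding Cc_iff using K(2) L(2) by (intro conjI exI[of _ "K \<union> L"]) auto
qed

context local_dirichlet_forms
begin

text \<open>The derivation on the functions of \<open>CD\<close>, where it agrees with \<^const>\<open>deriv_form\<close>.\<close>

abbreviation "grad f \<equiv> tens f (\<lambda>x. 1)"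

lemma inner_grad: "f \<in> CD \<Longrightarrow> g \<in> CD \<Longrightarrow> inner (grad f) (grad g) = E f g"
  using inner_tens[of f g "\<lambda>x. 1" "\<lambda>x. 1"] E_\<Gamma>[of f g] by (simp add: Bb_const)

lemma norm_grad: "f \<in> CD \<Longrightarrow> (norm (grad f))\<^sup>2 = E f f"
  using inner_grad[of f f] by (simp add: power2_norm_eq_inner)

lemma grad_lincomb: "f \<in> CD \<Longrightarrow> g \<in> CD \<Longrightarrow> grad (\<lambda>x. a * f x + b * g x) = a *\<^sub>R grad f + b *\<^sub>R grad g"
  by (rule tens_lincomb_left) (auto simp: Bb_const)

lemma grad_scale: "f \<in> CD \<Longrightarrow> grad (\<lambda>x. a * f x) = a *\<^sub>R grad f"
  using grad_lincomb[of f f a 0] by simp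

lemma grad_diff: "f \<in> CD \<Longrightarrow> g \<in> CD \<Longrightarrow> grad (\<lambda>x. f x - g x) = grad f - grad g"
  using grad_lincomb[of f g 1 "-1"] by simp

lemma zero_CD: "(\<lambda>x. 0) \<in> CD"
  using D_zero by (auto simp: Cb_iff)

lemma CD_diff: "f \<in> CD \<Longrightarrow> g \<in> CD \<Longrightarrow> (\<lambda>x. f x - g x) \<in> CD"
  using CD_lincomb[of f g 1 "-1"] by simp

lemma grad_sum:
  assumes "\<And>i. i \<in> I \<Longrightarrow> f i \<in> CD"
  shows "(\<lambda>x. \<Sum>i\<in>I. c i * f i x) \<in> CD \<and> grad (\<lambda>x. \<Sum>i\<in>I. c i * f i x) = (\<Sum>i\<in>I. c i *\<^sub>R grad (f i))"
  using assms
proof (induction I rule: infinite_finite_induct)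
  case (insert i I)
  have "(\<lambda>x. c i * f i x + 1 * (\<Sum>i\<in>I. c i * f i x)) \<in> CD"
    using insert by (intro CD_lincomb) auto
  moreover have "grad (\<lambda>x. c i * f i x + 1 * (\<Sum>i\<in>I. c i * f i x)) =
      c i *\<^sub>R grad (f i) + 1 *\<^sub>R grad (\<lambda>x. \<Sum>i\<in>I. c i * f i x)"
    using insert by (intro grad_lincomb) auto
  ultimately show ?case using insert by simp
qed (use zero_CD grad_scale[OF zero_CD, of 0] in simp_all)

lemma unit_scale_D:
  assumes f: "f \<in> D" and c: "c > 0"
  shows "(\<lambda>x. min c (max 0 (f x))) \<in> D"
    and "E (\<lambda>x. min c (max 0 (f x))) (\<lambda>x. min c (max 0 (f x))) \<le> E f f"
proof -
  let ?g = "\<lambda>x. inverse c * f x"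
  let ?h = "\<lambda>x. min 1 (max 0 (?g x))"
  have gD: "?g \<in> D" using f by (rule D_scale)
  have scale: "E (\<lambda>x. c * h x) (\<lambda>x. c * h x) = c\<^sup>2 * E h h" if "h \<in> D" for h c
    using E_lincomb[of h h "\<lambda>x. c * h x" c 0] E_lincomb[of h h h c 0] E_sym[of h "\<lambda>x. c * h x"] that
    by (simp add: D_scale power2_eq_square)
  have eq: "(\<lambda>x. min c (max 0 (f x))) = (\<lambda>x. c * ?h x)"
    using c by (auto simp: fun_eq_iff min_def max_def field_simps)
  show "(\<lambda>x. min c (max 0 (f x))) \<in> D" unfolding eq by (intro D_scale D_unit gD)
  have "E (\<lambda>x. c * ?h x) (\<lambda>x. c * ?h x) = c\<^sup>2 * E ?h ?h" by (rule scale[OF D_unit[OF gD]])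
  also have "\<dots> \<le> c\<^sup>2 * E ?g ?g" using E_unit[OF gD] by (intro mult_left_mono) auto
  also have "\<dots> = E f f" using c by (simp add: scale[OF f] power_inverse)
  finally show "E (\<lambda>x. min c (max 0 (f x))) (\<lambda>x. min c (max 0 (f x))) \<le> E f f" unfolding eq .
qed

lemma slice_Cc_D:
  assumes f: "f \<in> Cc \<inter> D" "\<And>x. 0 \<le> f x" and n: "n > 0"
  shows "slice n f i \<in> Cc \<inter> D"
proof -
  have m: "(\<lambda>x. min (f x) (real k / real n)) \<in> D" for k
  proof (cases "k = 0")
    case True then show ?thesis using f(2) D_zero by (simp add: min_absorb2)
  next
    case False
    then have "(\<lambda>x. min (real k / real n) (max 0 (f x))) \<in> D"
      using f n by (intro unit_scale_D) auto
    then show ?thesis using f(2) by (simp add: max_absorb2 min.commute)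
  qed
  have "slice n f i \<in> D"
    using D_diff[OF m m, of "Suc i" i] by (simp add: slice_def[abs_def])
  moreover obtain K where c: "continuous_on UNIV f" and K: "compact K" "\<forall>x. x \<notin> K \<longrightarrow> f x = 0"
    using IntD1[OF f(1)] by (rule CcE)
  have "continuous_on UNIV (slice n f i)"
    unfolding slice_def[abs_def] by (intro continuous_intros c)
  moreover have "slice n f i x = 0" if "x \<notin> K" for x
    using K(2) that by (intro slice_eq_0) simp
  ultimately show ?thesis using K(1) by (auto simp: Cc_iff)
qed

lemma slice_CD:
  "f \<in> Cc \<inter> D \<Longrightarrow> (\<And>x. 0 \<le> f x) \<Longrightarrow> n > 0 \<Longrightarrow> slice n f i \<in> CD"
  using slice_Cc_D[of f n i] Cc_subset_Cb by blast

lemma staircase_CD: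
  assumes "f \<in> Cc \<inter> D" "\<And>x. 0 \<le> f x" "n > 0"
  shows "staircase n a f \<in> CD"
    and "grad (staircase n a f) = (\<Sum>i<n. a (real i / real n) *\<^sub>R grad (slice n f i))"
  using grad_sum[of "{..<n}" "slice n f" "\<lambda>i. a (real i / real n)"] slice_CD[OF assms]
  by (simp_all add: staircase_def[abs_def])

text \<open>If \<open>j > i\<close>, then truncating \<open>slice n f i + t * slice n f j\<close> at height \<open>1/n\<close> gives back
  \<open>slice n f i\<close>, for every \<open>t > 0\<close>. So the Markov property forces the mixed energy to be
  nonnegative.\<close>

lemma slice_energy_nonneg:
  assumes f: "f \<in> Cc \<inter> D" "\<And>x. 0 \<le> f x" and n: "n > 0"
  shows "inner (grad (slice n f i)) (grad (slice n f j)) \<ge> 0"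
proof -
  have lt: "inner (grad (slice n f i)) (grad (slice n f j)) \<ge> 0" if ij: "i < j" for i j
  proof (rule ccontr)
    let ?v = "grad (slice n f i)" and ?w = "grad (slice n f j)"
    note si = slice_CD[OF f n, of i] and sj = slice_CD[OF f n, of j]
    have key: "0 \<le> 2 * inner ?v ?w + t * inner ?w ?w" if t: "t > 0" for t
    proof -
      let ?u = "\<lambda>x. 1 * slice n f i x + t * slice n f j x"
      have u: "?u \<in> CD" using si sj by (rule CD_lincomb)
      have "min (1 / real n) (max 0 (?u x)) = slice n f i x" for x
      proof (cases "f x \<le> real j / real n")
        case True
        then have "slice n f j x = 0" by (rule slice_eq_0)
        then show ?thesis using slice_bounds[OF n, of f i x] by simp
      next
        case False
        have "real (Suc i) / real n \<le> real j / real n" using ij by (simp add: divide_right_mono)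
        then have "slice n f i x = 1 / real n" using False by (intro slice_eq_max) auto
        moreover have "0 \<le> t * slice n f j x" using t slice_bounds(1)[OF n, of f j x] by simp
        ultimately show ?thesis by simp
      qed
      then have "E (slice n f i) (slice n f i) \<le> E ?u ?u"
        using unit_scale_D(2)[of ?u "1 / real n"] u n by simp
      then have "inner ?v ?v \<le> inner (1 *\<^sub>R ?v + t *\<^sub>R ?w) (1 *\<^sub>R ?v + t *\<^sub>R ?w)"
        unfolding inner_grad[OF si si, symmetric] inner_grad[OF u u, symmetric] grad_lincomb[OF si
            sj] .
      then have "0 \<le> t * (2 * inner ?v ?w + t * inner ?w ?w)"
        by (simp add: inner_add_left inner_add_right inner_commute algebra_simps)
      then show ?thesis using t by (simp add: zero_le_mult_iff)
    qed
    assume neg: "\<not> inner ?v ?w \<ge> 0"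
    \<comment> \<open>The \<open>+ 1\<close> keeps the denominator positive when the upper slice has energy zero.\<close>
    define t where "t = - inner ?v ?w / (inner ?w ?w + 1)"
    have W: "inner ?w ?w + 1 > 0" using inner_ge_zero[of ?w] by linarith
    then have W0: "inner ?w ?w + 1 \<noteq> 0" by linarith
    have t: "t > 0" unfolding t_def by (intro divide_pos_pos W) (use neg in linarith)
    have "t * inner ?w ?w \<le> t * (inner ?w ?w + 1)" using t by simp
    also have "\<dots> = - inner ?v ?w" using W0 unfolding t_def by simp
    finally show False using key[OF t] neg by simp
  qed
  consider "i < j" | "j < i" | "i = j" by linarith
  then show ?thesis using lt[of i j] lt[of j i] by cases (auto simp: inner_commute)
qed

text \<open>Slices at non-adjacent levels have no mixed energy: the lower one is constant near the support
  of the upper one.\<close>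

lemma slice_energy_eq_0:
  assumes f: "f \<in> Cc \<inter> D" "\<And>x. 0 \<le> f x" and n: "n > 0"
    and ij: "i + 2 \<le> j \<or> j + 2 \<le> i"
  shows "inner (grad (slice n f i)) (grad (slice n f j)) = 0"
proof -
  have supp: "ess_supp M g \<subseteq> F" if "closed F" "\<And>x. x \<notin> F \<Longrightarrow> g x = 0" for g F
    unfolding ess_supp_def using that by blast
  have "compact (ess_supp M g)" if g: "g \<in> Cc" for g
  proof -
    obtain K where "continuous_on UNIV g" and K: "compact K" "\<forall>x. x \<notin> K \<longrightarrow> g x = 0"
        by (rule CcE[OF g])
    have "ess_supp M g \<subseteq> K" using K by (intro supp compact_imp_closed) auto
    moreover have "closed (ess_supp M g)" unfolding ess_supp_def by (intro closed_Inter) auto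
    ultimately show ?thesis using K(1) by (metis compact_Int_closed inf.absorb_iff2)
  qed
  then have cs: "compact (ess_supp M (slice n f i))" for i
    using slice_Cc_D[OF f n] by blast
  have lt: "inner (grad (slice n f i)) (grad (slice n f j)) = 0" if ij: "i + 2 \<le> j" for i j
  proof -
    have c: "continuous_on UNIV f" using f(1) by (simp add: Cc_iff)
    define U where "U = {x. real (Suc i) / real n < f x}"
    have "open U" unfolding U_def by (intro open_Collect_less continuous_intros c)
    moreover have "ess_supp M (slice n f j) \<subseteq> {x. real j / real n \<le> f x}"
    proof (rule supp)
      show "closed {x. real j / real n \<le> f x}" by (intro closed_Collect_le continuous_intros c)
    qed (auto intro: slice_eq_0)
    moreover have "{x. real j / real n \<le> f x} \<subseteq> U"
    proof
      fix x assume "x \<in> {x. real j / real n \<le> f x}"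
      moreover have "real (Suc i) / real n < real j / real n"
        using ij n by (simp add: divide_strict_right_mono)
      ultimately show "x \<in> U" unfolding U_def by auto
    qed
    moreover have "slice n f i x = 1 / real n" if "x \<in> U" for x
      using that by (intro slice_eq_max) (simp add: U_def)
    ultimately have "\<exists>U c. open U \<and> ess_supp M (slice n f j) \<subseteq> U \<and> (AE x in M. x \<in> U \<longrightarrow> slice n f i x
        = c)"
      by (intro exI[of _ U] exI[of _ "1 / real n"]) auto
    then have "E (slice n f j) (slice n f i) = 0"
      using strongly_local cs slice_Cc_D[OF f n] unfolding strongly_local_def by blast
    then show ?thesis
      using inner_grad[OF slice_CD[OF f n] slice_CD[OF f n], of j i] by (simp add: inner_commute)
  qed
  show ?thesis using ij lt[of i j] lt[of j i] by (auto simp: inner_commute)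
qed

lemma sum_slice_energy:
  assumes f: "f \<in> Cc \<inter> D" "\<And>x. 0 \<le> f x" "\<And>x. f x \<le> 1" and n: "n > 0"
  shows "(\<Sum>i<n. grad (slice n f i)) = grad f"
proof -
  have "staircase n (\<lambda>_. 1) f = f"
    using sum_slice[of n f, OF n f(2,3)] by (auto simp: staircase_def fun_eq_iff)
  then show ?thesis using staircase_CD(2)[OF f(1,2) n, of "\<lambda>_. 1"] by simp
qed

lemma inner_sum_sum: "inner (\<Sum>i\<in>I. p i *\<^sub>R v i) (\<Sum>j\<in>J. q j *\<^sub>R w j) =
    (\<Sum>i\<in>I. \<Sum>j\<in>J. p i * q j * inner (v i) (w j))"
  for v w :: "_ \<Rightarrow> 'b::real_inner"
  by (simp add: inner_sum_left inner_sum_right sum_distrib_left mult.assoc, subst sum.swap)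
    (simp add: mult.left_commute)

text \<open>Multiplying the slices of \<open>f\<close> by bounded constants is a bounded operation in energy, since
  all mixed energies are nonnegative and add up to the energy of \<open>f\<close>.\<close>

lemma norm_slice_combination_le:
  assumes f: "f \<in> Cc \<inter> D" "\<And>x. 0 \<le> f x" "\<And>x. f x \<le> 1" and n: "n > 0"
    and c: "\<And>i. i < n \<Longrightarrow> \<bar>c i\<bar> \<le> C" and C: "C \<ge> 0"
  shows "norm (\<Sum>i<n. c i *\<^sub>R grad (slice n f i)) \<le> C * norm (grad f)"
proof (rule power2_le_imp_le)
  let ?v = "\<lambda>i. grad (slice n f i)"
  have "(norm (\<Sum>i<n. c i *\<^sub>R ?v i))\<^sup>2 = (\<Sum>i<n. \<Sum>j<n. c i * c j * inner (?v i) (?v j))"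
    unfolding power2_norm_eq_inner by (rule inner_sum_sum)
  also have "\<dots> \<le> (\<Sum>i<n. \<Sum>j<n. C * C * inner (?v i) (?v j))"
  proof (intro sum_mono mult_right_mono slice_energy_nonneg f n)
    fix i j assume "i \<in> {..<n}" "j \<in> {..<n}"
    then have "\<bar>c i * c j\<bar> \<le> C * C" unfolding abs_mult using c C by (intro mult_mono) auto
    then show "c i * c j \<le> C * C" by simp
  qed
  also have "\<dots> = (norm (\<Sum>i<n. C *\<^sub>R ?v i))\<^sup>2"
    unfolding power2_norm_eq_inner by (rule inner_sum_sum[symmetric])
  also have "\<dots> = (C * norm (grad f))\<^sup>2"
    using C unfolding scaleR_sum_right[symmetric] sum_slice_energy[OF f n] by simp
  finally show "(norm (\<Sum>i<n. c i *\<^sub>R ?v i))\<^sup>2 \<le> (C * norm (grad f))\<^sup>2" .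
qed (use C in simp)

text \<open>On the common refinement of the grids with \<open>n\<close> and \<open>m\<close> levels, the two staircases have slopes that
  differ by at most \<open>L (1/n + 1/m)\<close>.\<close>

lemma norm_grad_staircase_diff_le:
  assumes f: "f \<in> Cc \<inter> D" "\<And>x. 0 \<le> f x" "\<And>x. f x \<le> 1" and nm: "n > 0" "m > 0"
    and L: "L \<ge> 0" and a: "\<And>s t. s \<in> {0..1} \<Longrightarrow> t \<in> {0..1} \<Longrightarrow> \<bar>a s - a t\<bar> \<le> L * \<bar>s - t\<bar>"
  shows "norm (grad (staircase n a f) - grad (staircase m a f)) \<le>
    L * (1 / real n + 1 / real m) * norm (grad f)"
proof -
  define c where "c j = a (real (j div m) / real n) - a (real (j div n) / real m)" for j
  have "staircase n a f x - staircase m a f x = (\<Sum>j<n * m. c j * slice (n * m) f j x)" for x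
    unfolding staircase_refine[OF nm] staircase_refine[OF nm(2,1)] c_def
    by (simp add: mult.commute[of m n] sum_subtractf left_diff_distrib)
  then have "grad (staircase n a f) - grad (staircase m a f)
      = grad (\<lambda>x. \<Sum>j<n * m. c j * slice (n * m) f j x)"
    using grad_diff[OF staircase_CD(1)[OF f(1,2) nm(1), of a] staircase_CD(1)[OF f(1,2) nm(2), of
        a]] by simp
  also have "\<dots> = (\<Sum>j<n * m. c j *\<^sub>R grad (slice (n * m) f j))"
    using nm by (intro conjunct2[OF grad_sum] slice_CD f) auto
  also have "norm \<dots> \<le> L * (1 / real n + 1 / real m) * norm (grad f)"
  proof (rule norm_slice_combination_le[OF f])
    show "n * m > 0" using nm by simp
    show "0 \<le> L * (1 / real n + 1 / real m)" using L by simp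
    fix j assume j: "j < n * m"
    have "j div m < n" "j div n < m"
      using j nm by (simp_all add: less_mult_imp_div_less mult.commute)
    then have "\<bar>c j\<bar> \<le> L * \<bar>real (j div m) / real n - real (j div n) / real m\<bar>"
      unfolding c_def using nm by (intro a) auto
    also have "\<dots> \<le> L * (1 / real n + 1 / real m)"
      using L floor_grid_diff[OF nm] by (intro mult_left_mono)
    finally show "\<bar>c j\<bar> \<le> L * (1 / real n + 1 / real m)" .
  qed
  finally show ?thesis .
qed

lemma E1_norm_eq: "E1_norm M E f = sqrt (E f f + (\<integral>x. (f x)\<^sup>2 \<partial>M))"
  by (simp add: E1_norm_def l2_inner_def power2_eq_square)

lemma E1_norm_tendsto_0_D:
  assumes u: "\<And>n. u n \<in> D" and lim: "(\<lambda>n. E1_norm M E (u n)) \<longlonglongrightarrow> 0"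
  shows "(\<lambda>n. E (u n) (u n)) \<longlonglongrightarrow> 0" "(\<lambda>n. \<integral>x. (u n x)\<^sup>2 \<partial>M) \<longlonglongrightarrow> 0"
proof -
  have nn: "E (u n) (u n) \<ge> 0" "(\<integral>x. (u n x)\<^sup>2 \<partial>M) \<ge> 0" for n using E_nonneg[OF u] by simp_all
  have "(\<lambda>n. (E1_norm M E (u n))\<^sup>2) \<longlonglongrightarrow> 0" using tendsto_power[OF lim, of 2] by simp
  then have l: "(\<lambda>n. E (u n) (u n) + (\<integral>x. (u n x)\<^sup>2 \<partial>M)) \<longlonglongrightarrow> 0"
    using nn by (simp add: E1_norm_eq)
  show "(\<lambda>n. E (u n) (u n)) \<longlonglongrightarrow> 0"
    by (rule tendsto_sandwich[OF _ _ tendsto_const l]) (use nn in auto)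
  show "(\<lambda>n. \<integral>x. (u n x)\<^sup>2 \<partial>M) \<longlonglongrightarrow> 0"
    by (rule tendsto_sandwich[OF _ _ tendsto_const l]) (use nn in auto)
qed

lemma L2_dist_le:
  assumes "f \<in> L2 M" "g \<in> L2 M" "h \<in> L2 M"
  shows "(\<integral>x. (f x - h x)\<^sup>2 \<partial>M) \<le> 2 * (\<integral>x. (g x - f x)\<^sup>2 \<partial>M) + 2 * (\<integral>x. (g x - h x)\<^sup>2 \<partial>M)"
  using integral_square_add_le[OF L2_diff[OF assms(1,2)] L2_diff[OF assms(2,3)]]
  by (simp add: power2_commute[of "f _" "g _"])

lemma L2_limit_unique:
  assumes "\<And>n. u n \<in> L2 M" "f \<in> L2 M" "h \<in> L2 M"
    and lim: "(\<lambda>n. \<integral>x. (u n x - f x)\<^sup>2 \<partial>M) \<longlonglongrightarrow> 0" "(\<lambda>n. \<integral>x. (u n x - h x)\<^sup>2 \<partial>M) \<longlonglongrightarrow> 0"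
  shows "AE x in M. f x = h x"
proof -
  have "(\<lambda>n. 2 * (\<integral>x. (u n x - f x)\<^sup>2 \<partial>M) + 2 * (\<integral>x. (u n x - h x)\<^sup>2 \<partial>M)) \<longlonglongrightarrow> 2 * 0 + 2 * 0"
    by (intro tendsto_intros lim)
  then have "(\<integral>x. (f x - h x)\<^sup>2 \<partial>M) \<le> 0"
    using L2_dist_le[OF assms(2,1,3)] by (intro LIMSEQ_le_const) auto
  then have "AE x in M. f x - h x = 0" by (intro L2_AE_eq_0 L2_diff assms)
  then show ?thesis by simp
qed

text \<open>Closedness of the form, phrased for the gradients: an $L^2$ limit of functions with converging
  gradients lies in the domain, and the functions converge to it in energy.\<close>

lemma closed_grad:
  assumes u: "\<And>n. u n \<in> CD" and h: "h \<in> L2 M"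
    and lim: "(\<lambda>n. \<integral>x. (u n x - h x)\<^sup>2 \<partial>M) \<longlonglongrightarrow> 0" and C: "Cauchy (\<lambda>n. grad (u n))"
  shows "h \<in> D" "(\<lambda>n. E (\<lambda>x. u n x - h x) (\<lambda>x. u n x - h x)) \<longlonglongrightarrow> 0"
proof -
  have uD: "u n \<in> D" and uL: "u n \<in> L2 M" for n using u[of n] D_L2 by auto
  have "\<exists>f\<in>D. (\<lambda>n. E1_norm M E (\<lambda>x. u n x - f x)) \<longlonglongrightarrow> 0"
  proof (rule E_closed[OF uD])
    fix e :: real assume e: "e > 0"
    obtain K1 where K1: "\<And>n. n \<ge> K1 \<Longrightarrow> (\<integral>x. (u n x - h x)\<^sup>2 \<partial>M) < e\<^sup>2 / 8"
      using order_tendstoD(2)[OF lim, of "e\<^sup>2 / 8"] e by (auto simp: eventually_sequentially)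
    obtain K2 where K2: "\<And>m n. m \<ge> K2 \<Longrightarrow> n \<ge> K2 \<Longrightarrow> dist (grad (u m)) (grad (u n)) < e / 2"
      using metric_CauchyD[OF C, of "e / 2"] e by auto
    have "E1_norm M E (\<lambda>x. u m x - u n x) < e" if mn: "m \<ge> max K1 K2" "n \<ge> max K1 K2" for m n
    proof -
      have "E (\<lambda>x. u m x - u n x) (\<lambda>x. u m x - u n x) = (dist (grad (u m)) (grad (u n)))\<^sup>2"
        using norm_grad[OF CD_diff[OF u u], of m n] grad_diff[OF u u, of m n]
            by (simp add: dist_norm)
      also have "\<dots> < (e / 2)\<^sup>2" using mn K2[of m n] by (intro power_strict_mono) auto
      finally have 1: "E (\<lambda>x. u m x - u n x) (\<lambda>x. u m x - u n x) < e\<^sup>2 / 4"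
          by (simp add: power_divide)
      have "(\<integral>x. (u m x - u n x)\<^sup>2 \<partial>M) \<le> 2 * (\<integral>x. (h x - u m x)\<^sup>2 \<partial>M) + 2 * (\<integral>x. (h x
          - u n x)\<^sup>2 \<partial>M)"
        by (rule L2_dist_le[OF uL h uL])
      also have "\<dots> < e\<^sup>2 / 2" using K1[of m] K1[of n] mn by (simp add: power2_commute)
      finally have "E (\<lambda>x. u m x - u n x) (\<lambda>x. u m x - u n x) + (\<integral>x. (u m x - u n x)\<^sup>2 \<partial>M) < e\<^sup>2"
        using 1 zero_le_power2[of e] by linarith
      then show ?thesis unfolding E1_norm_eq using e by (intro real_less_lsqrt) auto
    qed
    then show "\<exists>K. \<forall>m\<ge>K. \<forall>n\<ge>K. E1_norm M E (\<lambda>x. u m x - u n x) < e" by blast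
  qed
  then obtain f where f: "f \<in> D" and l: "(\<lambda>n. E1_norm M E (\<lambda>x. u n x - f x)) \<longlonglongrightarrow> 0" by blast
  note l' = E1_norm_tendsto_0_D[OF D_diff[OF uD f] l]
  have fh: "AE x in M. f x = h x"
    by (rule L2_limit_unique[OF uL D_L2[OF f] h l'(2) lim])
  show hD: "h \<in> D" using D_AE[OF f L2_measurable[OF h] fh] .
  have "E (\<lambda>x. u n x - f x) (\<lambda>x. u n x - f x) = E (\<lambda>x. u n x - h x) (\<lambda>x. u n x - h x)" for n
  proof -
    let ?a = "\<lambda>x. u n x - f x" and ?b = "\<lambda>x. u n x - h x"
    have d: "?a \<in> D" "?b \<in> D" using D_diff uD f hD by auto
    have ae: "AE x in M. ?a x = ?b x" using fh by eventually_elim simp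
    show ?thesis using E_AE[OF d(1,2,1) ae] E_AE[OF d(1,2,2) ae] E_sym[OF d] by simp
  qed
  then show "(\<lambda>n. E (\<lambda>x. u n x - h x) (\<lambda>x. u n x - h x)) \<longlonglongrightarrow> 0" using l'(1) by simp
qed

text \<open>For a bounded continuous limit, the gradients converge to its gradient.\<close>

lemma closed_grad_CD:
  assumes u: "\<And>n. u n \<in> CD" and h: "h \<in> L2 M" "h \<in> Cb"
    and lim: "(\<lambda>n. \<integral>x. (u n x - h x)\<^sup>2 \<partial>M) \<longlonglongrightarrow> 0" and C: "Cauchy (\<lambda>n. grad (u n))"
  shows "h \<in> CD" "(\<lambda>n. grad (u n)) \<longlonglongrightarrow> grad h"
proof -
  show hCD: "h \<in> CD" using closed_grad(1)[OF u h(1) lim C] h(2) by blast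
  have "E (\<lambda>x. u n x - h x) (\<lambda>x. u n x - h x) = (norm (grad (u n) - grad h))\<^sup>2" for n
    using norm_grad[OF CD_diff[OF u hCD]] grad_diff[OF u hCD] by simp
  then have "(\<lambda>n. (norm (grad (u n) - grad h))\<^sup>2) \<longlonglongrightarrow> 0"
    using closed_grad(2)[OF u h(1) lim C] by simp
  from tendsto_real_sqrt[OF this] show "(\<lambda>n. grad (u n)) \<longlonglongrightarrow> grad h"
    by (simp add: tendsto_norm_zero_iff LIM_zero_iff)
qed

text \<open>If \<open>a\<close> is the derivative of \<open>\<phi>\<close> on the unit interval, in the quantitative sense of the
  assumptions, then the staircases with slopes \<open>a (i/n)\<close> converge to \<open>\<phi>(f)\<close> in energy.\<close>

lemma chain_limit:
  assumes f: "f \<in> Cc \<inter> D" "\<And>x. 0 \<le> f x" "\<And>x. f x \<le> 1"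
    and \<phi>0: "\<phi> 0 = 0" and \<phi>c: "(\<lambda>x. \<phi> (f x)) \<in> Cb"
    and \<phi>: "\<And>s t. 0 \<le> s \<Longrightarrow> s \<le> t \<Longrightarrow> t \<le> 1 \<Longrightarrow> \<bar>\<phi> t - \<phi> s - a s * (t - s)\<bar> \<le> L * (t - s)\<^sup>2"
    and a: "\<And>s t. s \<in> {0..1} \<Longrightarrow> t \<in> {0..1} \<Longrightarrow> \<bar>a s - a t\<bar> \<le> L * \<bar>s - t\<bar>"
  shows "(\<lambda>x. \<phi> (f x)) \<in> CD"
    and "(\<lambda>n. grad (staircase (Suc n) a f)) \<longlonglongrightarrow> grad (\<lambda>x. \<phi> (f x))"
proof -
  have L: "L \<ge> 0" using a[of 0 1] by simp
  let ?u = "\<lambda>n. staircase (Suc n) a f"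
  have u: "?u n \<in> CD" for n by (rule staircase_CD[OF f(1,2)]) simp
  have fL: "f \<in> L2 M" using f(1) D_L2 by blast
  have hL: "(\<lambda>x. \<phi> (f x)) \<in> L2 M"
  proof -
    have hB: "(\<lambda>x. \<phi> (f x)) \<in> Bb" using \<phi>c by (rule Cb_subset_Bb)
    have "integrable M (\<lambda>x. (\<phi> (f x) * \<phi> (f x)) * 1)"
        by (rule integrable_Bb_mult[OF Bb_mult[OF hB hB]]) simp
    then show ?thesis using Bb_measurable[OF hB] by (simp add: L2_def power2_eq_square)
  qed
  have inv: "(\<lambda>n. L / real (Suc n)) \<longlonglongrightarrow> 0"
    using tendsto_mult[OF tendsto_const[of L] LIMSEQ_inverse_real_of_nat]
        by (simp add: divide_inverse)
  have lim: "(\<lambda>n. \<integral>x. (?u n x - \<phi> (f x))\<^sup>2 \<partial>M) \<longlonglongrightarrow> 0"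
  proof (rule tendsto_sandwich[OF _ _ tendsto_const])
    show "(\<lambda>n. (L / real (Suc n))\<^sup>2 * (\<integral>x. (f x)\<^sup>2 \<partial>M)) \<longlonglongrightarrow> 0"
      using tendsto_mult[OF tendsto_power[OF inv, of 2] tendsto_const] by simp
    have "(\<integral>x. (?u n x - \<phi> (f x))\<^sup>2 \<partial>M) \<le> (\<integral>x. (L / real (Suc n))\<^sup>2 * (f x)\<^sup>2 \<partial>M)" for n
    proof (rule integral_mono)
      show "integrable M (\<lambda>x. (?u n x - \<phi> (f x))\<^sup>2)"
        using u[of n] by (intro L2_integrable_square L2_diff hL) (auto intro: D_L2)
      show "integrable M (\<lambda>x. (L / real (Suc n))\<^sup>2 * (f x)\<^sup>2)" using L2_integrable_square[OF fL]
          by simp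
      fix x
      have "\<bar>\<phi> (f x) - ?u n x\<bar> \<le> L / real (Suc n) * f x"
        by (rule staircase_approx[of "Suc n" f x \<phi> a L, OF _ f(2,3) \<phi>0 \<phi>]) auto
      then have "\<bar>\<phi> (f x) - ?u n x\<bar>\<^sup>2 \<le> (L / real (Suc n) * f x)\<^sup>2" by (rule power_mono) simp
      then show "(?u n x - \<phi> (f x))\<^sup>2 \<le> (L / real (Suc n))\<^sup>2 * (f x)\<^sup>2"
        unfolding power_mult_distrib power2_abs by (simp only: power2_commute)
    qed
    then show "\<forall>\<^sub>F n in sequentially. (\<integral>x. (?u n x - \<phi> (f x))\<^sup>2 \<partial>M)
        \<le> (L / real (Suc n))\<^sup>2 * (\<integral>x. (f x)\<^sup>2 \<partial>M)"
      by simp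
  qed simp
  have C: "Cauchy (\<lambda>n. grad (?u n))"
  proof (rule metric_CauchyI)
    fix e :: real assume e: "e > 0"
    define N where "N = norm (grad f) + 1"
    have N: "N > 0" "norm (grad f) \<le> N" by (simp_all add: N_def add_nonneg_pos)
    obtain K where K: "\<And>n. n \<ge> K \<Longrightarrow> L / real (Suc n) < e / (2 * N)"
      using order_tendstoD(2)[OF inv, of "e / (2 * N)"] e N by (auto simp: eventually_sequentially)
    have "dist (grad (?u m)) (grad (?u n)) < e" if mn: "m \<ge> K" "n \<ge> K" for m n
    proof -
      have "dist (grad (?u m)) (grad (?u n)) \<le> L * (1 / real (Suc m)
          + 1 / real (Suc n)) * norm (grad f)"
        unfolding dist_norm by (rule norm_grad_staircase_diff_le[OF f _ _ L a]) auto
      also have "\<dots> \<le> L * (1 / real (Suc m) + 1 / real (Suc n)) * N"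
        using L N by (intro mult_left_mono mult_nonneg_nonneg add_nonneg_nonneg) auto
      also have "\<dots> = (L / real (Suc m) + L / real (Suc n)) * N" by (simp add: distrib_left)
      also have "\<dots> < (e / (2 * N) + e / (2 * N)) * N"
        using K[OF mn(1)] K[OF mn(2)] N by (intro mult_strict_right_mono add_strict_mono)
      also have "\<dots> = e" using N by simp
      finally show ?thesis .
    qed
    then show "\<exists>K. \<forall>m\<ge>K. \<forall>n\<ge>K. dist (grad (?u m)) (grad (?u n)) < e" by blast
  qed
  show "(\<lambda>x. \<phi> (f x)) \<in> CD" "(\<lambda>n. grad (staircase (Suc n) a f)) \<longlonglongrightarrow> grad (\<lambda>x. \<phi> (f x))"
    using closed_grad_CD[OF u hL \<phi>c lim C] .
qed

text \<open>Leibniz rule, in the form \<open>4 E(f^3, f) = 3 E(f^2, f^2)\<close>. For the staircases that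
  approximate \<open>f^2\<close> and \<open>f^3\<close>, the difference of the two sides, expanded over slices, has coefficients
  \<open>12 x_i (x_i - x_j)\<close> with \<open>x_i = i/n\<close> against the mixed energies. Those vanish unless \<open>i\<close> and \<open>j\<close> differ by at most one, so the difference is at most \<open>12 E(f, f) / n\<close>.\<close>

lemma square_cube_energy:
  assumes f: "f \<in> Cc \<inter> D" "\<And>x. 0 \<le> f x" "\<And>x. f x \<le> 1"
  shows "(\<lambda>x. f x * f x) \<in> CD" "(\<lambda>x. f x * f x * f x) \<in> CD"
    and "4 * E (\<lambda>x. f x * f x * f x) f = 3 * E (\<lambda>x. f x * f x) (\<lambda>x. f x * f x)"
proof -
  have fCD: "f \<in> CD" using f(1) Cc_subset_Cb by blast
  then have f2b: "(\<lambda>x. f x * f x) \<in> Cb" and f3b: "(\<lambda>x. f x * f x * f x) \<in> Cb"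
    by (auto intro: Cb_mult)
  have sq: "\<bar>t * t - s * s - 2 * s * (t - s)\<bar> \<le> 6 * (t - s)\<^sup>2" for s t :: real
  proof -
    have "t * t - s * s - 2 * s * (t - s) = (t - s)\<^sup>2" by (simp add: power2_eq_square algebra_simps)
    then show ?thesis by simp
  qed
  have cu: "\<bar>t * t * t - s * s * s - 3 * s * s * (t - s)\<bar> \<le> 6 * (t - s)\<^sup>2"
    if "0 \<le> s" "s \<le> t" "t \<le> 1" for s t :: real
  proof -
    have "t * t * t - s * s * s - 3 * s * s * (t - s) = (t + 2 * s) * (t - s)\<^sup>2"
      by (simp add: power2_eq_square algebra_simps)
    moreover have "\<bar>(t + 2 * s) * (t - s)\<^sup>2\<bar> \<le> 6 * (t - s)\<^sup>2"
      unfolding abs_mult using that by (intro mult_mono) auto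
    ultimately show ?thesis by simp
  qed
  have sq': "\<bar>2 * s - 2 * t\<bar> \<le> 6 * \<bar>s - t\<bar>" for s t :: real
  proof -
    have "\<bar>2 * (s - t)\<bar> \<le> 6 * \<bar>s - t\<bar>" unfolding abs_mult by simp
    then show ?thesis by (simp only: right_diff_distrib)
  qed
  have cu': "\<bar>3 * s * s - 3 * t * t\<bar> \<le> 6 * \<bar>s - t\<bar>" if "s \<in> {0..1}" "t \<in> {0..1}" for s t :: real
  proof -
    have "3 * s * s - 3 * t * t = (3 * (s + t)) * (s - t)" by (simp add: algebra_simps)
    moreover have "\<bar>(3 * (s + t)) * (s - t)\<bar> \<le> 6 * \<bar>s - t\<bar>"
      unfolding abs_mult using that by (intro mult_right_mono) auto
    ultimately show ?thesis by simp
  qed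
  note c2 = chain_limit[of f "\<lambda>t. t * t" "\<lambda>s. 2 * s" 6, OF f _ f2b sq sq']
  note c3 = chain_limit[of f "\<lambda>t. t * t * t" "\<lambda>s. 3 * s * s" 6, OF f _ f3b cu cu']
  show f2: "(\<lambda>x. f x * f x) \<in> CD" using c2(1) by simp
  show f3: "(\<lambda>x. f x * f x * f x) \<in> CD" using c3(1) by simp
  let ?s2 = "\<lambda>n. grad (staircase (Suc n) (\<lambda>s. 2 * s) f)"
  let ?s3 = "\<lambda>n. grad (staircase (Suc n) (\<lambda>s. 3 * s * s) f)"
  have l2: "?s2 \<longlonglongrightarrow> grad (\<lambda>x. f x * f x)" and l3: "?s3 \<longlonglongrightarrow> grad (\<lambda>x. f x * f x * f x)"
    using c2(2) c3(2) by simp_all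
  have bound: "\<bar>4 * inner (?s3 n) (grad f) - 3 * inner (?s2 n) (?s2 n)\<bar>
      \<le> 12 / real (Suc n) * inner (grad f) (grad f)" for n
  proof -
    let ?N = "Suc n"
    let ?v = "\<lambda>i. grad (slice ?N f i)"
    define x where "x i = real i / real ?N" for i
    have N: "?N > 0" by simp
    have gf: "grad f = (\<Sum>i<?N. 1 *\<^sub>R ?v i)" using sum_slice_energy[OF f N] by simp
    have e3: "inner (?s3 n) (grad f) = (\<Sum>i<?N. \<Sum>j<?N. (3 * x i * x i) * inner (?v i) (?v j))"
      unfolding staircase_CD(2)[OF f(1,2) N] gf inner_sum_sum by (simp add: x_def)
    have e2: "inner (?s2 n) (?s2 n) = (\<Sum>i<?N. \<Sum>j<?N. (2 * x i) * (2 * x j) * inner (?v i) (?v j))"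
      unfolding staircase_CD(2)[OF f(1,2) N] inner_sum_sum by (simp add: x_def)
    have "4 * inner (?s3 n) (grad f) - 3 * inner (?s2 n) (?s2 n) =
        (\<Sum>i<?N. \<Sum>j<?N. 4 * ((3 * x i * x i) * inner (?v i) (?v j))
            - 3 * ((2 * x i) * (2 * x j) * inner (?v i) (?v j)))"
      unfolding e3 e2 sum_distrib_left sum_subtractf by (rule refl)
    then have "\<bar>4 * inner (?s3 n) (grad f) - 3 * inner (?s2 n) (?s2 n)\<bar> =
        \<bar>\<Sum>i<?N. \<Sum>j<?N. 4 * ((3 * x i * x i) * inner (?v i) (?v j))
            - 3 * ((2 * x i) * (2 * x j) * inner (?v i) (?v j))\<bar>"
      by (rule arg_cong)
    also have "\<dots> \<le> (\<Sum>i<?N. \<Sum>j<?N. 12 / real ?N * inner (?v i) (?v j))"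
    proof (rule order_trans[OF sum_abs sum_mono], rule order_trans[OF sum_abs sum_mono])
      fix i j assume ij: "i \<in> {..<?N}" "j \<in> {..<?N}"
      have eq: "4 * ((3 * x i * x i) * inner (?v i) (?v j))
          - 3 * ((2 * x i) * (2 * x j) * inner (?v i) (?v j)) =
          (12 * x i * (x i - x j)) * inner (?v i) (?v j)" by (simp add: algebra_simps)
      have nn: "inner (?v i) (?v j) \<ge> 0" by (rule slice_energy_nonneg[OF f(1,2) N])
      show "\<bar>4 * ((3 * x i * x i) * inner (?v i) (?v j))
          - 3 * ((2 * x i) * (2 * x j) * inner (?v i) (?v j))\<bar>
          \<le> 12 / real ?N * inner (?v i) (?v j)"
      proof (cases "i + 2 \<le> j \<or> j + 2 \<le> i")
        case True
        then have "inner (?v i) (?v j) = 0" by (rule slice_energy_eq_0[OF f(1,2) N])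
        then show ?thesis by simp
      next
        case False
        then have "\<bar>real i - real j\<bar> \<le> 1" by linarith
        then have "\<bar>x i - x j\<bar> \<le> 1 / real ?N"
          unfolding x_def diff_divide_distrib[symmetric] abs_divide by (simp add: divide_right_mono)
        moreover have "0 \<le> x i" "x i \<le> 1" using ij(1) unfolding x_def
            by (simp_all add: divide_le_eq_1)
        ultimately have "\<bar>12 * x i * (x i - x j)\<bar> \<le> 12 * 1 * (1 / real ?N)"
          unfolding abs_mult by (intro mult_mono) auto
        then show ?thesis unfolding eq abs_mult[of _ "inner _ _"] abs_of_nonneg[OF nn]
          using nn by (intro mult_right_mono) auto
      qed
    qed
    also have "\<dots> = 12 / real ?N * inner (grad f) (grad f)"
      unfolding gf inner_sum_sum by (simp only: sum_distrib_left mult_1_left)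
    finally show ?thesis .
  qed
  have "(\<lambda>n. 4 * inner (?s3 n) (grad f) - 3 * inner (?s2 n) (?s2 n)) \<longlonglongrightarrow>
      4 * inner (grad (\<lambda>x. f x * f x * f x)) (grad f)
          - 3 * inner (grad (\<lambda>x. f x * f x)) (grad (\<lambda>x. f x * f x))"
    by (intro tendsto_intros l2 l3)
  moreover have "(\<lambda>n. 4 * inner (?s3 n) (grad f) - 3 * inner (?s2 n) (?s2 n)) \<longlonglongrightarrow> 0"
  proof (rule Lim_null_comparison)
    show "(\<lambda>n. 12 / real (Suc n) * inner (grad f) (grad f)) \<longlonglongrightarrow> 0"
      using tendsto_mult[OF tendsto_const[of "12 * inner (grad f) (grad f)"]
          LIMSEQ_inverse_real_of_nat]
      by (simp add: divide_inverse ac_simps)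
  qed (use bound in simp)
  ultimately have "4 * inner (grad (\<lambda>x. f x * f x * f x)) (grad f) -
      3 * inner (grad (\<lambda>x. f x * f x)) (grad (\<lambda>x. f x * f x)) = 0"
    by (rule LIMSEQ_unique)
  then show "4 * E (\<lambda>x. f x * f x * f x) f = 3 * E (\<lambda>x. f x * f x) (\<lambda>x. f x * f x)"
    unfolding inner_grad[OF f3 fCD] inner_grad[OF f2 f2] by simp
qed

lemma ess_bounded_Cb: "f \<in> Cb \<Longrightarrow> ess_bounded M f"
  unfolding ess_bounded_def Cb_iff by (metis AE_I2)

lemma grad_square:
  assumes f: "f \<in> Cc \<inter> D" "\<And>x. 0 \<le> f x" "\<And>x. f x \<le> 1"
  shows "grad (\<lambda>x. f x * f x) = 2 *\<^sub>R tens f f"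
proof -
  let ?f2 = "\<lambda>x. f x * f x" and ?f3 = "\<lambda>x. f x * f x * f x"
  note f2 = square_cube_energy(1)[OF f] and f3 = square_cube_energy(2)[OF f]
    and e = square_cube_energy(3)[OF f]
  have fCD: "f \<in> CD" using f(1) Cc_subset_Cb by blast
  have fB: "f \<in> Bb" using fCD Cb_subset_Bb by blast
  have eb: "ess_bounded M f" "ess_bounded M ?f2" using fCD f2 ess_bounded_Cb by auto
  have d: "f \<in> D" "?f2 \<in> D" "?f3 \<in> D" using fCD f2 f3 by auto
  have "2 * (\<integral>x. f x * \<Gamma> ?f2 f x \<partial>M) = E ?f3 f + E ?f2 ?f2 - E ?f3 f"
    by (rule \<Gamma>_product[OF d(2,1,1) eb(2,1,1)])
  then have 1: "2 * inner (grad ?f2) (tens f f) = E ?f2 ?f2"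
    using inner_tens[OF f2 fCD Bb_const[of 1] fB] by simp
  have "2 * (\<integral>x. ?f2 x * \<Gamma> f f x \<partial>M) = E (\<lambda>x. f x * ?f2 x) f + E (\<lambda>x. f x * ?f2 x) f - E ?f2 ?f2"
    by (rule \<Gamma>_product[OF d(1,1,2) eb(1,1,2)])
  moreover have "(\<lambda>x. f x * ?f2 x) = ?f3" by (simp add: mult.assoc)
  ultimately have 2: "2 * inner (tens f f) (tens f f) = 2 * E ?f3 f - E ?f2 ?f2"
    using inner_tens[OF fCD fCD fB fB] by simp
  have "inner (grad ?f2 - 2 *\<^sub>R tens f f) (grad ?f2 - 2 *\<^sub>R tens f f) =
      inner (grad ?f2) (grad ?f2) - 4 * inner (grad ?f2) (tens f f)
          + 4 * inner (tens f f) (tens f f)"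
    by (simp add: inner_diff_left inner_diff_right inner_commute)
  also have "\<dots> = 0" using 1 2 e inner_grad[OF f2 f2] by simp
  finally show ?thesis by simp
qed

section \<open>The derivation on the whole domain\<close>

lemma regular_sequence:
  assumes f: "f \<in> D"
  shows "\<exists>u. (\<forall>n. u n \<in> Cc \<inter> D) \<and> (\<lambda>n. E (\<lambda>x. u n x - f x) (\<lambda>x. u n x - f x)) \<longlonglongrightarrow> 0 \<and>
    (\<lambda>n. \<integral>x. (u n x - f x)\<^sup>2 \<partial>M) \<longlonglongrightarrow> 0"
proof -
  have "\<forall>n. \<exists>g. g \<in> Cc \<inter> D \<and> E1_norm M E (\<lambda>x. g x - f x) < inverse (real (Suc n))"
  proof
    fix n
    have "inverse (real (Suc n)) > 0" by simp
    then show "\<exists>g. g \<in> Cc \<inter> D \<and> E1_norm M E (\<lambda>x. g x - f x) < inverse (real (Suc n))"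
      using regular[unfolded regular_form_def, THEN conjunct1] f by blast
  qed
  from choice[OF this] obtain u
    where u': "\<forall>n. u n \<in> Cc \<inter> D \<and> E1_norm M E (\<lambda>x. u n x - f x) < inverse (real (Suc n))" ..
  have u: "u n \<in> Cc \<inter> D" and le: "E1_norm M E (\<lambda>x. u n x - f x) < inverse (real (Suc n))" for n
    using spec[OF u', of n] by (rule conjunct1, rule conjunct2)
  have d: "(\<lambda>x. u n x - f x) \<in> D" for n using u f by (intro D_diff) auto
  have "(\<lambda>n. E1_norm M E (\<lambda>x. u n x - f x)) \<longlonglongrightarrow> 0"
  proof (rule tendsto_sandwich[OF _ _ tendsto_const LIMSEQ_inverse_real_of_nat])
    show "\<forall>\<^sub>F n in sequentially. 0 \<le> E1_norm M E (\<lambda>x. u n x - f x)"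
      using E_nonneg[OF d] by (simp add: E1_norm_eq)
    show "\<forall>\<^sub>F n in sequentially. E1_norm M E (\<lambda>x. u n x - f x) \<le> inverse (real (Suc n))"
      using le by (simp add: less_imp_le)
  qed
  from E1_norm_tendsto_0_D[OF d this] show ?thesis using u by blast
qed

lemma E_Cauchy_Schwarz:
  assumes f: "f \<in> D" and g: "g \<in> D"
  shows "\<bar>E f g\<bar> \<le> sqrt (E f f) * sqrt (E g g)"
proof -
  have q: "0 \<le> E f f + 2 * t * E f g + t\<^sup>2 * E g g" for t
  proof -
    let ?h = "\<lambda>x. 1 * f x + t * g x"
    have h: "?h \<in> D" by (rule D_lincomb[OF f g])
    have "E ?h ?h = E f f + 2 * t * E f g + t\<^sup>2 * E g g"
      using E_lincomb[OF f g h, of 1 t] E_lincomb[OF f g f, of 1 t] E_lincomb[OF f g g, of 1 t]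
        E_sym[OF f h] E_sym[OF g h] E_sym[OF f g]
      by (simp add: power2_eq_square algebra_simps)
    then show ?thesis using E_nonneg[OF h] by simp
  qed
  have "(E f g)\<^sup>2 \<le> E f f * E g g"
  proof (cases "E g g = 0")
    case True
    have "E f g = 0"
    proof (rule ccontr)
      assume ne: "E f g \<noteq> 0"
      then have "2 * (- (E f f + 1) / (2 * E f g)) * E f g = - (E f f + 1)" by simp
      then show False using q[of "- (E f f + 1) / (2 * E f g)"] True by simp
    qed
    then show ?thesis using True by simp
  next
    case False
    then have p: "E g g > 0" using E_nonneg[OF g] by simp
    have "0 \<le> E f f - (E f g)\<^sup>2 / E g g"
      using q[of "- E f g / E g g"] False by (simp add: power2_eq_square)
    then show ?thesis using p by (simp add: field_simps)
  qed
  then have "sqrt ((E f g)\<^sup>2) \<le> sqrt (E f f * E g g)" by (rule real_sqrt_le_mono)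
  then show ?thesis by (simp add: real_sqrt_mult)
qed

lemma grad_Cauchy:
  assumes u: "\<And>n. u n \<in> CD" and f: "f \<in> D"
    and lim: "(\<lambda>n. E (\<lambda>x. u n x - f x) (\<lambda>x. u n x - f x)) \<longlonglongrightarrow> 0"
  shows "Cauchy (\<lambda>n. grad (u n))"
proof (rule metric_CauchyI)
  let ?d = "\<lambda>n x. u n x - f x"
  have uD: "u n \<in> D" for n using u[of n] by blast
  have d: "?d n \<in> D" for n by (rule D_diff[OF uD f])
  fix e :: real assume e: "e > 0"
  then obtain K where K: "\<And>n. n \<ge> K \<Longrightarrow> E (?d n) (?d n) < (e / 2)\<^sup>2"
    using order_tendstoD(2)[OF lim, of "(e / 2)\<^sup>2"] by (auto simp: eventually_sequentially)
  have "dist (grad (u m)) (grad (u n)) < e" if mn: "m \<ge> K" "n \<ge> K" for m n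
  proof -
    let ?a = "?d m" and ?b = "?d n" and ?c = "\<lambda>x. 1 * ?d m x + (-1) * ?d n x"
    have c: "?c \<in> D" by (rule D_lincomb[OF d d])
    have "(dist (grad (u m)) (grad (u n)))\<^sup>2 = E ?c ?c"
      using norm_grad[OF CD_diff[OF u u], of m n] grad_diff[OF u u, of m n] by (simp add: dist_norm)
    also have "\<dots> = E ?a ?a - 2 * E ?a ?b + E ?b ?b"
      using E_lincomb[OF d d c, of 1 m "-1" n] E_lincomb[OF d d d, of 1 m "-1" n m]
        E_lincomb[OF d d d, of 1 m "-1" n n] E_sym[OF d c, of m] E_sym[OF d c, of n] E_sym[OF d d,
            of m n]
      by simp
    also have "\<dots> \<le> E ?a ?a + 2 * (sqrt (E ?a ?a) * sqrt (E ?b ?b)) + E ?b ?b"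
      using E_Cauchy_Schwarz[OF d d, of m n] by linarith
    also have "\<dots> = (sqrt (E ?a ?a) + sqrt (E ?b ?b))\<^sup>2"
      using E_nonneg[OF d] by (simp add: power2_sum)
    finally have "dist (grad (u m)) (grad (u n)) \<le> sqrt (E ?a ?a) + sqrt (E ?b ?b)"
      by (rule power2_le_imp_le) (intro add_nonneg_nonneg real_sqrt_ge_zero E_nonneg d)
    moreover have "sqrt (E ?a ?a) < e / 2" "sqrt (E ?b ?b) < e / 2"
      using real_sqrt_less_mono[OF K[OF mn(1)]] real_sqrt_less_mono[OF K[OF mn(2)]] e
      by (simp_all only: real_sqrt_abs abs_of_pos half_gt_zero)
    ultimately show ?thesis by simp
  qed
  then show "\<exists>K. \<forall>m\<ge>K. \<forall>n\<ge>K. dist (grad (u m)) (grad (u n)) < e" by blast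
qed



text \<open>Closability of the derivation makes the limit of the gradients independent of the sequence.\<close>

lemma deriv_form_eqI:
  assumes f: "f \<in> L2 M" and u: "\<And>n. u n \<in> CD" "(\<lambda>n. \<integral>x. (u n x - f x)\<^sup>2 \<partial>M) \<longlonglongrightarrow> 0"
    and \<eta>: "(\<lambda>n. grad (u n)) \<longlonglongrightarrow> \<eta>"
  shows "deriv_form M D tens f = \<eta>"
  unfolding deriv_form_def l2_norm_tendsto_0_iff
proof (rule the_equality)
  show "\<exists>u. (\<forall>n. u n \<in> CD) \<and> (\<lambda>n. \<integral>x. (u n x - f x)\<^sup>2 \<partial>M) \<longlonglongrightarrow> 0 \<and> (\<lambda>n. grad (u n)) \<longlonglongrightarrow> \<eta>"
    using u \<eta> by blast
  fix \<zeta>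
  assume "\<exists>v. (\<forall>n. v n \<in> CD) \<and> (\<lambda>n. \<integral>x. (v n x - f x)\<^sup>2 \<partial>M) \<longlonglongrightarrow> 0 \<and> (\<lambda>n. grad (v n)) \<longlonglongrightarrow> \<zeta>"
  then obtain v where v: "\<forall>n. v n \<in> CD" "(\<lambda>n. \<integral>x. (v n x - f x)\<^sup>2 \<partial>M) \<longlonglongrightarrow> 0"
    "(\<lambda>n. grad (v n)) \<longlonglongrightarrow> \<zeta>" by (elim exE conjE)
  have vC: "v n \<in> CD" for n using v(1) by (rule spec)
  have uL: "u n \<in> L2 M" and vL: "v n \<in> L2 M" for n using u(1)[of n] vC[of n] by (auto intro: D_L2)
  define w where "w n x = v n x - u n x" for n x
  have wC: "w n \<in> CD" for n unfolding w_def[abs_def] by (rule CD_diff[OF vC u(1)])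
  have gw: "grad (w n) = grad (v n) - grad (u n)" for n
    unfolding w_def[abs_def] by (rule grad_diff[OF vC u(1)])
  have wl: "(\<lambda>n. grad (w n)) \<longlonglongrightarrow> \<zeta> - \<eta>" unfolding gw by (intro tendsto_diff v(3) \<eta>)
  have zL: "(\<lambda>x. 0) \<in> L2 M" using D_L2[OF D_zero] .
  have "(\<lambda>n. \<integral>x. (w n x - 0)\<^sup>2 \<partial>M) \<longlonglongrightarrow> 0"
  proof (rule tendsto_sandwich[OF _ _ tendsto_const])
    have "(\<lambda>n. 2 * (\<integral>x. (v n x - f x)\<^sup>2 \<partial>M) + 2 * (\<integral>x. (u n x - f x)\<^sup>2 \<partial>M)) \<longlonglongrightarrow> 2 * 0 + 2 * 0"
      by (intro tendsto_intros v(2) u(2))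
    then show "(\<lambda>n. 2 * (\<integral>x. (v n x - f x)\<^sup>2 \<partial>M) + 2 * (\<integral>x. (u n x - f x)\<^sup>2 \<partial>M)) \<longlonglongrightarrow> 0" by simp
    have "(\<integral>x. (w n x - 0)\<^sup>2 \<partial>M) \<le> 2 * (\<integral>x. (v n x - f x)\<^sup>2 \<partial>M) + 2 * (\<integral>x. (u n x - f x)\<^sup>2 \<partial>M)"
        for n
      using L2_dist_le[OF vL f uL, of n n] by (simp add: w_def power2_commute[of "f _"])
    then show "\<forall>\<^sub>F n in sequentially. (\<integral>x. (w n x - 0)\<^sup>2 \<partial>M) \<le>
        2 * (\<integral>x. (v n x - f x)\<^sup>2 \<partial>M) + 2 * (\<integral>x. (u n x - f x)\<^sup>2 \<partial>M)" by simp
  qed simp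
  from closed_grad(2)[OF wC zL this LIMSEQ_imp_Cauchy[OF wl]]
  have "(\<lambda>n. (norm (grad (w n)))\<^sup>2) \<longlonglongrightarrow> 0" by (simp add: norm_grad[OF wC])
  moreover have "(\<lambda>n. (norm (grad (w n)))\<^sup>2) \<longlonglongrightarrow> (norm (\<zeta> - \<eta>))\<^sup>2" by (intro tendsto_intros wl)
  ultimately have "0 = (norm (\<zeta> - \<eta>))\<^sup>2" by (rule LIMSEQ_unique)
  then show "\<zeta> = \<eta>" by simp
qed

lemma deriv_form_CD: "f \<in> CD \<Longrightarrow> deriv_form M D tens f = grad f"
  by (rule deriv_form_eqI[where u="\<lambda>_. f"]) (auto intro: D_L2)

lemma deriv_form_sequence:
  assumes f: "f \<in> D"
  shows "\<exists>u. (\<forall>n. u n \<in> Cc \<inter> D) \<and> (\<lambda>n. E (\<lambda>x. u n x - f x) (\<lambda>x. u n x - f x)) \<longlonglongrightarrow> 0 \<and>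
    (\<lambda>n. \<integral>x. (u n x - f x)\<^sup>2 \<partial>M) \<longlonglongrightarrow> 0 \<and> (\<lambda>n. grad (u n)) \<longlonglongrightarrow> deriv_form M D tens f"
proof -
  obtain u where u: "\<forall>n. u n \<in> Cc \<inter> D" and e: "(\<lambda>n. E (\<lambda>x. u n x - f x) (\<lambda>x. u n x - f x)) \<longlonglongrightarrow> 0"
    and l: "(\<lambda>n. \<integral>x. (u n x - f x)\<^sup>2 \<partial>M) \<longlonglongrightarrow> 0"
    using regular_sequence[OF f] by (elim exE conjE)
  have uC: "u n \<in> CD" for n using u Cc_subset_Cb by blast
  have "Cauchy (\<lambda>n. grad (u n))" by (rule grad_Cauchy[OF uC f e])
  then have "convergent (\<lambda>n. grad (u n))" by (simp add: Cauchy_convergent_iff)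
  then obtain \<eta> where \<eta>: "(\<lambda>n. grad (u n)) \<longlonglongrightarrow> \<eta>" unfolding convergent_def by (rule exE)
  have "deriv_form M D tens f = \<eta>" by (rule deriv_form_eqI[OF D_L2[OF f] uC l \<eta>])
  then show ?thesis using u e l \<eta> by (intro exI[of _ u] conjI) simp_all
qed

lemma inner_deriv_form:
  assumes f: "f \<in> D" and g: "g \<in> D"
  shows "inner (deriv_form M D tens f) (deriv_form M D tens g) = E f g"
proof -
  obtain u where u: "\<forall>n. u n \<in> Cc \<inter> D" and ue: "(\<lambda>n. E (\<lambda>x. u n x - f x) (\<lambda>x. u n x - f x)) \<longlonglongrightarrow> 0"
    and ul: "(\<lambda>n. grad (u n)) \<longlonglongrightarrow> deriv_form M D tens f"
    using deriv_form_sequence[OF f] by (elim exE conjE)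
  obtain v where v: "\<forall>n. v n \<in> Cc \<inter> D" and ve: "(\<lambda>n. E (\<lambda>x. v n x - g x) (\<lambda>x. v n x - g x)) \<longlonglongrightarrow> 0"
    and vl: "(\<lambda>n. grad (v n)) \<longlonglongrightarrow> deriv_form M D tens g"
    using deriv_form_sequence[OF g] by (elim exE conjE)
  have uC: "u n \<in> CD" and vC: "v n \<in> CD" for n using u v Cc_subset_Cb by auto
  have uD: "u n \<in> D" and vD: "v n \<in> D" for n using u v by auto
  let ?a = "\<lambda>n x. u n x - f x" and ?b = "\<lambda>n x. v n x - g x"
  have aD: "?a n \<in> D" and bD: "?b n \<in> D" for n by (rule D_diff uD vD f g)+
  have split: "E (u n) (v n) - E f g = E (?a n) (v n) + E (?b n) f" for n
    using E_lincomb[OF uD f vD, of 1 n "-1" n] E_lincomb[OF vD g f, of 1 n "-1"] E_sym[OF f vD, of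
        n] E_sym[OF f g]
    by simp
  have "(\<lambda>n. E (?a n) (v n) + E (?b n) f) \<longlonglongrightarrow> 0"
  proof (rule Lim_null_comparison)
    have "norm (E (?a n) (v n) + E (?b n) f) \<le>
        sqrt (E (?a n) (?a n)) * norm (grad (v n)) + sqrt (E (?b n) (?b n)) * sqrt (E f f)" for n
    proof -
      have "sqrt (E (v n) (v n)) = norm (grad (v n))" by (simp flip: norm_grad[OF vC])
      then show ?thesis
        using E_Cauchy_Schwarz[OF aD vD, of n n] E_Cauchy_Schwarz[OF bD f, of n] by simp
    qed
    then show "\<forall>\<^sub>F n in sequentially. norm (E (?a n) (v n) + E (?b n) f) \<le>
        sqrt (E (?a n) (?a n)) * norm (grad (v n)) + sqrt (E (?b n) (?b n)) * sqrt (E f f)" by simp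
    have "(\<lambda>n. sqrt (E (?a n) (?a n)) * norm (grad (v n)) + sqrt (E (?b n) (?b n)) * sqrt (E f f)) \<longlonglongrightarrow>
        sqrt 0 * norm (deriv_form M D tens g) + sqrt 0 * sqrt (E f f)"
      by (intro tendsto_intros ue ve vl)
    then show "(\<lambda>n. sqrt (E (?a n) (?a n)) * norm (grad (v n))
        + sqrt (E (?b n) (?b n)) * sqrt (E f f)) \<longlonglongrightarrow> 0"
      by simp
  qed
  then have "(\<lambda>n. E (u n) (v n)) \<longlonglongrightarrow> E f g" unfolding split[symmetric] by (simp add: LIM_zero_iff)
  moreover have "(\<lambda>n. E (u n) (v n)) \<longlonglongrightarrow> inner (deriv_form M D tens f) (deriv_form M D tens g)"
    using tendsto_inner[OF ul vl] by (simp add: inner_grad[OF uC vC])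
  ultimately show ?thesis by (rule LIMSEQ_unique[symmetric])
qed

text \<open>The coderivative is determined almost everywhere, because the domain is dense.\<close>

lemma coderiv_AE:
  assumes "is_coderiv M D tens \<eta> u"
  shows "AE x in M. coderiv M D tens \<eta> x = u x"
proof -
  let ?c = "coderiv M D tens \<eta>"
  have c: "is_coderiv M D tens \<eta> ?c" unfolding coderiv_def using assms
      by (rule someI[where P="is_coderiv M D tens \<eta>"])
  define v where "v x = ?c x - u x" for x
  have cL: "?c \<in> L2 M" and uL: "u \<in> L2 M" using c assms by (auto simp: is_coderiv_def)
  have vL: "v \<in> L2 M" unfolding v_def[abs_def] by (rule L2_diff[OF cL uL])
  have orth: "(\<integral>x. f x * v x \<partial>M) = 0" if f: "f \<in> D" for f
  proof -
    have "(\<integral>x. f x * ?c x \<partial>M) = (\<integral>x. f x * u x \<partial>M)"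
      using c assms f by (simp add: is_coderiv_def l2_inner_def)
    then show ?thesis
      using integrable_L2_mult[OF D_L2[OF f] cL] integrable_L2_mult[OF D_L2[OF f] uL]
      by (simp add: v_def right_diff_distrib)
  qed
  have le: "(\<integral>x. (v x)\<^sup>2 \<partial>M) \<le> (\<integral>x. (f x - v x)\<^sup>2 \<partial>M)" if f: "f \<in> D" for f
  proof -
    have fL: "f \<in> L2 M" using D_L2[OF f] .
    have "(\<integral>x. (f x - v x)\<^sup>2 \<partial>M) = (\<integral>x. (f x)\<^sup>2 - 2 * (f x * v x) + (v x)\<^sup>2 \<partial>M)"
      by (simp add: power2_diff algebra_simps)
    also have "\<dots> = (\<integral>x. (f x)\<^sup>2 \<partial>M) - 2 * (\<integral>x. f x * v x \<partial>M) + (\<integral>x. (v x)\<^sup>2 \<partial>M)"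
      using L2_integrable_square[OF fL] L2_integrable_square[OF vL] integrable_L2_mult[OF fL vL]
          by simp
    finally show ?thesis using orth[OF f] by simp
  qed
  have "(\<integral>x. (v x)\<^sup>2 \<partial>M) \<le> 0"
  proof (rule ccontr)
    assume n: "\<not> (\<integral>x. (v x)\<^sup>2 \<partial>M) \<le> 0"
    then have "sqrt (\<integral>x. (v x)\<^sup>2 \<partial>M) > 0" by simp
    from D_dense[OF vL this] obtain f where f: "f \<in> D" "l2_norm M (\<lambda>x. f x - v x)
        < sqrt (\<integral>x. (v x)\<^sup>2 \<partial>M)"
      by (rule bexE)
    then show False using le[OF f(1)] by (simp add: l2_norm_eq)
  qed
  from L2_AE_eq_0[OF vL this] show ?thesis by (simp add: v_def)
qed

end

section \<open>Skew symmetry\<close>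

context harmonic_frame
begin

lemma inner_grad_\<omega>:
  assumes f: "f \<in> CD"
  shows "inner (grad f) \<omega> = 0"
proof -
  have h: "\<omega> \<in> dom_coderiv M D tens" "AE x in M. coderiv M D tens \<omega> x = 0"
    using harmonic by (simp_all add: harmonic_form_def)
  from h(1) have c: "is_coderiv M D tens \<omega> (coderiv M D tens \<omega>)"
    unfolding dom_coderiv_def coderiv_def by (simp add: someI_ex)
  then have "inner (grad f) \<omega> = (\<integral>x. f x * coderiv M D tens \<omega> x \<partial>M)"
    using f deriv_form_CD[OF f] by (auto simp: is_coderiv_def l2_inner_def)
  also have "\<dots> = 0" using h(2) by (intro integral_eq_zero_AE) auto
  finally show ?thesis .
qed

lemma tens_square_\<omega>:
  assumes f: "f \<in> Cc \<inter> D" "\<And>x. 0 \<le> f x"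
  shows "inner (tens f f) \<omega> = 0"
proof -
  have fC: "f \<in> CD" and fB: "f \<in> Bb" using f(1) Cc_subset_Cb Cb_subset_Bb by auto
  obtain B where B: "\<And>x. \<bar>f x\<bar> \<le> B" using fB by (auto simp: Bb_iff)
  \<comment> \<open>Rescaling makes the function take values in the unit interval.\<close>
  define c where "c = inverse (\<bar>B\<bar> + 1)"
  have c: "c > 0" by (simp add: c_def add_nonneg_pos)
  let ?g = "\<lambda>x. c * f x"
  have g: "?g \<in> Cc \<inter> D" using f(1) Cc_lincomb[of f f c 0] D_scale[of f c] by auto
  have g1: "?g x \<le> 1" for x
  proof -
    have "f x \<le> \<bar>B\<bar> + 1" using B[of x] by linarith
    then have "c * f x \<le> c * (\<bar>B\<bar> + 1)" using c by simp
    also have "\<dots> = 1" unfolding c_def by (intro left_inverse) linarith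
    finally show ?thesis .
  qed
  have g0: "0 \<le> ?g x" for x using c f(2) by simp
  have gC: "?g \<in> CD" and gB: "?g \<in> Bb" using g Cc_subset_Cb Cb_subset_Bb by auto
  have "tens ?g ?g = (c * c) *\<^sub>R tens f f"
    using tens_lincomb_left[OF fC fC gB, of c 0] tens_lincomb_right[OF fC fB fB, of c 0] by simp
  moreover have "2 * inner (tens ?g ?g) \<omega> = 0"
    using grad_square[OF g g0 g1] inner_grad_\<omega>[OF square_cube_energy(1)[OF g g0 g1]] by simp
  ultimately show ?thesis using c by simp
qed

text \<open>The form \<open>f \<partial>g + g \<partial>f\<close> is orthogonal to \<open>\<omega>\<close>. For nonnegative functions this follows from the
  quadratic case by polarization; signed functions are split into positive and negative parts.\<close>

lemma tens_symmetric_\<omega>: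
  assumes f: "f \<in> Cc \<inter> D" and g: "g \<in> Cc \<inter> D"
  shows "inner (tens f g + tens g f) \<omega> = 0"
proof -
  define B where "B f g = inner (tens f g + tens g f) \<omega>" for f g
  have CDI: "f \<in> CD" and BbI: "f \<in> Bb" if "f \<in> Cc \<inter> D" for f
    using that Cc_subset_Cb Cb_subset_Bb by auto
  have lin: "B (\<lambda>x. a * f x + b * h x) g = a * B f g + b * B h g"
    if "f \<in> Cc \<inter> D" "g \<in> Cc \<inter> D" "h \<in> Cc \<inter> D" for f g h a b
    unfolding B_def tens_lincomb_left[OF CDI[OF that(1)] CDI[OF that(3)] BbI[OF that(2)]]
      tens_lincomb_right[OF CDI[OF that(2)] BbI[OF that(1)] BbI[OF that(3)]]
    by (simp add: inner_add_left algebra_simps)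
  have sym: "B f g = B g f" for f g by (simp add: B_def add.commute)
  have pos: "B f g = 0" if f: "f \<in> Cc \<inter> D" "\<And>x. 0 \<le> f x" and g: "g \<in> Cc \<inter> D" "\<And>x. 0 \<le> g x" for f g
  proof -
    let ?h = "\<lambda>x. 1 * f x + 1 * g x"
    have h: "?h \<in> Cc \<inter> D" using Cc_lincomb[of f g 1 1] D_lincomb[of f g 1 1] f(1) g(1) by blast
    have h0: "0 \<le> ?h x" for x using f(2) g(2) by simp
    have diag: "B k k = 0" if "k \<in> Cc \<inter> D" "\<And>x. 0 \<le> k x" for k
      using tens_square_\<omega>[OF that] by (simp add: B_def inner_add_left)
    have "B ?h ?h = B f ?h + B g ?h" using lin[OF f(1) h g(1), of 1 1] by simp
    moreover have "B f ?h = B f f + B g f" using lin[OF f(1) f(1) g(1), of 1 1]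
        unfolding sym[of f ?h] by simp
    moreover have "B g ?h = B f g + B g g" using lin[OF f(1) g(1) g(1), of 1 1]
        unfolding sym[of g ?h] by simp
    ultimately show ?thesis
      using diag[OF h h0] diag[OF f] diag[OF g] sym[of g f] by simp
  qed
  have parts: "\<exists>p q. p \<in> Cc \<inter> D \<and> q \<in> Cc \<inter> D \<and> (\<forall>x. 0 \<le> p x) \<and> (\<forall>x. 0 \<le> q x) \<and> f = (\<lambda>x. 1 * p x
      + (-1) * q x)"
    if f: "f \<in> Cc \<inter> D" for f
  proof -
    obtain C where C: "\<And>x. \<bar>f x\<bar> \<le> C" using BbI[OF f] by (auto simp: Bb_iff)
    define p where "p x = max 0 (f x)" for x
    have "p = (\<lambda>x. min (\<bar>C\<bar> + 1) (max 0 (f x)))"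
    proof
      fix x show "p x = min (\<bar>C\<bar> + 1) (max 0 (f x))" using C[of x] by (auto simp: p_def)
    qed
    then have pD: "p \<in> D" using unit_scale_D(1)[of f "\<bar>C\<bar> + 1"] f by (simp add: add_nonneg_pos)
    obtain K where cf: "continuous_on UNIV f" and K: "compact K" "\<forall>x. x \<notin> K \<longrightarrow> f x = 0"
      by (rule CcE[OF IntD1[OF f]])
    have "continuous_on UNIV p" unfolding p_def[abs_def] by (intro continuous_intros cf)
    then have pC: "p \<in> Cc" unfolding Cc_iff using K by (intro conjI exI[of _ K]) (auto simp: p_def)
    have q: "(\<lambda>x. 1 * p x + (-1) * f x) \<in> Cc \<inter> D"
        using Cc_lincomb[OF pC IntD1[OF f]] D_lincomb[OF pD IntD2[OF f]] by blast
    show ?thesis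
      by (rule exI[of _ p], rule exI[of _ "\<lambda>x. 1 * p x
          + (-1) * f x"]) (use pC pD q in \<open>auto simp: p_def\<close>)
  qed
  obtain p q where pq: "p \<in> Cc \<inter> D" "q \<in> Cc \<inter> D" "\<forall>x. 0 \<le> p x" "\<forall>x. 0 \<le> q x" and fpq: "f
      = (\<lambda>x. 1 * p x + (-1) * q x)"
    using parts[OF f] by (elim exE conjE)
  obtain r s where rs: "r \<in> Cc \<inter> D" "s \<in> Cc \<inter> D" "\<forall>x. 0 \<le> r x" "\<forall>x. 0 \<le> s x" and grs: "g
      = (\<lambda>x. 1 * r x + (-1) * s x)"
    using parts[OF g] by (elim exE conjE)
  have zero: "B p' g = 0" if "p' \<in> Cc \<inter> D" "\<forall>x. 0 \<le> p' x" for p'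
  proof -
    have "B g p' = 1 * B r p' + (-1) * B s p'" unfolding grs by (rule lin[OF rs(1) that(1) rs(2)])
    then show ?thesis
      using pos[OF rs(1) _ that(1)] pos[OF rs(2) _ that(1)] rs that by (simp add: sym[of p' g])
  qed
  have "B f g = 1 * B p g + (-1) * B q g" unfolding fpq by (rule lin[OF pq(1) g pq(2)])
  then have "B f g = 0" using zero[OF pq(1,3)] zero[OF pq(2,4)] by simp
  then show ?thesis by (simp add: B_def)
qed

text \<open>Both sides are continuous along regular approximating sequences, as \<open>\<star>\<close> is isometric.\<close>

lemma inner_star_deriv_skew:
  assumes f: "f \<in> D" and g: "g \<in> D"
  shows "inner (star f) (deriv_form M D tens g) = - inner (star g) (deriv_form M D tens f)"
proof -
  have star_lim: "(\<lambda>n. star (u n)) \<longlonglongrightarrow> star f"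
    if f: "f \<in> D" and u: "\<And>n. u n \<in> Cc \<inter> D" and l: "(\<lambda>n. \<integral>x. (u n x - f x)\<^sup>2 \<partial>M) \<longlonglongrightarrow> 0" for f u
  proof -
    have uL: "u n \<in> L2 M" for n using u[of n] D_L2 by blast
    have fL: "f \<in> L2 M" using D_L2[OF f] .
    have "(norm (star (u n) - star f))\<^sup>2 = (\<integral>x. (u n x - f x)\<^sup>2 \<partial>M)" for n
    proof -
      let ?d = "\<lambda>x. u n x - f x"
      have dL: "?d \<in> L2 M" by (rule L2_diff[OF uL fL])
      have "AE x in M. \<beta> (star (u n) - star f) \<eta> x = ?d x * \<beta> \<omega> \<eta> x" for \<eta>
        using \<beta>_diff[of "star (u n)" "star f" \<eta>] star_\<beta>[OF uL, of n \<eta>] star_\<beta>[OF fL, of \<eta>]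
        by eventually_elim (simp add: left_diff_distrib)
      then have s: "star ?d = star (u n) - star f" by (rule star_eqI)
      have "(norm (star ?d))\<^sup>2 = (\<integral>x. ?d x * \<beta> (star ?d) \<omega> x \<partial>M)"
        using inner_star[OF dL, of "star ?d"] by (simp add: power2_norm_eq_inner l2_inner_def)
      also have "\<dots> = (\<integral>x. (?d x)\<^sup>2 \<partial>M)"
      proof (rule integral_cong_AE)
        show "(\<lambda>x. ?d x * \<beta> (star ?d) \<omega> x) \<in> borel_measurable M"
          by (intro borel_measurable_times L2_measurable dL coefficient_L2)
        show "(\<lambda>x. (?d x)\<^sup>2) \<in> borel_measurable M"
          by (intro borel_measurable_power L2_measurable dL)
        show "AE x in M. ?d x * \<beta> (star ?d) \<omega> x = (?d x)\<^sup>2"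
          using star_\<beta>[OF dL, of \<omega>] \<beta>_\<omega>_\<omega> by eventually_elim (simp add: power2_eq_square)
      qed
      finally show ?thesis unfolding s .
    qed
    then have "(\<lambda>n. (norm (star (u n) - star f))\<^sup>2) \<longlonglongrightarrow> 0" using l by simp
    from tendsto_real_sqrt[OF this] show ?thesis by (simp add: tendsto_norm_zero_iff LIM_zero_iff)
  qed
  obtain u where u: "\<forall>n. u n \<in> Cc \<inter> D" and ue: "(\<lambda>n. \<integral>x. (u n x - f x)\<^sup>2 \<partial>M) \<longlonglongrightarrow> 0"
    and ul: "(\<lambda>n. grad (u n)) \<longlonglongrightarrow> deriv_form M D tens f"
    using deriv_form_sequence[OF f] by (elim exE conjE)
  obtain v where v: "\<forall>n. v n \<in> Cc \<inter> D" and ve: "(\<lambda>n. \<integral>x. (v n x - g x)\<^sup>2 \<partial>M) \<longlonglongrightarrow> 0"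
    and vl: "(\<lambda>n. grad (v n)) \<longlonglongrightarrow> deriv_form M D tens g"
    using deriv_form_sequence[OF g] by (elim exE conjE)
  have eq: "inner (star p) (grad q) = inner (tens q p) \<omega>" if "p \<in> Cc \<inter> D" "q \<in> Cc \<inter> D" for p q
  proof -
    have pB: "p \<in> Bb" and qC: "q \<in> CD" using that Cc_subset_Cb Cb_subset_Bb by auto
    have "inner (star p) (grad q) = inner \<omega> (fmul p (grad q))"
      unfolding star_Bb[OF pB] by (rule inner_form_mult[OF pB])
    then show ?thesis using form_mult_tens[OF pB qC Bb_const] by (simp add: inner_commute)
  qed
  have "inner (star (u n)) (grad (v n)) + inner (star (v n)) (grad (u n)) = 0" for n
    using tens_symmetric_\<omega>[OF spec[OF u] spec[OF v], of n n]
    unfolding eq[OF spec[OF u] spec[OF v]] eq[OF spec[OF v] spec[OF u]]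
        by (simp add: inner_add_left)
  moreover have "(\<lambda>n. inner (star (u n)) (grad (v n)) + inner (star (v n)) (grad (u n))) \<longlonglongrightarrow>
      inner (star f) (deriv_form M D tens g) + inner (star g) (deriv_form M D tens f)"
    by (intro tendsto_intros star_lim[OF f spec[OF u] ue] star_lim[OF g spec[OF v] ve] ul vl)
  ultimately have "inner (star f) (deriv_form M D tens g) + inner (star g) (deriv_form M D tens f)
      = 0"
    by (simp add: LIMSEQ_const_iff)
  then show ?thesis by simp
qed

lemma is_coderiv_star:
  assumes f: "f \<in> D"
  shows "is_coderiv M D tens (star f) (\<lambda>x. - \<beta> (deriv_form M D tens f) \<omega> x)"
  unfolding is_coderiv_def
proof (intro conjI ballI)
  let ?c = "\<beta> (deriv_form M D tens f) \<omega>"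
  show "(\<lambda>x. - ?c x) \<in> L2 M" using L2_lincomb[OF coefficient_L2 coefficient_L2, of "-1" _ 0] by simp
  fix h assume h: "h \<in> D"
  have "inner (deriv_form M D tens h) (star f) = - inner (star h) (deriv_form M D tens f)"
    using inner_star_deriv_skew[OF f h] by (simp add: inner_commute)
  also have "\<dots> = l2_inner M h (\<lambda>x. - ?c x)"
    unfolding inner_star[OF D_L2[OF h]] l2_inner_def by simp
  finally show "inner (deriv_form M D tens h) (star f) = l2_inner M h (\<lambda>x. - ?c x)" .
qed

lemma l2_inner_cong_AE:
  assumes "f \<in> L2 M" "f' \<in> L2 M" "g \<in> L2 M" "g' \<in> L2 M"
    and "AE x in M. f x = f' x" "AE x in M. g x = g' x"
  shows "l2_inner M f g = l2_inner M f' g'"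
  unfolding l2_inner_def
proof (rule integral_cong_AE)
  show "AE x in M. f x * g x = f' x * g' x" using assms(5,6) by eventually_elim simp
qed (intro borel_measurable_times L2_measurable assms)+

theorem skew_and_extension:
  "(\<forall>f\<in>D. \<forall>g\<in>D.
      l2_inner M f (hodge_star_inv M D \<Gamma> tens \<omega> (deriv_form M D tens g)) =
      - l2_inner M (hodge_star_inv M D \<Gamma> tens \<omega> (deriv_form M D tens f)) g) \<and>
   D \<subseteq> dom_E_perp M D \<Gamma> tens \<omega> \<and>
   (\<forall>f\<in>D. \<forall>g\<in>D. E_perp M D \<Gamma> tens \<omega> f g = E f g)"
proof (intro conjI ballI subsetI)
  fix f g assume f: "f \<in> D" and g: "g \<in> D"
  have inv: "l2_inner M h (hodge_star_inv M D \<Gamma> tens \<omega> \<eta>) = inner (star h) \<eta>" if "h \<in> D" for h \<eta>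
    unfolding inner_star[OF D_L2[OF that]]
    by (intro l2_inner_cong_AE D_L2 that star_inv_L2 coefficient_L2 star_inv_AE) simp
  have comm: "l2_inner M p q = l2_inner M q p" for p q by (simp add: l2_inner_def mult.commute)
  show "l2_inner M f (hodge_star_inv M D \<Gamma> tens \<omega> (deriv_form M D tens g)) =
      - l2_inner M (hodge_star_inv M D \<Gamma> tens \<omega> (deriv_form M D tens f)) g"
    unfolding comm[of _ g] inv[OF f] inv[OF g] by (rule inner_star_deriv_skew[OF f g])
  have c: "is_coderiv M D tens (star h) (coderiv M D tens (star h))" if "h \<in> D" for h
    unfolding coderiv_def using is_coderiv_star[OF that]
        by (rule someI[where P="is_coderiv M D tens (star h)"])
  let ?b = "\<lambda>h x. - \<beta> (deriv_form M D tens h) \<omega> x"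
  have L: "coderiv M D tens (star h) \<in> L2 M" "?b h \<in> L2 M" if "h \<in> D" for h
    using c[OF that] is_coderiv_star[OF that] by (simp_all add: is_coderiv_def)
  have "E_perp M D \<Gamma> tens \<omega> f g = l2_inner M (?b f) (?b g)"
    unfolding E_perp_def
    by (intro l2_inner_cong_AE L f g coderiv_AE is_coderiv_star)
  also have "\<dots> = l2_inner M (\<beta> (deriv_form M D tens f) \<omega>) (\<beta> (deriv_form M D tens g) \<omega>)"
    by (simp add: l2_inner_def)
  also have "\<dots> = E f g" by (simp add: l2_inner_coefficient inner_deriv_form[OF f g])
  finally show "E_perp M D \<Gamma> tens \<omega> f g = E f g" .
next
  fix f assume f: "f \<in> D"
  then show "f \<in> dom_E_perp M D \<Gamma> tens \<omega>"
    unfolding dom_E_perp_def dom_coderiv_def using D_L2[OF f] is_coderiv_star[OF f] by blast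
qed

end

theorem lemma4p9:
  fixes M :: "'a::metric_space measure"
    and D :: "('a \<Rightarrow> real) set"
    and E :: "('a \<Rightarrow> real) \<Rightarrow> ('a \<Rightarrow> real) \<Rightarrow> real"
    and \<Gamma> :: "('a \<Rightarrow> real) \<Rightarrow> ('a \<Rightarrow> real) \<Rightarrow> 'a \<Rightarrow> real"
    and tens :: "('a \<Rightarrow> real) \<Rightarrow> ('a \<Rightarrow> real) \<Rightarrow> 'h::{real_inner,complete_space}"
    and \<omega> :: 'h
  assumes "metric_measure_setting M"
    and "dirichlet_form M D E"
    and "regular_form M D E"
    and "strongly_local M D E"
    and "carre_du_champ M D E \<Gamma>"
    and "one_forms M D \<Gamma> tens"
    and "has_hino_index M D \<Gamma> 1"
    and "harmonic_form M D tens \<omega>"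
    and "is_form_measure D tens \<omega> M"
  shows "(\<forall>f\<in>D. \<forall>g\<in>D.
            l2_inner M f (hodge_star_inv M D \<Gamma> tens \<omega> (deriv_form M D tens g)) =
            - l2_inner M (hodge_star_inv M D \<Gamma> tens \<omega> (deriv_form M D tens f)) g) \<and>
         D \<subseteq> dom_E_perp M D \<Gamma> tens \<omega> \<and>
         (\<forall>f\<in>D. \<forall>g\<in>D. E_perp M D \<Gamma> tens \<omega> f g = E f g)"
proof -
  have "finite_measure M" using assms(9) by (simp add: is_form_measure_def)
  then interpret harmonic_frame M D E \<Gamma> tens \<omega>
    using assms by (intro harmonic_frame.intro local_dirichlet_forms.intro
        harmonic_frame_axioms.intro)
  show ?thesis by (rule skew_and_extension)
qed

end
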